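(* Let $K$ be an imaginary quadratic number field, with discriminant $D_K$, ring of integers $\mathcal{O}_K$ and Dedekind zeta function $\zeta_K$. For $x\in\mathcal{O}_K\smallsetminus\{0\}$ let $\mathbf{d}_K(x)=\operatorname{Card}\{d\in\mathcal{O}_K\smallsetminus\{0\}: d\mid x\}$. Then, as $X\to+\infty$, \[ \sum_{x\in\mathcal{O}_K\smallsetminus\{0,-1\},\ |x|^2\le X}\mathbf{d}_K(x)\,\mathbf{d}_K(x+1)=\frac{8\,\pi^3}{|D_K|^{3/2}\,\zeta_K(2)}\;X(\ln X)^2+O(X\ln X). \]
   Context: $K$ is viewed as a subfield of $\mathbb{C}$ and $|x|$ is the usual complex absolute value. Divisibility is in the ring $\mathcal{O}_K$, and divisors are counted as elements (associates are counted separately). *)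

theory Defs
  imports
    "HOL-Analysis.Analysis"
    "HOL-Library.Landau_Symbols"
    "HOL-Algebra.Divisibility"
    "HOL-Algebra.QuotRing"
    "HOL-Algebra.Embedded_Algebras"
    "HOL-Algebra.Algebraic_Closure_Type"
begin

abbreviation complex_ring :: "complex ring" where
  "complex_ring \<equiv> ring_of_type_algebra"

text \<open>
  Number fields are subfields of the complex numbers. A quadratic field is imaginary if it
  has no real embedding; being Galois over the rationals, it then is not contained in the reals,
  and conversely.
\<close>

definition imaginary_quadratic_field :: "complex set \<Rightarrow> bool" where
  "imaginary_quadratic_field K \<longleftrightarrow>
     subfield K complex_ring \<and> ring.dimension complex_ring 2 \<rat> K \<and> \<not> K \<subseteq> \<real>"

definition integers_of :: "complex set \<Rightarrow> complex set" where
  "integers_of K = {x \<in> K. algebraic_int x}"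

definition ring_of_integers :: "complex set \<Rightarrow> complex ring" where
  "ring_of_integers K = complex_ring\<lparr>carrier := integers_of K\<rparr>"

text \<open>
  Embeddings are made extensional (undefined outside of the field), so that distinct elements of
  this set are distinct as maps on the field.
\<close>

definition field_embeddings :: "complex set \<Rightarrow> (complex \<Rightarrow> complex) set" where
  "field_embeddings K = ring_hom (complex_ring\<lparr>carrier := K\<rparr>) complex_ring \<inter> extensional K"

definition field_trace :: "complex set \<Rightarrow> complex \<Rightarrow> complex" where
  "field_trace K x = (\<Sum>\<sigma>\<in>field_embeddings K. \<sigma> x)"

definition integral_basis2 :: "complex set \<Rightarrow> complex \<Rightarrow> complex \<Rightarrow> bool" where
  "integral_basis2 K u v \<longleftrightarrow>
     u \<in> integers_of K \<and> v \<in> integers_of K \<and>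
     (\<forall>x\<in>integers_of K. \<exists>!(a, b). x = of_int a * u + of_int b * v)"

text \<open>
  The determinant of the Gram matrix of the trace form on an integral basis; it does not depend
  on the choice of the basis.
\<close>

definition quadratic_discriminant :: "complex set \<Rightarrow> int" where
  "quadratic_discriminant K =
     (THE D. \<exists>u v. integral_basis2 K u v \<and>
        of_int D = field_trace K (u * u) * field_trace K (v * v)
                   - field_trace K (u * v) * field_trace K (v * u))"

definition ideal_norm :: "complex set \<Rightarrow> complex set \<Rightarrow> nat" where
  "ideal_norm K I = card (carrier (ring_of_integers K Quot I))"

text \<open>
  The Dirichlet series over all nonzero ideals. It represents the Dedekind zeta function only in
  the half-plane of absolute convergence, where the real part of the argument exceeds 1.
\<close>

definition dedekind_zeta :: "complex set \<Rightarrow> complex \<Rightarrow> complex" where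
  "dedekind_zeta K s =
     (\<Sum>\<^sub>\<infinity>I\<in>{I. ideal I (ring_of_integers K) \<and> I \<noteq> {0}}. of_nat (ideal_norm K I) powr (- s))"

definition divisor_count :: "complex set \<Rightarrow> complex \<Rightarrow> nat" where
  "divisor_count K x = card {d \<in> integers_of K - {0}. d divides\<^bsub>ring_of_integers K\<^esub> x}"

end

theory Submission
  imports Defs
begin

text \<open>
  A divisor \<open>a\<close> of \<open>x + 1\<close> and a divisor \<open>b\<close> of \<open>x\<close> are coprime. By the hyperbola method it suffices,
  up to a factor 4 and an admissible error, to sum over small \<open>a\<close> and \<open>b\<close>. For fixed coprime \<open>a\<close>
  and \<open>b\<close> the possible \<open>x\<close> form a coset of the ideal \<open>(a b)\<close>, so the number of \<open>x\<close> in the disc is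
  \<open>\<kappa> T / (N(a) N(b))\<close> with \<open>\<kappa> = 2 \<pi> / \<surd>\<bar>D\<bar>\<close>, up to errors whose sum is \<open>O(T ln T)\<close>.

  The Moebius function on ideals turns the remaining sum of \<open>1 / (N(a) N(b))\<close> over coprime pairs
  into \<open>\<Sum> \<mu>(I) h(I)\<^sup>2\<close>, where \<open>h(I)\<close> is the sum of \<open>1 / N(a)\<close> over the nonzero \<open>a\<close> in \<open>I\<close> with
  \<open>N(a) \<le> Q\<close>. Every ideal is homothetic to one of finitely many, hence
  \<open>h(I) = (\<kappa> ln Q + O(1 + ln N(I))) / N(I)\<close> uniformly in \<open>I\<close>; finally \<open>\<Sum> \<mu>(I) / N(I)\<^sup>2 = 1 / \<zeta>(2)\<close>.
\<close>

section \<open>Lattice points in discs\<close>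

text \<open>The variable x is an element, but the Moebius function lives on ideals, since elements
  need not factor uniquely. The ideal theory hangs on one identity, I I' = N(I) O with I' the
  conjugate of I: up to an integer, I' is an inverse of I, so cancellation, multiplicativity of N
  and "to contain is to divide" follow formally. The cutoff for the norms of a and b is Q = \<surd>T
  + 1, which bounds both |x| and |x + 1|. Then N(a b) can reach Q^2, of order T, where the disc
  holds only boundedly many points of (a b). About Q^2 pairs with an error O(1) each give O(T), and
  the boundary terms cost one logarithm more: hence O(T ln T). Since ln Q is about (ln T) / 2, the
  factor 4 of the hyperbola method cancels against the 1/4 from (ln Q)^2, and \<kappa>^3 /
  \<zeta>(2) remains. The delicate point is uniformity in I: the constant in the lattice count
  depends on the shape of I, and only the reduction to finitely many shapes makes the sum over I
  converge.\<close>

definition brick_lattice :: "real \<Rightarrow> complex \<Rightarrow> complex set" where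
  "brick_lattice p q = {of_int m * of_real p + of_int n * q | m n. True}"

text \<open>
  The translates of the rectangle \<open>[0, p) \<times> [0, Im q)\<close> by the lattice tile the plane like bricks.
\<close>

lemma brick_lattice_disjoint:
  assumes p: "p > 0" and h: "Im q > 0" and "x \<in> brick_lattice p q" "y \<in> brick_lattice p q"
    and r: "0 \<le> Re r" "Re r < p" "0 \<le> Im r" "Im r < Im q"
    and s: "0 \<le> Re s" "Re s < p" "0 \<le> Im s" "Im s < Im q"
    and eq: "x + r = y + s"
  shows "x = y"
proof -
  obtain m n m' n' where x: "x = of_int m * of_real p + of_int n * q"
    and y: "y = of_int m' * of_real p + of_int n' * q"
    using assms(3,4) unfolding brick_lattice_def by blast
  have *: "k = 0" if "\<bar>real_of_int k\<bar> * c < c" "c > 0" for k c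
  proof -
    have "\<bar>real_of_int k\<bar> * c < 1 * c" using that by simp
    hence "\<bar>real_of_int k\<bar> < 1" using that(2) by (rule mult_less_cancel_right_pos[THEN iffD1, rotated])
    thus ?thesis by linarith
  qed
  have "of_int n * Im q + Im r = of_int n' * Im q + Im s"
    using arg_cong[OF eq, of Im] unfolding x y by simp
  hence "of_int (n - n') * Im q = Im s - Im r" by (simp add: algebra_simps)
  hence "\<bar>real_of_int (n - n')\<bar> * Im q = \<bar>Im s - Im r\<bar>"
    using h by (metis abs_mult abs_of_pos)
  also have "\<dots> < Im q" using r s by linarith
  finally have n: "n = n'" using *[of "n - n'" "Im q"] h by simp
  have "of_int m * p + Re r = of_int m' * p + Re s"
    using arg_cong[OF eq, of Re] unfolding x y n by simp
  hence "of_int (m - m') * p = Re s - Re r" by (simp add: algebra_simps)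
  hence "\<bar>real_of_int (m - m')\<bar> * p = \<bar>Re s - Re r\<bar>"
    using p by (metis abs_mult abs_of_pos)
  also have "\<dots> < p" using r s by linarith
  finally have "m = m'" using *[of "m - m'" p] p by simp
  thus ?thesis using n x y by simp
qed

lemma brick_lattice_cover:
  assumes p: "p > 0" and h: "Im q > 0"
  obtains x where "x \<in> brick_lattice p q" "0 \<le> Re (w - x)" "Re (w - x) < p"
    "0 \<le> Im (w - x)" "Im (w - x) < Im q"
proof -
  define n where "n = \<lfloor>Im w / Im q\<rfloor>"
  define m where "m = \<lfloor>(Re w - of_int n * Re q) / p\<rfloor>"
  define x where "x = of_int m * of_real p + of_int n * q"
  have "x \<in> brick_lattice p q" unfolding x_def brick_lattice_def by blast
  moreover have "of_int n \<le> Im w / Im q" "Im w / Im q < of_int n + 1" unfolding n_def by linarith+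
  hence "0 \<le> Im (w - x)" "Im (w - x) < Im q"
    using h unfolding x_def by (auto simp: field_simps)
  moreover have "of_int m \<le> (Re w - of_int n * Re q) / p" "(Re w - of_int n * Re q) / p < of_int m + 1"
    unfolding m_def by linarith+
  hence "0 \<le> Re (w - x)" "Re (w - x) < p"
    using p unfolding x_def by (auto simp: field_simps)
  ultimately show ?thesis using that by blast
qed

lemma brick_measure:
  fixes p h :: real
  assumes "p > 0" "h > 0"
  defines "R \<equiv> {r::complex. 0 \<le> Re r \<and> Re r < p \<and> 0 \<le> Im r \<and> Im r < h}"
  shows "R \<in> lmeasurable" "measure lebesgue R = p * h"
proof -
  have cb: "cbox 0 (Complex p h) = {r. 0 \<le> Re r \<and> Re r \<le> p \<and> 0 \<le> Im r \<and> Im r \<le> h}"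
    by (auto simp: cbox_def Basis_complex_def)
  have bx: "box 0 (Complex p h) = {r. 0 < Re r \<and> Re r < p \<and> 0 < Im r \<and> Im r < h}"
    by (auto simp: box_def Basis_complex_def)
  have sub: "R \<subseteq> cbox 0 (Complex p h)" "box 0 (Complex p h) \<subseteq> R" unfolding cb bx R_def by auto
  have "negligible (cbox 0 (Complex p h) - box 0 (Complex p h))"
    using negligible_frontier_interval by blast
  hence neg: "negligible ((cbox 0 (Complex p h) - R) \<union> (R - cbox 0 (Complex p h)))"
    by (rule negligible_subset) (use sub in auto)
  show "R \<in> lmeasurable"
    by (rule lmeasurable_negligible_symdiff[OF lmeasurable_cbox[of 0 "Complex p h"] neg])
  have "measure lebesgue R = measure lebesgue (cbox 0 (Complex p h))"
    using measure_negligible_symdiff[OF _ neg] lmeasurable_cbox[of 0 "Complex p h"] by (simp add: fmeasurableD)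
  also have "\<dots> = measure lborel (cbox 0 (Complex p h))" by simp
  also have "\<dots> = p * h"
    using assms by (subst content_cbox) (auto simp: Basis_complex_def)
  finally show "measure lebesgue R = p * h" .
qed

text \<open>Gauss's area argument: the bricks at the counted points are disjoint, lie in the disc of
  radius \<rho> + \<delta> and cover the disc of radius \<rho> - \<delta>. Uniformity in
  \<open>z\<close> matters, because solving a congruence later recentres the disc at an arbitrary
  point.\<close>

lemma brick_lattice_count:
  fixes p :: real and q :: complex
  assumes p: "p > 0" and h: "Im q > 0"
  shows "\<exists>C\<ge>0. \<forall>z \<rho>. \<rho> \<ge> 0 \<longrightarrow> finite {x \<in> brick_lattice p q. cmod (x + z) \<le> \<rho>} \<and>
     \<bar>real (card {x \<in> brick_lattice p q. cmod (x + z) \<le> \<rho>}) - pi * \<rho>\<^sup>2 / (p * Im q)\<bar> \<le> C * (\<rho> + 1)"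
proof -
  define R where "R = {r::complex. 0 \<le> Re r \<and> Re r < p \<and> 0 \<le> Im r \<and> Im r < Im q}"
  \<comment> \<open>A bound for the modulus of every point of the brick.\<close>
  define \<delta> where "\<delta> = p + Im q"
  have \<delta>: "\<delta> > 0" using p h by (simp add: \<delta>_def)
  have Rm: "R \<in> lmeasurable" "measure lebesgue R = p * Im q"
    using brick_measure[OF p h] unfolding R_def by auto
  have Rn: "cmod r \<le> \<delta>" if "r \<in> R" for r
    using that cmod_le[of r] unfolding R_def \<delta>_def by simp
  \<comment> \<open>The area between radii \<rho> and \<rho> + \<delta> is \<pi> (2 \<delta> \<rho>
    + \<delta>^2), at most \<pi> (2 \<delta> + \<delta>^2) (\<rho> + 1); it is divided by the area
    of a brick.\<close>
  define C where "C = pi * (2 * \<delta> + \<delta>\<^sup>2) / (p * Im q)"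
  have ph: "p * Im q > 0" using p h by simp
  have C: "C \<ge> 0" unfolding C_def using ph \<delta> by simp
  have area: "measure lebesgue (cball (0::complex) r) = pi * r\<^sup>2" if "r \<ge> 0" for r
    using content_cball[of r "0::complex"] that by (simp add: unit_ball_vol_2)
  have main: "finite {x \<in> brick_lattice p q. cmod (x + z) \<le> \<rho>} \<and>
     \<bar>real (card {x \<in> brick_lattice p q. cmod (x + z) \<le> \<rho>}) - pi * \<rho>\<^sup>2 / (p * Im q)\<bar> \<le> C * (\<rho> + 1)"
    if \<rho>: "\<rho> \<ge> 0" for z \<rho>
  proof -
    let ?F = "{x \<in> brick_lattice p q. cmod (x + z) \<le> \<rho>}"
    let ?T = "\<lambda>x. (+) (x + z) ` R"
    have meas: "?T x \<in> lmeasurable" "measure lebesgue (?T x) = p * Im q" for x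
      using Rm by (simp_all add: measurable_translation measure_translation)
    have vol: "(\<Union>x\<in>G. ?T x) \<in> lmeasurable \<and> measure lebesgue (\<Union>x\<in>G. ?T x) = card G * (p * Im q)"
      if G: "G \<subseteq> ?F" "finite G" for G
    proof
      show "(\<Union>x\<in>G. ?T x) \<in> lmeasurable" using G(2) meas by (intro fmeasurable.finite_UN) auto
      have "disjoint_family_on ?T G"
        unfolding disjoint_family_on_def
      proof (intro ballI impI)
        fix x y assume xy: "x \<in> G" "y \<in> G" "x \<noteq> y"
        show "?T x \<inter> ?T y = {}"
        proof (rule ccontr)
          assume "?T x \<inter> ?T y \<noteq> {}"
          then obtain r s where "r \<in> R" "s \<in> R" "x + z + r = y + z + s" by auto
          hence "x = y"
            using brick_lattice_disjoint[OF p h, of x y r s] xy G unfolding R_def by (auto simp: algebra_simps)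
          thus False using xy by simp
        qed
      qed
      hence "measure lebesgue (\<Union>x\<in>G. ?T x) = (\<Sum>x\<in>G. measure lebesgue (?T x))"
        using G(2) by (intro measure_finite_Union) (use fmeasurableD[OF meas(1)] fmeasurableD2[OF meas(1)] in \<open>auto simp: image_subset_iff simp del: emeasure_completion\<close>)
      thus "measure lebesgue (\<Union>x\<in>G. ?T x) = card G * (p * Im q)" by (simp add: meas)
    qed
    have sub: "(\<Union>x\<in>G. ?T x) \<subseteq> cball 0 (\<rho> + \<delta>)" if "G \<subseteq> ?F" for G
    proof
      fix w assume "w \<in> (\<Union>x\<in>G. ?T x)"
      then obtain x r where "x \<in> G" "r \<in> R" "w = x + z + r" by auto
      moreover from this have "x \<in> ?F" using that by blast
      ultimately have "x \<in> ?F" "r \<in> R" "w = x + z + r" by blast+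
      thus "w \<in> cball 0 (\<rho> + \<delta>)" using norm_triangle_ineq[of "x + z" r] Rn[of r] by simp
    qed
    have up: "card G * (p * Im q) \<le> pi * (\<rho> + \<delta>)\<^sup>2" if "G \<subseteq> ?F" "finite G" for G
    proof -
      have "measure lebesgue (\<Union>x\<in>G. ?T x) \<le> measure lebesgue (cball (0::complex) (\<rho> + \<delta>))"
        using sub[OF that(1)] vol[OF that] by (intro measure_mono_fmeasurable) (auto simp: fmeasurableD)
      thus ?thesis using vol[OF that] area[of "\<rho> + \<delta>"] \<rho> \<delta> by simp
    qed
    \<comment> \<open>An infinite set would have finite subsets of every size, against the area
      bound \<open>up\<close>.\<close>
    have fin: "finite ?F"
    proof (rule ccontr)
      assume inf: "infinite ?F"
      obtain k :: nat where k: "real k > pi * (\<rho> + \<delta>)\<^sup>2 / (p * Im q)" using reals_Archimedean2 by blast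
      obtain G where "G \<subseteq> ?F" "finite G" "card G = k" using infinite_arbitrarily_large[OF inf, of k] by blast
      hence "k * (p * Im q) \<le> pi * (\<rho> + \<delta>)\<^sup>2" using up by blast
      thus False using k ph by (simp add: field_simps)
    qed
    have U: "card ?F * (p * Im q) \<le> pi * (\<rho> + \<delta>)\<^sup>2" using up fin by blast
    \<comment> \<open>Weaker than \<pi> (\<rho> - \<delta>)^2, but it mirrors the upper bound and is
      nonpositive when \<rho> < \<delta>, where the inner disc disappears.\<close>
    have L: "pi * (\<rho>\<^sup>2 - 2 * \<delta> * \<rho> - \<delta>\<^sup>2) \<le> card ?F * (p * Im q)"
    proof (cases "\<rho> \<ge> \<delta>")
      case True
      have "cball 0 (\<rho> - \<delta>) \<subseteq> (\<Union>x\<in>?F. ?T x)"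
      proof
        fix w :: complex assume w: "w \<in> cball 0 (\<rho> - \<delta>)"
        obtain x where x: "x \<in> brick_lattice p q" and "w - z - x \<in> R"
          using brick_lattice_cover[OF p h, of "w - z"] unfolding R_def by blast
        hence r: "w - z - x \<in> R" by simp
        have "cmod (x + z) \<le> cmod w + cmod (w - z - x)"
          using norm_triangle_ineq4[of w "w - z - x"] by (simp add: algebra_simps)
        hence "x \<in> ?F" using w x Rn[OF r] by simp
        moreover have "w \<in> ?T x" by (rule image_eqI[OF _ r]) simp
        ultimately show "w \<in> (\<Union>x\<in>?F. ?T x)" by blast
      qed
      hence "measure lebesgue (cball (0::complex) (\<rho> - \<delta>)) \<le> measure lebesgue (\<Union>x\<in>?F. ?T x)"
        using vol[of ?F] fin by (intro measure_mono_fmeasurable) (auto simp: fmeasurableD)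
      hence "pi * (\<rho> - \<delta>)\<^sup>2 \<le> card ?F * (p * Im q)" using area[of "\<rho> - \<delta>"] vol[of ?F] fin True by simp
      moreover have "pi * (\<rho>\<^sup>2 - 2 * \<delta> * \<rho> - \<delta>\<^sup>2) \<le> pi * (\<rho> - \<delta>)\<^sup>2"
        by (intro mult_left_mono) (auto simp: power2_eq_square algebra_simps)
      ultimately show ?thesis by linarith
    next
      case False
      hence "\<rho>\<^sup>2 \<le> \<delta>\<^sup>2" using \<rho> by (intro power_mono) auto
      hence "\<rho>\<^sup>2 - 2 * \<delta> * \<rho> - \<delta>\<^sup>2 \<le> 0" using \<rho> \<delta> mult_nonneg_nonneg[of \<delta> \<rho>] by linarith
      hence "pi * (\<rho>\<^sup>2 - 2 * \<delta> * \<rho> - \<delta>\<^sup>2) \<le> 0" by (simp add: mult_le_0_iff)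
      also have "0 \<le> card ?F * (p * Im q)" using ph by simp
      finally show ?thesis .
    qed
    have "\<bar>card ?F * (p * Im q) - pi * \<rho>\<^sup>2\<bar> \<le> pi * (2 * \<delta> * \<rho> + \<delta>\<^sup>2)"
      using U L by (auto simp: power2_eq_square algebra_simps abs_le_iff)
    also have "\<dots> \<le> pi * ((2 * \<delta> + \<delta>\<^sup>2) * (\<rho> + 1))"
      using \<rho> \<delta> by (intro mult_left_mono) (auto simp: algebra_simps)
    also have "\<dots> = C * (\<rho> + 1) * (p * Im q)" unfolding C_def using p h by simp
    finally have "\<bar>card ?F * (p * Im q) - pi * \<rho>\<^sup>2\<bar> / (p * Im q) \<le> C * (\<rho> + 1)"
      using ph by (simp add: divide_le_eq)
    moreover have "card ?F - pi * \<rho>\<^sup>2 / (p * Im q) = (card ?F * (p * Im q) - pi * \<rho>\<^sup>2) / (p * Im q)"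
      using ph p h by (simp add: field_simps)
    ultimately show ?thesis using fin ph by (simp add: abs_divide)
  qed
  show ?thesis using C main by blast
qed

section \<open>Ideals of the maximal order\<close>

lemma int_subgroup_cyclic:
  fixes H :: "int set"
  assumes "0 \<in> H" "\<And>x y. x \<in> H \<Longrightarrow> y \<in> H \<Longrightarrow> x - y \<in> H" "x0 \<in> H" "x0 \<noteq> 0"
  obtains g where "g > 0" "H = {x. g dvd x}"
proof -
  have neg: "- x \<in> H" if "x \<in> H" for x using assms(2)[OF assms(1) that] by simp
  have add: "x + y \<in> H" if "x \<in> H" "y \<in> H" for x y using assms(2)[OF that(1) neg[OF that(2)]] by simp
  have mul_nat: "int k * x \<in> H" if "x \<in> H" for x k
    by (induction k) (use assms(1) add that in \<open>auto simp: algebra_simps\<close>)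
  have mul: "k * x \<in> H" if "x \<in> H" for x k
    using mul_nat[OF that, of "nat k"] neg[OF mul_nat[OF that, of "nat (-k)"]] by (cases "k \<ge> 0") auto
  define P where "P = (\<lambda>k::nat. k > 0 \<and> int k \<in> H)"
  have "P (nat \<bar>x0\<bar>)" unfolding P_def using assms(3,4) neg by (auto simp: abs_if)
  hence ex: "\<exists>k. P k" by blast
  define k where "k = (LEAST k. P k)"
  have k: "P k" unfolding k_def using LeastI_ex[OF ex] .
  have least: "k \<le> j" if "P j" for j unfolding k_def using that by (rule Least_le)
  have "int k dvd x" if "x \<in> H" for x
  proof (rule ccontr)
    assume nd: "\<not> int k dvd x"
    have "x mod int k = x - (x div int k) * int k" by (simp add: minus_div_mult_eq_mod)
    hence "x mod int k \<in> H" using assms(2)[OF that mul] k unfolding P_def by metis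
    moreover have "x mod int k > 0" "x mod int k < int k"
      using k nd unfolding P_def by (auto simp: dvd_eq_mod_eq_0 order.not_eq_order_implies_strict)
    ultimately have "P (nat (x mod int k))" unfolding P_def by auto
    hence "k \<le> nat (x mod int k)" by (rule least)
    thus False using \<open>x mod int k < int k\<close> \<open>x mod int k > 0\<close> by linarith
  qed
  moreover have "x \<in> H" if "int k dvd x" for x
    using that mul k unfolding P_def by (metis dvd_def mult.commute)
  ultimately show ?thesis using that[of "int k"] k unfolding P_def by auto
qed

section \<open>Products of sets of complex numbers\<close>

inductive_set iprod :: "complex set \<Rightarrow> complex set \<Rightarrow> complex set" for I J where
  zero: "0 \<in> iprod I J"
| step: "z \<in> iprod I J \<Longrightarrow> x \<in> I \<Longrightarrow> y \<in> J \<Longrightarrow> z + x * y \<in> iprod I J"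

text \<open>The universal property of the product, to which the inclusions between products below
  are reduced.\<close>

lemma iprod_least:
  assumes "0 \<in> L" "\<And>x y. x \<in> L \<Longrightarrow> y \<in> L \<Longrightarrow> x + y \<in> L" "\<And>x y. x \<in> I \<Longrightarrow> y \<in> J \<Longrightarrow> x * y \<in> L"
  shows "iprod I J \<subseteq> L"
proof
  fix z assume "z \<in> iprod I J" thus "z \<in> L" by induction (use assms in auto)
qed

lemma iprod_mult: "x \<in> I \<Longrightarrow> y \<in> J \<Longrightarrow> x * y \<in> iprod I J"
  using iprod.step[OF iprod.zero] by fastforce

lemma iprod_add: "x \<in> iprod I J \<Longrightarrow> y \<in> iprod I J \<Longrightarrow> x + y \<in> iprod I J"
proof (induction x rule: iprod.induct)
  case (step z x' y') thus ?case using iprod.step[of "z + y" I J x' y'] by (simp add: algebra_simps)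
qed auto

lemma iprod_commute: "iprod I J = iprod J I"
proof -
  have "iprod I J \<subseteq> iprod J I" for I J
    by (rule iprod_least) (auto intro: iprod.zero iprod_add, metis iprod_mult mult.commute)
  thus ?thesis by blast
qed

lemma iprod_mono: "I \<subseteq> I' \<Longrightarrow> J \<subseteq> J' \<Longrightarrow> iprod I J \<subseteq> iprod I' J'"
  by (rule iprod_least) (auto intro: iprod.zero iprod_add iprod_mult)

text \<open>For fixed k, the u with u k in the right-hand side form an additively closed set, so the
  universal property applies to one factor after the other. The converse inclusion is the same one
  with the three factors in reverse order.\<close>

lemma iprod_assoc: "iprod (iprod I J) K = iprod I (iprod J K)"
proof -
  have *: "iprod (iprod I J) K \<subseteq> iprod I (iprod J K)" for I J K
  proof (rule iprod_least)
    fix x k assume x: "x \<in> iprod I J" and k: "k \<in> K"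
    have "iprod I J \<subseteq> {u. u * k \<in> iprod I (iprod J K)}"
    proof (rule iprod_least)
      fix a b assume "a \<in> I" "b \<in> J"
      thus "a * b \<in> {u. u * k \<in> iprod I (iprod J K)}"
        using iprod_mult[of a I "b * k" "iprod J K"] iprod_mult[of b J k K] k by (simp add: mult.assoc)
    qed (auto intro: iprod.zero iprod_add simp: distrib_right)
    thus "x * k \<in> iprod I (iprod J K)" using x by blast
  qed (auto intro: iprod.zero iprod_add)
  have "iprod I (iprod J K) = iprod (iprod K J) I" by (simp add: iprod_commute)
  also have "\<dots> \<subseteq> iprod K (iprod J I)" by (rule *)
  also have "\<dots> = iprod (iprod I J) K" by (simp add: iprod_commute)
  finally show ?thesis using * by blast
qed

lemma iprod_cnj: "iprod (cnj ` I) (cnj ` J) = cnj ` iprod I J"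
proof -
  have *: "iprod (cnj ` I) (cnj ` J) \<subseteq> cnj ` iprod I J" for I J
  proof (rule iprod_least)
    show "0 \<in> cnj ` iprod I J" using iprod.zero by (metis complex_cnj_zero imageI)
    fix x y
    show "x \<in> cnj ` iprod I J \<Longrightarrow> y \<in> cnj ` iprod I J \<Longrightarrow> x + y \<in> cnj ` iprod I J"
      using iprod_add by (auto simp flip: complex_cnj_add)
    show "x \<in> cnj ` I \<Longrightarrow> y \<in> cnj ` J \<Longrightarrow> x * y \<in> cnj ` iprod I J"
      using iprod_mult by (auto simp flip: complex_cnj_mult)
  qed
  have cc: "cnj ` cnj ` A = A" for A by (simp add: image_image)
  have "iprod I J \<subseteq> cnj ` iprod (cnj ` I) (cnj ` J)"
    using *[of "cnj ` I" "cnj ` J"] by (simp only: cc)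
  hence "cnj ` iprod I J \<subseteq> cnj ` cnj ` iprod (cnj ` I) (cnj ` J)" by (rule image_mono)
  hence "cnj ` iprod I J \<subseteq> iprod (cnj ` I) (cnj ` J)" by (simp only: cc)
  thus ?thesis using * by (intro equalityI)
qed

lemma iprod_scale_left: "iprod ((*) c ` I) J = (*) c ` iprod I J"
proof
  show "iprod ((*) c ` I) J \<subseteq> (*) c ` iprod I J"
  proof (rule iprod_least)
    show "0 \<in> (*) c ` iprod I J" using iprod.zero by force
    fix x y
    show "x \<in> (*) c ` iprod I J \<Longrightarrow> y \<in> (*) c ` iprod I J \<Longrightarrow> x + y \<in> (*) c ` iprod I J"
      using iprod_add by (auto simp flip: distrib_left)
    show "x \<in> (*) c ` I \<Longrightarrow> y \<in> J \<Longrightarrow> x * y \<in> (*) c ` iprod I J"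
      using iprod_mult by (auto simp: mult.assoc)
  qed
  have "iprod I J \<subseteq> {x. c * x \<in> iprod ((*) c ` I) J}"
    using iprod_mult[of _ "(*) c ` I" _ J]
    by (intro iprod_least) (auto intro: iprod.zero iprod_add simp: distrib_left simp flip: mult.assoc)
  thus "(*) c ` iprod I J \<subseteq> iprod ((*) c ` I) J" by blast
qed

text \<open>
  The maximal order \<open>\<int> + \<int> w\<close> of an imaginary quadratic field, without reference to the field:
  maximality is the last assumption.
\<close>

locale imag_quadratic =
  fixes w :: complex and tw nw :: int
  assumes Im_w: "Im w > 0"
    and trace_w: "w + cnj w = of_int tw"
    and norm_w: "w * cnj w = of_int nw"
    and maximal: "\<And>x (k::int) a b. k \<noteq> 0 \<Longrightarrow> of_int k * x = of_int a + of_int b * w \<Longrightarrow>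
        x + cnj x \<in> \<int> \<Longrightarrow> x * cnj x \<in> \<int> \<Longrightarrow> \<exists>a b. x = of_int a + of_int b * w"
begin

definition Ok :: "complex set" where "Ok = {of_int a + of_int b * w | a b. True}"

lemma OkI: "of_int a + of_int b * w \<in> Ok" unfolding Ok_def by blast

lemma OkE: assumes "x \<in> Ok" obtains a b where "x = of_int a + of_int b * w"
  using assms unfolding Ok_def by blast

lemma coords_eq: "(of_int a + of_int b * w = of_int a' + of_int b' * w) \<longleftrightarrow> a = a' \<and> b = b'"
proof
  assume *: "of_int a + of_int b * w = of_int a' + of_int b' * w"
  from arg_cong[OF this, of Im] have "b = b'" using Im_w by simp
  with * show "a = a' \<and> b = b'" by simp
qed auto

lemma w_sq: "w * w = of_int tw * w - of_int nw"
proof -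
  have "w * (of_int tw - w) = of_int nw" unfolding trace_w[symmetric] using norm_w by simp
  thus ?thesis by (simp add: algebra_simps)
qed

lemma Ok_of_int: "of_int a \<in> Ok" using OkI[of a 0] by simp
lemma Ok_0: "0 \<in> Ok" using Ok_of_int[of 0] by simp
lemma Ok_1: "1 \<in> Ok" using Ok_of_int[of 1] by simp
lemma Ok_w: "w \<in> Ok" using OkI[of 0 1] by simp

lemma Ok_add: assumes "x \<in> Ok" "y \<in> Ok" shows "x + y \<in> Ok"
proof -
  obtain a b c d where "x = of_int a + of_int b * w" "y = of_int c + of_int d * w" using assms by (metis OkE)
  hence "x + y = of_int (a + c) + of_int (b + d) * w" by (simp add: algebra_simps)
  thus ?thesis using OkI by metis
qed

lemma Ok_mult: assumes "x \<in> Ok" "y \<in> Ok" shows "x * y \<in> Ok"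
proof -
  obtain a b c d where "x = of_int a + of_int b * w" "y = of_int c + of_int d * w" using assms by (metis OkE)
  hence "x * y = of_int (a * c) + of_int (a * d + b * c) * w + of_int (b * d) * (w * w)" by (simp add: algebra_simps)
  also have "\<dots> = of_int (a * c - b * d * nw) + of_int (a * d + b * c + b * d * tw) * w"
    unfolding w_sq by (simp add: algebra_simps)
  finally show ?thesis using OkI by metis
qed

lemma Ok_minus: assumes "x \<in> Ok" shows "- x \<in> Ok"
  using Ok_mult[OF Ok_of_int[of "-1"] assms] by simp

lemma Ok_diff: assumes "x \<in> Ok" "y \<in> Ok" shows "x - y \<in> Ok"
  using Ok_add[OF assms(1) Ok_minus[OF assms(2)]] by simp

lemma cnj_coords: "cnj (of_int a + of_int b * w) = of_int (a + b * tw) + of_int (- b) * w"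
proof -
  have "cnj w = of_int tw - w" unfolding trace_w[symmetric] by simp
  hence "cnj (of_int a + of_int b * w) = of_int a + of_int b * (of_int tw - w)" by simp
  thus ?thesis by (simp add: algebra_simps)
qed

lemma Ok_cnj: assumes "x \<in> Ok" shows "cnj x \<in> Ok"
  using assms OkI cnj_coords by (metis OkE)

lemma cnj_Ok: "cnj ` Ok = Ok"
proof -
  have "x \<in> cnj ` Ok" if "x \<in> Ok" for x using Ok_cnj[OF that] by (intro image_eqI[of _ _ "cnj x"]) auto
  thus ?thesis using Ok_cnj by blast
qed

lemma Ok_trace: assumes "x \<in> Ok" shows "x + cnj x \<in> \<int>"
proof -
  obtain a b where x: "x = of_int a + of_int b * w" using assms by (rule OkE)
  have "x + cnj x = of_int (2 * a + b * tw)" unfolding x cnj_coords by (simp add: algebra_simps)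
  thus ?thesis by (metis Ints_of_int)
qed

lemma Ok_real_int: assumes "x \<in> Ok" "Im x = 0" shows "x \<in> \<int>"
proof -
  obtain a b where x: "x = of_int a + of_int b * w" using assms by (metis OkE)
  thus ?thesis using assms Im_w by simp
qed

lemma Ok_norm: assumes "x \<in> Ok" shows "x * cnj x \<in> \<int>"
  using Ok_real_int[OF Ok_mult[OF assms Ok_cnj[OF assms]]] by simp

text \<open>Counting functions in |x|^2 therefore jump only at integers, which allows summation by
  parts over the naturals.\<close>

lemma Ok_norm_nat: assumes "x \<in> Ok" obtains k :: nat where "(cmod x)\<^sup>2 = real k"
proof -
  obtain k where k: "x * cnj x = of_int k" using Ok_norm[OF assms] by (metis Ints_cases)
  have "of_real ((cmod x)\<^sup>2) = (of_int k :: complex)" using k by (simp add: complex_norm_square del: of_real_power)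
  hence e: "(cmod x)\<^sup>2 = real_of_int k" by (metis of_real_eq_iff of_real_of_int_eq)
  hence "k \<ge> 0" by (metis of_int_0_le_iff zero_le_power2)
  thus ?thesis using that[of "nat k"] e by simp
qed

section \<open>Nonzero ideals and their Hermite bases\<close>

definition idl :: "complex set \<Rightarrow> bool" where
  "idl I \<longleftrightarrow> I \<subseteq> Ok \<and> 0 \<in> I \<and> (\<forall>x\<in>I. \<forall>y\<in>I. x + y \<in> I) \<and> (\<forall>a\<in>Ok. \<forall>x\<in>I. a * x \<in> I) \<and> (\<exists>x\<in>I. x \<noteq> 0)"

lemma idlI:
  assumes "I \<subseteq> Ok" "0 \<in> I" "\<And>x y. x \<in> I \<Longrightarrow> y \<in> I \<Longrightarrow> x + y \<in> I"
    "\<And>a x. a \<in> Ok \<Longrightarrow> x \<in> I \<Longrightarrow> a * x \<in> I" "z \<in> I" "z \<noteq> 0"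
  shows "idl I"
  using assms unfolding idl_def by auto

lemma idl_sub: "idl I \<Longrightarrow> I \<subseteq> Ok"
  and idl_0: "idl I \<Longrightarrow> 0 \<in> I"
  and idl_add: "idl I \<Longrightarrow> x \<in> I \<Longrightarrow> y \<in> I \<Longrightarrow> x + y \<in> I"
  and idl_mult: "idl I \<Longrightarrow> a \<in> Ok \<Longrightarrow> x \<in> I \<Longrightarrow> a * x \<in> I"
  and idl_nonzero: "idl I \<Longrightarrow> \<exists>x\<in>I. x \<noteq> 0"
  unfolding idl_def by blast+

lemma idl_minus: "idl I \<Longrightarrow> x \<in> I \<Longrightarrow> - x \<in> I"
  using idl_mult[of I "-1" x] Ok_minus[OF Ok_1] by simp

lemma idl_diff: "idl I \<Longrightarrow> x \<in> I \<Longrightarrow> y \<in> I \<Longrightarrow> x - y \<in> I"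
  using idl_add[of I x "-y"] idl_minus by simp

lemma idl_of_int_mult: "idl I \<Longrightarrow> x \<in> I \<Longrightarrow> of_int k * x \<in> I"
  using idl_mult Ok_of_int by blast

lemma idl_Ok: "idl Ok"
  using Ok_1 by (intro idlI[of _ 1]) (auto intro: Ok_0 Ok_add Ok_mult)

lemma idl_cnj: assumes "idl I" shows "idl (cnj ` I)"
proof -
  have "a * cnj x \<in> cnj ` I" if "a \<in> Ok" "x \<in> I" for a x
    using idl_mult[OF assms Ok_cnj[OF that(1)] that(2)] by (intro image_eqI[of _ _ "cnj a * x"]) auto
  moreover have "cnj x + cnj y \<in> cnj ` I" if "x \<in> I" "y \<in> I" for x y
    using idl_add[OF assms that] by (metis complex_cnj_add imageI)
  moreover have "0 \<in> cnj ` I" using idl_0[OF assms] by (metis complex_cnj_zero imageI)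
  ultimately show ?thesis
    using idl_sub[OF assms] idl_nonzero[OF assms] Ok_cnj unfolding idl_def by auto
qed

lemma idl_iprod: assumes "idl I" "idl J" shows "idl (iprod I J)"
proof -
  have "iprod I J \<subseteq> Ok"
    using idl_sub[OF assms(1)] idl_sub[OF assms(2)] by (intro iprod_least) (auto intro: Ok_0 Ok_add Ok_mult)
  moreover have "a * x \<in> iprod I J" if "a \<in> Ok" "x \<in> iprod I J" for a x
  proof -
    have "iprod I J \<subseteq> {x. a * x \<in> iprod I J}"
      using iprod_mult[OF idl_mult[OF assms(1) that(1)], of _ _ J]
      by (intro iprod_least) (auto intro: iprod.zero iprod_add simp: distrib_left mult.assoc)
    thus ?thesis using that by blast
  qed
  moreover obtain x where x: "x \<in> I" "x \<noteq> 0" using idl_nonzero[OF assms(1)] by blast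
  obtain y where y: "y \<in> J" "y \<noteq> 0" using idl_nonzero[OF assms(2)] by blast
  have "x * y \<noteq> 0" using x y by simp
  ultimately show ?thesis
    using iprod_mult[OF x(1) y(1)] by (intro idlI[of _ "x * y"]) (auto intro: iprod.zero iprod_add)
qed

lemma iprod_Ok: assumes "idl I" shows "iprod Ok I = I"
proof
  show "iprod Ok I \<subseteq> I" using assms by (intro iprod_least) (auto intro: idl_0 idl_add idl_mult)
  show "I \<subseteq> iprod Ok I" using iprod_mult[OF Ok_1, of _ I] by auto
qed

lemma iprod_sub: assumes "idl I" "idl J" shows "iprod I J \<subseteq> J"
  using iprod_mono[OF idl_sub[OF assms(1)] order_refl, of J] iprod_Ok[OF assms(2)] by simp

lemma idl_scale: assumes "idl I" "a \<in> Ok" "a \<noteq> 0" shows "idl ((*) a ` I)"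
proof -
  have "idl ((*) a ` Ok)"
  proof -
    have "b * (a * x) \<in> (*) a ` Ok" if "b \<in> Ok" "x \<in> Ok" for b x
      using Ok_mult[OF that] by (intro image_eqI[of _ _ "b * x"]) auto
    moreover have "a * x + a * y \<in> (*) a ` Ok" if "x \<in> Ok" "y \<in> Ok" for x y
      using Ok_add[OF that] by (intro image_eqI[of _ _ "x + y"]) (auto simp: algebra_simps)
    moreover have "0 \<in> (*) a ` Ok" "a \<in> (*) a ` Ok"
      using Ok_0 Ok_1 by force+
    moreover have "(*) a ` Ok \<subseteq> Ok" using Ok_mult assms by blast
    ultimately show ?thesis using assms(3) unfolding idl_def by auto
  qed
  moreover have "(*) a ` I = iprod ((*) a ` Ok) I" by (simp add: iprod_scale_left iprod_Ok assms)
  ultimately show ?thesis using idl_iprod assms by metis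
qed

lemma of_int_Ok_sub_iff: assumes "k > 0" "m > 0"
  shows "(*) (of_int k) ` Ok \<subseteq> (*) (of_int m) ` Ok \<longleftrightarrow> m dvd k"
proof
  assume "(*) (of_int k) ` Ok \<subseteq> (*) (of_int m) ` Ok"
  hence "of_int k * 1 \<in> (*) (of_int m) ` Ok" using Ok_1 by blast
  then obtain a b where "of_int k = of_int m * (of_int a + of_int b * w)" by (metis imageE OkE mult_1_right)
  hence "of_int k + of_int 0 * w = of_int (m * a) + of_int (m * b) * w" by (simp add: algebra_simps)
  hence "k = m * a" using coords_eq by blast
  thus "m dvd k" by simp
next
  assume "m dvd k"
  then obtain c where c: "k = m * c" by blast
  show "(*) (of_int k) ` Ok \<subseteq> (*) (of_int m) ` Ok"
  proof
    fix x assume "x \<in> (*) (of_int k) ` Ok"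
    then obtain y where "y \<in> Ok" "x = of_int m * (of_int c * y)" unfolding c by auto
    thus "x \<in> (*) (of_int m) ` Ok" using Ok_mult[OF Ok_of_int] by blast
  qed
qed

text \<open>Norm identities are read off from identities between ideals in this way.\<close>

lemma of_int_Ok_eq: assumes "k > 0" "m > 0" "(*) (of_int k) ` Ok = (*) (of_int m) ` Ok" shows "k = m"
  using of_int_Ok_sub_iff[of k m] of_int_Ok_sub_iff[of m k] assms by (simp add: zdvd_antisym_nonneg)

text \<open>Hermite normal form: \<open>p\<close> generates the integers in the ideal and
  \<open>s\<close> the coefficients of \<open>w\<close>. The real first basis vector is what
  \<open>brick_lattice\<close> expects, and the range of \<open>r\<close> leaves finitely many
  candidates for given \<open>p\<close> and \<open>s\<close>.\<close>

definition hermite_basis :: "complex set \<Rightarrow> int \<Rightarrow> int \<Rightarrow> int \<Rightarrow> bool" where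
  "hermite_basis I p s r \<longleftrightarrow> p > 0 \<and> s > 0 \<and> 0 \<le> r \<and> r < p \<and>
     I = {of_int m * of_int p + of_int k * (of_int r + of_int s * w) | m k. True} \<and>
     (\<forall>a b. of_int a + of_int b * w \<in> I \<longrightarrow> s dvd b) \<and> (\<forall>a. of_int a \<in> I \<longleftrightarrow> p dvd a)"

text \<open>Both coefficient groups are nonzero: the norm N of a nonzero element lies in the ideal,
  and so does N w.\<close>

lemma idl_basis:
  assumes "idl I"
  obtains p s r where "hermite_basis I p s r"
proof -
  obtain x where x: "x \<in> I" "x \<noteq> 0" using idl_nonzero[OF assms] by blast
  have "x * cnj x \<in> I" using idl_mult[OF assms Ok_cnj x(1)] x(1) idl_sub[OF assms] by (auto simp: mult.commute)
  moreover obtain N where N: "x * cnj x = of_int N" using Ok_norm x(1) idl_sub[OF assms] by (metis Ints_cases subsetD)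
  ultimately have NI: "of_int N \<in> I" "N \<noteq> 0" using x(2) by auto
  have NwI: "of_int 0 + of_int N * w \<in> I" using idl_mult[OF assms Ok_w NI(1)] by (simp add: mult.commute)
  have diff: "of_int a + of_int b * w \<in> I \<Longrightarrow> of_int a' + of_int b' * w \<in> I \<Longrightarrow>
      of_int (a - a') + of_int (b - b') * w \<in> I" for a b a' b'
    using idl_diff[OF assms, of "of_int a + of_int b * w" "of_int a' + of_int b' * w"] by (simp add: algebra_simps)
  obtain p where p: "p > 0" "{a. of_int a \<in> I} = {a. p dvd a}"
  proof (rule int_subgroup_cyclic[of "{a. of_int a \<in> I}" N])
    show "\<And>x y. x \<in> {a. of_int a \<in> I} \<Longrightarrow> y \<in> {a. of_int a \<in> I} \<Longrightarrow> x - y \<in> {a. of_int a \<in> I}"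
      using diff[of _ 0 _ 0] by simp
  qed (use idl_0[OF assms] NI in auto)
  have pd: "of_int a \<in> I \<longleftrightarrow> p dvd a" for a using p(2) by (simp add: set_eq_iff)
  define H where "H = {b. \<exists>a. of_int a + of_int b * w \<in> I}"
  have HI: "b \<in> H" if "of_int a + of_int b * w \<in> I" for a b using that unfolding H_def by blast
  have HE: "\<exists>a. of_int a + of_int b * w \<in> I" if "b \<in> H" for b using that unfolding H_def by simp
  have "of_int 0 + of_int 0 * w \<in> I" using idl_0[OF assms] by simp
  hence "0 \<in> H" by (rule HI)
  moreover have "x - y \<in> H" if "x \<in> H" "y \<in> H" for x y
    using HE[OF that(1)] HE[OF that(2)] diff HI by blast
  ultimately obtain s where s: "s > 0" "H = {a. s dvd a}"
    using HI[OF NwI] NI(2) int_subgroup_cyclic[of H N] by metis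
  have "s \<in> H" unfolding s(2) by simp
  then obtain r0 where r0: "of_int r0 + of_int s * w \<in> I" using HE by blast
  \<comment> \<open>Reduction is allowed since \<open>p\<close> itself lies in the ideal.\<close>
  define r where "r = r0 mod p"
  have "p dvd r0 - r" unfolding r_def by (simp add: mod_eq_dvd_iff[symmetric])
  hence "of_int (r0 - r) \<in> I" by (simp only: pd)
  hence r: "of_int r + of_int s * w \<in> I" using diff[OF r0, of "r0 - r" 0] by simp
  have pI: "of_int p \<in> I" by (simp add: pd)
  have "I = {of_int m * of_int p + of_int k * (of_int r + of_int s * w) | m k. True}"
  proof (intro subset_antisym subsetI)
    fix y assume y: "y \<in> I"
    have "y \<in> Ok" using y idl_sub[OF assms] by (rule subsetD[rotated])
    then obtain a b where ab: "y = of_int a + of_int b * w" by (rule OkE)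
    have "b \<in> H" using HI y unfolding ab .
    then obtain k where k: "b = s * k" unfolding s(2) by blast
    have "y - of_int k * (of_int r + of_int s * w) \<in> I"
      by (intro idl_diff[OF assms y] idl_of_int_mult[OF assms r])
    moreover have "y - of_int k * (of_int r + of_int s * w) = of_int (a - k * r)" unfolding ab k by (simp add: algebra_simps)
    ultimately have "of_int (a - k * r) \<in> I" by (simp only:)
    hence "p dvd a - k * r" by (simp only: pd)
    then obtain m where "a - k * r = p * m" by (rule dvdE)
    hence "a = p * m + k * r" by simp
    hence "y = of_int m * of_int p + of_int k * (of_int r + of_int s * w)" unfolding ab k by (simp add: algebra_simps)
    thus "y \<in> {of_int m * of_int p + of_int k * (of_int r + of_int s * w) | m k. True}" by blast
  next
    fix y assume "y \<in> {of_int m * of_int p + of_int k * (of_int r + of_int s * w) | m k. True}"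
    then obtain m k where y: "y = of_int m * of_int p + of_int k * (of_int r + of_int s * w)" by blast
    show "y \<in> I" unfolding y by (intro idl_add[OF assms] idl_of_int_mult[OF assms] pI r)
  qed
  moreover have "0 \<le> r" "r < p" unfolding r_def using p(1) by auto
  moreover have "s dvd b" if "of_int a + of_int b * w \<in> I" for a b using HI[OF that] unfolding s(2) by simp
  ultimately have "hermite_basis I p s r" unfolding hermite_basis_def using p(1) s(1) pd by blast
  thus ?thesis by (rule that)
qed

section \<open>The norm as an index\<close>

definition nrm :: "complex set \<Rightarrow> nat" where
  "nrm I = card ((\<lambda>x. (\<lambda>h. h + x) ` I) ` Ok)"

lemma coset_eq_iff:
  assumes "idl I" shows "(\<lambda>h. h + x) ` I = (\<lambda>h. h + y) ` I \<longleftrightarrow> x - y \<in> I"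
proof
  assume "(\<lambda>h. h + x) ` I = (\<lambda>h. h + y) ` I"
  hence "0 + x \<in> (\<lambda>h. h + y) ` I" using idl_0[OF assms] by blast
  thus "x - y \<in> I" by auto
next
  have *: "(\<lambda>h. h + x) ` I \<subseteq> (\<lambda>h. h + y) ` I" if "x - y \<in> I" for x y
  proof
    fix z assume "z \<in> (\<lambda>h. h + x) ` I"
    then obtain h where "h \<in> I" "z = (h + (x - y)) + y" by auto
    thus "z \<in> (\<lambda>h. h + y) ` I" using idl_add[OF assms _ that] by blast
  qed
  assume "x - y \<in> I"
  thus "(\<lambda>h. h + x) ` I = (\<lambda>h. h + y) ` I" using *[of x y] *[of y x] idl_minus[OF assms, of "x - y"] by auto
qed

text \<open>The a + b w with 0 \<le> a < p and 0 \<le> b < s represent the classes: reduce b by the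
  second basis vector, then a by \<open>p\<close>.\<close>

lemma nrm_basis:
  assumes I: "idl I" and B: "hermite_basis I p s r"
  shows "int (nrm I) = p * s"
proof -
  have ps: "p > 0" "s > 0"
    and eq: "I = {of_int m * of_int p + of_int k * (of_int r + of_int s * w) | m k. True}"
    and s: "\<And>a b. of_int a + of_int b * w \<in> I \<Longrightarrow> s dvd b" and p: "\<And>a. of_int a \<in> I \<longleftrightarrow> p dvd a"
    using B unfolding hermite_basis_def by blast+
  let ?c = "\<lambda>x. (\<lambda>h. h + x) ` I"
  let ?f = "\<lambda>(a, b). ?c (of_int a + of_int b * w)"
  have "bij_betw ?f ({0..<p} \<times> {0..<s}) (?c ` Ok)"
    unfolding bij_betw_def
  proof
    show "inj_on ?f ({0..<p} \<times> {0..<s})"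
    proof (rule inj_onI, clarify)
      fix a b a' b' assume r: "a \<in> {0..<p}" "b \<in> {0..<s}" "a' \<in> {0..<p}" "b' \<in> {0..<s}"
        and "?c (of_int a + of_int b * w) = ?c (of_int a' + of_int b' * w)"
      hence "of_int (a - a') + of_int (b - b') * w \<in> I"
        unfolding coset_eq_iff[OF I] by (simp add: algebra_simps)
      note * = this
      hence "s dvd b - b'" using s by blast
      hence bb: "b = b'" using r zdvd_imp_le[of s "\<bar>b - b'\<bar>"] by fastforce
      have "of_int (a - a') \<in> I" using * by (simp add: bb)
      hence "p dvd a - a'" using p by blast
      hence "a = a'" using r zdvd_imp_le[of p "\<bar>a - a'\<bar>"] by fastforce
      with bb show "a = a' \<and> b = b'" by simp
    qed
    show "?f ` ({0..<p} \<times> {0..<s}) = ?c ` Ok"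
    proof
      show "?f ` ({0..<p} \<times> {0..<s}) \<subseteq> ?c ` Ok" using OkI by auto
      show "?c ` Ok \<subseteq> ?f ` ({0..<p} \<times> {0..<s})"
      proof (rule image_subsetI)
        fix x assume x: "x \<in> Ok"
        obtain a b where "x = of_int a + of_int b * w" using x by (rule OkE)
        hence X: "?c x = ?c (of_int a + of_int b * w)" by blast
        define k where "k = b div s"
        define m where "m = (a - k * r) div p"
        have a: "a = (a - k * r) mod p + m * p + k * r"
          using div_mult_mod_eq[of "a - k * r" p] unfolding m_def by linarith
        have b: "b = b mod s + k * s" using div_mult_mod_eq[of b s] unfolding k_def by linarith
        have "of_int a + of_int b * w - (of_int ((a - k * r) mod p) + of_int (b mod s) * w)
            = of_int m * of_int p + of_int k * (of_int r + of_int s * w)"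
          by (subst a, subst b) (simp add: algebra_simps)
        hence "of_int a + of_int b * w - (of_int ((a - k * r) mod p) + of_int (b mod s) * w) \<in> I"
          unfolding eq by blast
        hence "?c x = ?f ((a - k * r) mod p, b mod s)" unfolding X prod.case coset_eq_iff[OF I] .
        moreover have "((a - k * r) mod p, b mod s) \<in> {0..<p} \<times> {0..<s}" using ps by simp
        ultimately show "?c x \<in> ?f ` ({0..<p} \<times> {0..<s})" by (rule image_eqI)
      qed
    qed
  qed
  hence "nrm I = card ({0..<p} \<times> {0..<s})" unfolding nrm_def by (metis bij_betw_same_card)
  thus ?thesis using ps by (simp add: card_cartesian_product)
qed

lemma nrm_pos: assumes "idl I" shows "nrm I > 0"
proof -
  obtain p s r where B: "hermite_basis I p s r" using assms by (rule idl_basis)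
  hence "p * s > 0" unfolding hermite_basis_def by simp
  thus ?thesis using nrm_basis[OF assms B] by linarith
qed


text \<open>
  For a basis \<open>p\<close>, \<open>\<beta>\<close> of \<open>I\<close> and \<open>\<beta>'\<close> conjugate to \<open>\<beta>\<close>, the product is generated by the gcd \<open>g\<close> of
  \<open>p\<^sup>2\<close>, \<open>\<beta> \<beta>'\<close> and \<open>p (\<beta> + \<beta>')\<close>: maximality makes \<open>p \<beta> / g\<close> integral. Comparing the coefficients of \<open>w\<close> in both ideals gives
  \<open>g = N(I)\<close>.
\<close>

lemma iprod_cnj_self: assumes I: "idl I" shows "iprod I (cnj ` I) = (*) (of_nat (nrm I)) ` Ok"
proof -
  obtain p s r where B: "hermite_basis I p s r" using I by (rule idl_basis)
  have ps: "p > 0" "s > 0"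
    and eq: "I = {of_int m * of_int p + of_int k * (of_int r + of_int s * w) | m k. True}"
    and sI: "\<And>a b. of_int a + of_int b * w \<in> I \<Longrightarrow> s dvd b" and pI: "\<And>a. of_int a \<in> I \<longleftrightarrow> p dvd a"
    using B unfolding hermite_basis_def by blast+
  define \<beta> where "\<beta> = of_int r + of_int s * w"
  have eq': "I = {of_int m * of_int p + of_int k * \<beta> | m k. True}" unfolding \<beta>_def by (rule eq)
  have I_cases: "\<exists>m k. x = of_int m * of_int p + of_int k * \<beta>" if "x \<in> I" for x using that unfolding eq' by blast
  have \<beta>: "\<beta> \<in> Ok" unfolding \<beta>_def by (rule OkI)
  have "\<beta> = of_int 0 * of_int p + of_int 1 * \<beta>" by simp
  hence \<beta>I: "\<beta> \<in> I" unfolding eq' by blast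
  have pI': "of_int p \<in> I" using pI by simp
  obtain b where b: "\<beta> * cnj \<beta> = of_int b" using Ok_norm[OF \<beta>] by (metis Ints_cases)
  obtain c' where c': "\<beta> + cnj \<beta> = of_int c'" using Ok_trace[OF \<beta>] by (metis Ints_cases)
  define c where "c = p * c'"
  define g where "g = gcd (p * p) (gcd b c)"
  have g: "g > 0" unfolding g_def using ps by (simp add: gcd_pos_int)
  let ?P = "iprod I (cnj ` I)" and ?G = "(*) (of_int g) ` Ok"
  have idP: "idl ?P" using idl_iprod idl_cnj I by blast
  have idG: "idl ?G" by (rule idl_scale[OF idl_Ok Ok_of_int]) (use g in simp)
  have "of_int (p * p) \<in> ?P" using iprod_mult[OF pI' imageI[OF pI', of cnj]] by simp
  moreover have "of_int b \<in> ?P" using iprod_mult[OF \<beta>I imageI[OF \<beta>I, of cnj]] b by simp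
  moreover have "of_int c \<in> ?P"
  proof -
    have "\<beta> * cnj (of_int p) + of_int p * cnj \<beta> \<in> ?P" by (intro iprod_add iprod_mult[OF \<beta>I imageI[OF pI']] iprod_mult[OF pI' imageI[OF \<beta>I]])
    moreover have "\<beta> * cnj (of_int p) + of_int p * cnj \<beta> = of_int c" unfolding c_def by (simp add: algebra_simps flip: c')
    ultimately show ?thesis by simp
  qed
  ultimately have "of_int u * of_int (p * p) + of_int v * (of_int u' * of_int b + of_int v' * of_int c) \<in> ?P" for u v u' v'
    by (intro idl_add[OF idP] idl_of_int_mult[OF idP])
  moreover obtain u' v' where 1: "gcd b c = u' * b + v' * c" using bezout_int[of b c] by metis
  moreover obtain u v where 2: "g = u * (p * p) + v * gcd b c"
    using bezout_int[of "p * p" "gcd b c"] unfolding g_def by metis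
  have "of_int g = of_int u * of_int (p * p) + of_int v * (of_int u' * of_int b + of_int v' * (of_int c :: complex))"
    unfolding 2 1 by simp
  ultimately have "of_int g \<in> ?P" by simp
  hence GP: "?G \<subseteq> ?P" using idl_mult[OF idP] by (auto simp: mult.commute)
  have dv: "g dvd p * p" "g dvd b" "g dvd c" unfolding g_def by (auto intro: dvd_trans)
  have in_G: "of_int k \<in> ?G" if "g dvd k" for k
  proof -
    obtain c where "k = g * c" using \<open>g dvd k\<close> by (rule dvdE)
    hence "of_int k = of_int g * (of_int c :: complex)" by simp
    thus ?thesis using Ok_of_int by blast
  qed
  have p\<beta>: "of_int p * \<beta> \<in> ?G"
  proof -
    \<comment> \<open>By the choice of g, the trace c / g and the norm (p p / g) (b / g) of this
      quotient are integers, so \<open>maximal\<close> applies.\<close>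
    define x where "x = of_int p * \<beta> / of_int g"
    obtain k1 k2 k3 where k: "p * p = g * k1" "b = g * k2" "c = g * k3" using dv by blast
    have gx: "of_int g * x = of_int p * \<beta>" unfolding x_def using g by simp
    have "of_int g * (x + cnj x) = of_int p * \<beta> + cnj (of_int p * \<beta>)" using gx
      by (metis complex_cnj_mult complex_cnj_of_int distrib_left)
    moreover have "of_int p * \<beta> + cnj (of_int p * \<beta>) = of_int c" unfolding c_def by (simp add: algebra_simps flip: c')
    moreover have "of_int c = (of_int g * of_int k3 :: complex)" unfolding k by simp
    ultimately have t: "x + cnj x = of_int k3" using g by simp
    have "(of_int g * of_int g) * (x * cnj x) = (of_int g * x) * cnj (of_int g * x)" by (simp add: algebra_simps)
    moreover have "(of_int g * x) * cnj (of_int g * x) = of_int (p * p) * (\<beta> * cnj \<beta>)" unfolding gx by (simp add: algebra_simps)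
    moreover have "of_int (p * p) * (\<beta> * cnj \<beta>) = (of_int g * of_int g) * of_int (k1 * k2)" unfolding b unfolding k by simp
    ultimately have n: "x * cnj x = of_int (k1 * k2)" using g by simp
    obtain a' b' where "of_int p * \<beta> = of_int a' + of_int b' * w" using Ok_mult[OF Ok_of_int \<beta>] by (metis OkE)
    hence "\<exists>a b. x = of_int a + of_int b * w"
      using maximal[of g x a' b'] g gx t n by simp
    hence "x \<in> Ok" using OkI by metis
    hence "of_int g * x \<in> ?G" by blast
    thus ?thesis unfolding gx .
  qed
  have p\<beta>': "of_int p * cnj \<beta> \<in> ?G"
  proof -
    have "of_int p * cnj \<beta> = of_int c - of_int p * \<beta>" unfolding c_def by (simp add: algebra_simps flip: c')
    thus ?thesis using idl_diff[OF idG in_G[OF dv(3)] p\<beta>] by metis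
  qed
  have prod: "(of_int m * of_int p + of_int k * \<beta>) * cnj (of_int m' * of_int p + of_int k' * \<beta>) =
     of_int (m * m') * of_int (p * p) + (of_int (k * k') * of_int b +
       (of_int (m * k') * (of_int p * cnj \<beta>) + of_int (k * m') * (of_int p * \<beta>)))" for m k m' k'
    by (simp add: algebra_simps flip: b)
  have PG: "?P \<subseteq> ?G"
  proof (rule iprod_least)
    fix x y assume "x \<in> I" "y \<in> cnj ` I"
    then obtain m k m' k' where xy: "x = of_int m * of_int p + of_int k * \<beta>" "y = cnj (of_int m' * of_int p + of_int k' * \<beta>)"
      using I_cases by (metis imageE)
    show "x * y \<in> ?G" unfolding xy prod
      by (intro idl_add[OF idG] idl_of_int_mult[OF idG] in_G dv p\<beta> p\<beta>')
  qed (use idG idl_0 idl_add in auto)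
  have "?P = ?G" using GP PG by blast
  moreover have "g = p * s"
  proof (rule zdvd_antisym_nonneg)
    show "0 \<le> g" "0 \<le> p * s" using g ps by auto
    obtain a b1 where ab: "of_int p * \<beta> = of_int g * (of_int a + of_int b1 * w)" using p\<beta> by (metis OkE imageE)
    have "of_int (p * r) + of_int (p * s) * w = of_int (g * a) + of_int (g * b1) * w"
      using ab unfolding \<beta>_def by (simp add: algebra_simps)
    thus "g dvd p * s" using coords_eq by (metis dvd_triv_left)
    define L where "L = {of_int a + of_int (p * s * b) * w | a b. True}"
    have LI: "of_int a + of_int (p * s * b) * w \<in> L" for a b unfolding L_def by blast
    have L_add: "x + y \<in> L" if xy: "x \<in> L" "y \<in> L" for x y
    proof -
      obtain a b a' b' where "x = of_int a + of_int (p * s * b) * w" "y = of_int a' + of_int (p * s * b') * w"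
        using xy unfolding L_def by blast
      hence "x + y = of_int (a + a') + of_int (p * s * (b + b')) * w" by (simp add: algebra_simps)
      thus ?thesis using LI by metis
    qed
    have "?P \<subseteq> L"
    proof (rule iprod_least)
      fix x y assume "x \<in> I" "y \<in> cnj ` I"
      then obtain m k m' k' where xy: "x = of_int m * of_int p + of_int k * \<beta>" "y = cnj (of_int m' * of_int p + of_int k' * \<beta>)"
        using I_cases by (metis imageE)
      have "x * y = of_int (m * m' * (p * p) + k * k' * b + m * k' * p * (r + s * tw) + k * m' * p * r)
         + of_int (p * s * (k * m' - m * k')) * w"
        unfolding xy prod unfolding \<beta>_def cnj_coords using b by (simp add: algebra_simps)
      thus "x * y \<in> L" using LI by metis
    qed (use LI[of 0 0] L_add in auto)
    moreover have "of_int g * w \<in> ?P" using GP Ok_w by blast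
    ultimately have "of_int g * w \<in> L" by blast
    then obtain a b where "of_int 0 + of_int g * w = of_int a + of_int (p * s * b) * w" unfolding L_def by auto
    hence "g = p * s * b" using coords_eq by blast
    thus "p * s dvd g" by simp
  qed
  moreover have "int (nrm I) = p * s" using nrm_basis[OF I B] .
  ultimately show ?thesis by (metis of_int_of_nat_eq)
qed


section \<open>Cancellation, divisibility and multiplicativity of the norm\<close>

lemma scale_inj: assumes "c \<noteq> 0" "(*) c ` I = (*) c ` J" shows "I = (J :: complex set)"
  using assms inj_image_eq_iff[of "(*) c"] by (auto simp: inj_on_def)

lemma scale_scale: "(*) a ` (*) b ` I = (*) (a * b) ` (I :: complex set)"
  by (simp add: image_image mult.assoc)

lemma scale_cnj: "cnj ` (*) a ` I = (*) (cnj a) ` cnj ` I"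
  by (simp add: image_image)

text \<open>The conjugate of J undoes multiplication by J up to the scalar N(J); it plays the part
  of the inverse ideal.\<close>

lemma iprod_iprod_cnj: assumes "idl I" "idl J"
  shows "iprod (iprod I J) (cnj ` J) = (*) (of_nat (nrm J)) ` I"
proof -
  have "iprod (iprod I J) (cnj ` J) = iprod ((*) (of_nat (nrm J)) ` Ok) I"
    by (simp only: iprod_assoc iprod_cnj_self[OF assms(2)]) (rule iprod_commute)
  thus ?thesis by (simp only: iprod_scale_left iprod_Ok[OF assms(1)])
qed

lemma iprod_cancel:
  assumes "idl I" "idl I'" "idl J" "iprod I J = iprod I' J" shows "I = I'"
proof -
  have "(*) (of_nat (nrm J)) ` I = (*) (of_nat (nrm J)) ` I'"
    by (simp only: iprod_iprod_cnj[OF assms(1,3), symmetric] iprod_iprod_cnj[OF assms(2,3), symmetric] assms(4))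
  moreover have "(of_nat (nrm J) :: complex) \<noteq> 0" using nrm_pos[OF assms(3)] by simp
  ultimately show ?thesis by (rule scale_inj[rotated])
qed

lemma of_nat_Ok_eq: assumes "k > 0" "m > 0" "(*) (of_nat k) ` Ok = (*) (of_nat m) ` Ok" shows "k = m"
  using of_int_Ok_eq[of "int k" "int m"] assms by simp

text \<open>The product of I J with its conjugate is computed in two ways: at once, and one factor
  at a time.\<close>

lemma nrm_iprod: assumes "idl I" "idl J" shows "nrm (iprod I J) = nrm I * nrm J"
proof (rule of_nat_Ok_eq)
  show "nrm (iprod I J) > 0" "nrm I * nrm J > 0" using nrm_pos assms idl_iprod by simp_all
  have "(*) (of_nat (nrm (iprod I J))) ` Ok = iprod (iprod I J) (cnj ` iprod I J)"
    using iprod_cnj_self[OF idl_iprod[OF assms]] by simp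
  also have "\<dots> = iprod (iprod I J) (iprod (cnj ` J) (cnj ` I))"
    by (simp only: iprod_cnj[symmetric] iprod_commute[of "cnj ` J"])
  also have "\<dots> = iprod (iprod (iprod I J) (cnj ` J)) (cnj ` I)" by (simp only: iprod_assoc)
  also have "\<dots> = (*) (of_nat (nrm J)) ` iprod I (cnj ` I)"
    by (simp only: iprod_iprod_cnj[OF assms] iprod_scale_left)
  also have "\<dots> = (*) (of_nat (nrm I * nrm J)) ` Ok"
    by (simp only: iprod_cnj_self[OF assms(1)] scale_scale) (simp add: mult.commute)
  finally show "(*) (of_nat (nrm (iprod I J))) ` Ok = (*) (of_nat (nrm I * nrm J)) ` Ok" .
qed

lemma nrm_cnj: assumes "idl I" shows "nrm (cnj ` I) = nrm I"
proof (rule of_nat_Ok_eq)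
  have "cnj ` cnj ` I = I" by (simp add: image_image)
  thus "(*) (of_nat (nrm (cnj ` I))) ` Ok = (*) (of_nat (nrm I)) ` Ok"
    using iprod_cnj_self[OF assms] iprod_cnj_self[OF idl_cnj[OF assms]] by (simp add: iprod_commute)
qed (use nrm_pos assms idl_cnj in auto)

text \<open>The ideal times its conjugate is generated by the positive integer |a|^2.\<close>

lemma nrm_principal: assumes "a \<in> Ok" "a \<noteq> 0" shows "real (nrm ((*) a ` Ok)) = (cmod a)\<^sup>2"
proof -
  obtain k where k: "(cmod a)\<^sup>2 = real k" using Ok_norm_nat[OF assms(1)] .
  have id: "idl ((*) a ` Ok)" using idl_scale[OF idl_Ok assms] .
  have "a * cnj a = of_nat k"
    using complex_norm_square[of a] k by (metis of_real_of_nat_eq of_real_power)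
  moreover have "iprod ((*) a ` Ok) ((*) (cnj a) ` Ok) = (*) (a * cnj a) ` Ok"
    by (simp only: iprod_scale_left iprod_Ok[OF idl_scale[OF idl_Ok Ok_cnj[OF assms(1)]]] scale_scale
          assms(2) complex_cnj_zero_iff not_False_eq_True)
  ultimately have "(*) (of_nat (nrm ((*) a ` Ok))) ` Ok = (*) (of_nat k) ` Ok"
    using iprod_cnj_self[OF id] unfolding scale_cnj cnj_Ok by simp
  moreover have "k > 0" using k assms(2) by (cases "k = 0") auto
  ultimately have "nrm ((*) a ` Ok) = k" using nrm_pos[OF id] by (intro of_nat_Ok_eq)
  thus ?thesis using k by simp
qed

lemma nrm_Ok: "nrm Ok = 1"
  using nrm_principal[OF Ok_1] by simp

text \<open>The quotient is L J' / N(J) with J' the conjugate of J. It lies in the order because L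
  J' is contained in J J' = N(J) O.\<close>

lemma contains_divides:
  assumes L: "idl L" and J: "idl J" and sub: "L \<subseteq> J"
  obtains I where "idl I" "L = iprod I J"
proof -
  define n where "n = (of_nat (nrm J) :: complex)"
  have n: "n \<noteq> 0" using nrm_pos[OF J] unfolding n_def by simp
  have LJ: "idl (iprod L (cnj ` J))" using idl_iprod[OF L idl_cnj[OF J]] .
  have s: "iprod L (cnj ` J) \<subseteq> (*) n ` Ok"
    using iprod_mono[OF sub order_refl, of "cnj ` J"] unfolding iprod_cnj_self[OF J] n_def .
  define I where "I = {x. n * x \<in> iprod L (cnj ` J)}"
  have nI: "(*) n ` I = iprod L (cnj ` J)" using s unfolding I_def by auto
  obtain z where z: "z \<in> iprod L (cnj ` J)" "z \<noteq> 0" using idl_nonzero[OF LJ] by blast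
  have id: "idl I"
  proof (rule idlI[of _ "z / n"])
    show "I \<subseteq> Ok"
    proof
      fix x assume "x \<in> I"
      then obtain y where "y \<in> Ok" "n * x = n * y" using s unfolding I_def by blast
      thus "x \<in> Ok" using n by simp
    qed
    show "0 \<in> I" unfolding I_def using idl_0[OF LJ] by simp
    show "x + y \<in> I" if "x \<in> I" "y \<in> I" for x y
      using idl_add[OF LJ] that unfolding I_def by (simp add: distrib_left)
    show "a * x \<in> I" if "a \<in> Ok" "x \<in> I" for a x
      using idl_mult[OF LJ that(1), of "n * x"] that(2) unfolding I_def by (simp add: algebra_simps)
    show "z / n \<in> I" "z / n \<noteq> 0" using z n unfolding I_def by simp_all
  qed
  have "(*) n ` iprod I J = iprod (iprod L (cnj ` J)) J" unfolding nI[symmetric] iprod_scale_left ..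
  also have "\<dots> = iprod (iprod L J) (cnj ` J)" by (simp only: iprod_assoc iprod_commute[of J])
  also have "\<dots> = (*) n ` L" unfolding n_def by (rule iprod_iprod_cnj[OF L J])
  finally have "L = iprod I J" using scale_inj[OF n] by metis
  thus ?thesis using that id by blast
qed

lemma nrm_dvd: assumes "idl L" "idl J" "L \<subseteq> J" shows "nrm J dvd nrm L"
  using contains_divides[OF assms] nrm_iprod[OF _ assms(2)] by (metis dvd_triv_right)

lemma nrm_le: assumes "idl L" "idl J" "L \<subseteq> J" shows "nrm J \<le> nrm L"
  using nrm_dvd[OF assms] nrm_pos[OF assms(1)] by (rule dvd_imp_le)

lemma principal_sub: assumes "idl I" "a \<in> I" shows "(*) a ` Ok \<subseteq> I"
  using idl_mult[OF assms(1) _ assms(2)] by (auto simp: mult.commute)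

text \<open>The nonzero elements of an ideal start at its norm; this is what makes sums over ideals
  terminate at the cutoff.\<close>

lemma nrm_le_norm: assumes "idl I" "a \<in> I" "a \<noteq> 0" shows "real (nrm I) \<le> (cmod a)\<^sup>2"
proof -
  have "a \<in> Ok" using assms idl_sub by blast
  have "nrm I \<le> nrm ((*) a ` Ok)"
    by (rule nrm_le[OF idl_scale[OF idl_Ok \<open>a \<in> Ok\<close> assms(3)] assms(1) principal_sub[OF assms(1,2)]])
  thus ?thesis using nrm_principal[OF \<open>a \<in> Ok\<close> assms(3)] by simp
qed

section \<open>Finiteness: ideals of bounded norm, ideals up to homothety\<close>

lemma finite_idl_le: "finite {I. idl I \<and> nrm I \<le> N}"
proof -
  let ?f = "\<lambda>(p, s, r). {of_int m * of_int p + of_int k * (of_int r + of_int s * w) | m k. True}"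
  have "{I. idl I \<and> nrm I \<le> N} \<subseteq> ?f ` ({0..int N} \<times> {0..int N} \<times> {0..int N})"
  proof (rule subsetI, clarify)
    fix I assume I: "idl I" "nrm I \<le> N"
    obtain p s r where B: "hermite_basis I p s r" using I(1) by (rule idl_basis)
    hence pos: "p > 0" "s > 0" "0 \<le> r" "r < p" and eq: "I = ?f (p, s, r)" unfolding hermite_basis_def by simp_all
    have "p * s \<le> int N" using nrm_basis[OF I(1) B] I(2) by simp
    moreover have "p * 1 \<le> p * s" "1 * s \<le> p * s" using pos by (intro mult_mono; linarith)+
    ultimately have "p \<le> int N" "s \<le> int N" by linarith+
    hence "(p, s, r) \<in> {0..int N} \<times> {0..int N} \<times> {0..int N}" using pos by simp
    thus "I \<in> ?f ` ({0..int N} \<times> {0..int N} \<times> {0..int N})" unfolding eq by (rule imageI)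
  qed
  thus ?thesis by (rule finite_subset) simp
qed

lemma finite_idl_above: assumes "idl I" shows "finite {J. idl J \<and> I \<subseteq> J}"
  by (rule finite_subset[OF _ finite_idl_le[of "nrm I"]]) (use nrm_le[OF assms] in auto)

lemma idl_one_iff: assumes "idl I" shows "1 \<in> I \<longleftrightarrow> I = Ok"
  using idl_sub[OF assms] idl_mult[OF assms, of _ 1] Ok_1 by force

text \<open>Pigeonhole: among the i + j w with 0 \<le> i, j \<le> K, two are congruent modulo I, and
  their difference is small.\<close>

lemma idl_small_element:
  assumes I: "idl I"
  obtains a where "a \<in> I" "a \<noteq> 0" "(cmod a)\<^sup>2 \<le> (1 + cmod w)\<^sup>2 * nrm I"
proof -
  \<comment> \<open>The largest K with K^2 \<le> N(I), so that (K + 1)^2 points outnumber the N(I)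
    classes.\<close>
  define K where "K = nat \<lfloor>sqrt (nrm I)\<rfloor>"
  have K: "real K \<le> sqrt (nrm I)" "sqrt (nrm I) < real K + 1" unfolding K_def by (simp_all add: of_nat_nat)
  let ?c = "\<lambda>x. (\<lambda>h. h + x) ` I"
  let ?f = "\<lambda>(i, j). ?c (of_int (int i) + of_int (int j) * w)"
  have fin: "finite (?c ` Ok)" using nrm_pos[OF I] unfolding nrm_def by (rule card_ge_0_finite)
  have "?f ` ({0..K} \<times> {0..K}) \<subseteq> ?c ` Ok"     by (rule image_subsetI, unfold split_paired_all prod.case) (rule imageI[OF OkI])
  hence "card (?f ` ({0..K} \<times> {0..K})) \<le> nrm I" unfolding nrm_def by (rule card_mono[OF fin])
  also have "nrm I < (K + 1) * (K + 1)"
  proof -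
    have "real (nrm I) = sqrt (nrm I) * sqrt (nrm I)" by simp
    also have "\<dots> < (real K + 1) * (real K + 1)" using K(2) by (intro mult_strict_mono) auto
    also have "\<dots> = real ((K + 1) * (K + 1))" by (simp add: algebra_simps)
    finally show ?thesis by (simp only: of_nat_less_iff)
  qed
  also have "\<dots> = card ({0..K} \<times> {0..K})" by (simp add: card_cartesian_product)
  finally have "\<not> inj_on ?f ({0..K} \<times> {0..K})" using card_image by fastforce
  then obtain i j i' j' where ij: "i \<le> K" "j \<le> K" "i' \<le> K" "j' \<le> K" "(i, j) \<noteq> (i', j')" "?f (i, j) = ?f (i', j')"
    unfolding inj_on_def by auto
  define a where "a = of_int (int i - int i') + of_int (int j - int j') * w"
  have "a = (of_int (int i) + of_int (int j) * w) - (of_int (int i') + of_int (int j') * w)"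
    unfolding a_def by (simp add: algebra_simps)
  hence aI: "a \<in> I" using ij(6) unfolding prod.case coset_eq_iff[OF I] by simp
  have a0: "a \<noteq> 0"
  proof
    assume "a = 0"
    hence "of_int (int i - int i') + of_int (int j - int j') * w = of_int 0 + of_int 0 * w" unfolding a_def by simp
    hence "int i - int i' = 0 \<and> int j - int j' = 0" using coords_eq by blast
    thus False using ij(5) by simp
  qed
  have "cmod a \<le> \<bar>real_of_int (int i - int i')\<bar> + \<bar>real_of_int (int j - int j')\<bar> * cmod w"
    unfolding a_def by (metis norm_mult norm_of_int norm_triangle_ineq)
  also have "\<dots> \<le> real K + real K * cmod w" using ij by (intro add_mono mult_right_mono) auto
  also have "\<dots> \<le> sqrt (nrm I) * (1 + cmod w)"     using mult_right_mono[OF K(1), of "1 + cmod w"] by (simp add: algebra_simps)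
  finally have "(cmod a)\<^sup>2 \<le> (sqrt (nrm I) * (1 + cmod w))\<^sup>2" by (intro power_mono) auto
  also have "\<dots> = (1 + cmod w)\<^sup>2 * nrm I" by (simp add: power_mult_distrib)
  finally show ?thesis using that aI a0 by blast
qed

text \<open>Finiteness of the class number, with control of the scaling factor. A small a in I gives
  (a) = J I with N(J) bounded; multiplying by the conjugate J' turns this into N(J) I = a J'. The
  ideal returned as \<open>J\<close> is this conjugate, which has the same norm.\<close>

lemma idl_homothety:
  assumes I: "idl I"
  obtains a J where "a \<in> Ok" "a \<noteq> 0" "idl J" "real (nrm J) \<le> (1 + cmod w)\<^sup>2"
    "(cmod a)\<^sup>2 = real (nrm I) * real (nrm J)" "I = (*) (a / of_nat (nrm J)) ` J"
proof -
  obtain a where a: "a \<in> I" "a \<noteq> 0" "(cmod a)\<^sup>2 \<le> (1 + cmod w)\<^sup>2 * nrm I" using idl_small_element[OF I] .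
  have aO: "a \<in> Ok" using a(1) idl_sub[OF I] by blast
  obtain J where J: "idl J" "(*) a ` Ok = iprod J I"
    using contains_divides[OF idl_scale[OF idl_Ok aO a(2)] I principal_sub[OF I a(1)]] .
  have N: "(cmod a)\<^sup>2 = real (nrm I) * real (nrm J)"
    using nrm_principal[OF aO a(2)] nrm_iprod[OF J(1) I] unfolding J(2) by (simp add: mult.commute)
  hence "real (nrm I) * real (nrm J) \<le> real (nrm I) * (1 + cmod w)\<^sup>2" using a(3) by (simp add: mult.commute)
  hence le: "real (nrm J) \<le> (1 + cmod w)\<^sup>2" using nrm_pos[OF I] by simp
  have n: "(of_nat (nrm J) :: complex) \<noteq> 0" using nrm_pos[OF J(1)] by simp
  have "(*) (of_nat (nrm J)) ` I = iprod (iprod I J) (cnj ` J)" using iprod_iprod_cnj[OF I J(1)] by simp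
  also have "\<dots> = (*) a ` cnj ` J"
    by (simp only: iprod_commute[of I] J(2)[symmetric] iprod_scale_left iprod_Ok[OF idl_cnj[OF J(1)]])
  also have "\<dots> = (*) (of_nat (nrm J)) ` (*) (a / of_nat (nrm J)) ` cnj ` J"
    unfolding scale_scale using n by simp
  finally have "I = (*) (a / of_nat (nrm J)) ` cnj ` J" by (rule scale_inj[OF n])
  thus ?thesis using that[of a "cnj ` J"] aO a(2) idl_cnj[OF J(1)] N le nrm_cnj[OF J(1)] by simp
qed

end

section \<open>Reciprocal sums over ideals\<close>

lemma sum_inverse_3_2_bound: "\<exists>B\<ge>0. \<forall>n. (\<Sum>k=1..n. 1 / (real k * sqrt (real k))) \<le> B"
proof -
  have "summable (\<lambda>k. real k powr (-3/2))" by (subst summable_real_powr_iff) simp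
  moreover have "(\<Sum>k=1..n. 1 / (real k * sqrt (real k))) = (\<Sum>k=1..n. real k powr (-3/2))" for n
  proof (rule sum.cong)
    fix k assume "k \<in> {1..n}"
    hence k: "real k > 0" by simp
    have "real k powr (-3/2) = inverse (real k powr (1 + 1/2))" using powr_minus[of "real k" "3/2"] by simp
    also have "real k powr (1 + 1/2) = real k * sqrt (real k)"
      using k powr_half_sqrt[of "real k"] unfolding powr_add by (simp only: powr_one less_imp_le)
    finally show "1 / (real k * sqrt (real k)) = real k powr (-3/2)" by (simp only: inverse_eq_divide)
  qed simp
  ultimately have "(\<Sum>k=1..n. 1 / (real k * sqrt (real k))) \<le> (\<Sum>k. real k powr (-3/2))" for n
    using sum_le_suminf[of "\<lambda>k. real k powr (-3/2)" "{1..n}"] by simp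
  moreover have "0 \<le> (\<Sum>k. real k powr (-3/2))"
    using \<open>summable _\<close> by (intro suminf_nonneg) auto
  ultimately show ?thesis by blast
qed

lemma ln_Suc_diff_le:
  assumes "n \<ge> 1" shows "ln (real n + 1) - ln (real n) \<le> 1"
proof -
  have "1 + 1 / real n = (real n + 1) / real n" using assms by (simp add: field_simps)
  hence "ln (real n + 1) - ln (real n) = ln (1 + 1 / real n)" using assms by (simp add: ln_div)
  also have "\<dots> \<le> 1 / real n" by (rule ln_add_one_self_le_self) simp
  also have "\<dots> \<le> 1" using assms by simp
  finally show ?thesis .
qed

text \<open>The sum runs over 1 / (k + 1) because k / (k (k + 1)) is what the main term k leaves in
  \<open>recip_sum_nat\<close>.\<close>

lemma harmonic_ln_bound:
  assumes "n \<ge> 1" shows "\<bar>(\<Sum>k=1..n. 1 / (real k + 1)) - ln (real n)\<bar> \<le> 1"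
proof -
  have eq: "(\<Sum>k=1..m. 1 / (real k + 1)) = harm (Suc m) - 1" for m
    by (induction m) (simp_all add: harm_Suc harm_expand divide_inverse add_ac)
  have "harm (Suc n) - ln (real (Suc n)) \<le> harm (Suc 0) - ln (real (Suc 0))"
    using decseq_harm_diff_ln by (rule decseqD) simp
  hence up: "harm (Suc n) \<le> ln (real n + 1) + 1" by (simp add: harm_expand add_ac)
  note d = ln_Suc_diff_le[OF assms]
  have "ln (real n) \<le> ln (real (Suc n) + 1)" using assms by simp
  also have "\<dots> \<le> harm (Suc n)" by (rule ln_le_harm)
  finally show ?thesis unfolding eq using up d by linarith
qed

context imag_quadratic begin

text \<open>The covolume of I is p s Im w = N(I) Im w. The quotient \<open>pi / Im w\<close> is
  \<kappa> of the overview, because the discriminant will turn out to be -4 (Im w)^2.\<close>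

lemma idl_count:
  assumes I: "idl I"
  obtains C where "C \<ge> 0" "\<And>z \<rho>. \<rho> \<ge> 0 \<Longrightarrow> finite {x \<in> I. cmod (x + z) \<le> \<rho>}"
    "\<And>z \<rho>. \<rho> \<ge> 0 \<Longrightarrow>
      \<bar>real (card {x \<in> I. cmod (x + z) \<le> \<rho>}) - pi / Im w / nrm I * \<rho>\<^sup>2\<bar> \<le> C * (\<rho> + 1)"
proof -
  obtain p s r where B: "hermite_basis I p s r" using I by (rule idl_basis)
  hence pos: "p > 0" "s > 0"
    and eq: "I = {of_int m * of_int p + of_int k * (of_int r + of_int s * w) | m k. True}"
    unfolding hermite_basis_def by simp_all
  have L: "I = brick_lattice (of_int p) (of_int r + of_int s * w)"
    unfolding eq brick_lattice_def by simp
  have e: "real_of_int p * Im (of_int r + of_int s * w) = nrm I * Im w"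
    using arg_cong[OF nrm_basis[OF I B], of real_of_int] by simp
  have "real_of_int p > 0" "Im (of_int r + of_int s * w) > 0" using pos Im_w by simp_all
  from brick_lattice_count[OF this] obtain C where C: "C \<ge> 0"
    "\<And>z \<rho>. \<rho> \<ge> 0 \<Longrightarrow> finite {x \<in> I. cmod (x + z) \<le> \<rho>}"
    "\<And>z \<rho>. \<rho> \<ge> 0 \<Longrightarrow> \<bar>real (card {x \<in> I. cmod (x + z) \<le> \<rho>}) - pi * \<rho>\<^sup>2 / (nrm I * Im w)\<bar> \<le> C * (\<rho> + 1)"
    unfolding e L[symmetric] by blast
  have e2: "pi * \<rho>\<^sup>2 / (nrm I * Im w) = pi / Im w / nrm I * \<rho>\<^sup>2" for \<rho> by simp
  show ?thesis by (rule that[OF C(1) C(2) C(3)[unfolded e2]])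
qed

section \<open>Counting and summing over the elements of an ideal\<close>

definition ball0 :: "complex set \<Rightarrow> real \<Rightarrow> complex set" where
  "ball0 I Q = {x \<in> I. x \<noteq> 0 \<and> (cmod x)\<^sup>2 \<le> Q}"

text \<open>This is h(I) of the overview; |x|^2 is the norm of the principal ideal of x.\<close>

definition recip_sum :: "complex set \<Rightarrow> real \<Rightarrow> real" where
  "recip_sum I Q = (\<Sum>x\<in>ball0 I Q. 1 / (cmod x)\<^sup>2)"

lemma ball0_alt: "ball0 I Q = {x \<in> I. cmod (x + 0) \<le> sqrt Q} - {0}"
proof -
  have "(cmod x)\<^sup>2 \<le> Q \<longleftrightarrow> cmod x \<le> sqrt Q" for x using real_sqrt_le_iff[of "(cmod x)\<^sup>2" Q] by simp
  thus ?thesis unfolding ball0_def by auto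
qed

lemma finite_ball0: assumes "idl I" shows "finite (ball0 I Q)"
proof (cases "Q \<ge> 0")
  case True
  hence "finite {x \<in> I. cmod (x + 0) \<le> sqrt Q}" using idl_count[OF assms] by (metis real_sqrt_ge_zero)
  thus ?thesis unfolding ball0_alt by simp
next
  case False
  hence "ball0 I Q = {}" unfolding ball0_def using zero_le_power2 order_trans by blast
  thus ?thesis by simp
qed

lemma card_ball0:
  assumes I: "idl I"
  obtains C where "C \<ge> 0" "\<And>Q. Q \<ge> 1 \<Longrightarrow> \<bar>real (card (ball0 I Q)) - pi / Im w / nrm I * Q\<bar> \<le> C * sqrt Q"
proof -
  obtain C where C: "C \<ge> 0" "\<And>z \<rho>. \<rho> \<ge> 0 \<Longrightarrow> finite {x \<in> I. cmod (x + z) \<le> \<rho>}"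
    "\<And>z \<rho>. \<rho> \<ge> 0 \<Longrightarrow>
      \<bar>real (card {x \<in> I. cmod (x + z) \<le> \<rho>}) - pi / Im w / nrm I * \<rho>\<^sup>2\<bar> \<le> C * (\<rho> + 1)"
    using idl_count[OF I] by blast
  \<comment> \<open>As \<surd>Q \<ge> 1, the factor 2 C + 1 absorbs both the constant term of the
    lattice count and the excluded element 0.\<close>
  have "\<bar>real (card (ball0 I Q)) - pi / Im w / nrm I * Q\<bar> \<le> (2 * C + 1) * sqrt Q" if Q: "Q \<ge> 1" for Q
  proof -
    let ?S = "{x \<in> I. cmod (x + 0) \<le> sqrt Q}"
    have S: "finite ?S" "\<bar>real (card ?S) - pi / Im w / nrm I * Q\<bar> \<le> C * (sqrt Q + 1)"
      using C(2,3)[of "sqrt Q" 0] Q by simp_all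
    have "0 \<in> ?S" using idl_0[OF I] Q by simp
    hence "card ?S = Suc (card (ball0 I Q))" unfolding ball0_alt using S(1) by (rule card.remove[rotated])
    hence "real (card (ball0 I Q)) = real (card ?S) - 1" by simp
    moreover have "sqrt Q \<ge> 1" using Q by simp
    moreover have "C \<le> C * sqrt Q" using C(1) \<open>sqrt Q \<ge> 1\<close> mult_left_mono[of 1 "sqrt Q" C] by simp
    moreover have "(2 * C + 1) * sqrt Q = 2 * (C * sqrt Q) + sqrt Q" "C * (sqrt Q + 1) = C * sqrt Q + C"
      by (simp_all add: algebra_simps)
    ultimately show ?thesis using S(2) by linarith
  qed
  thus ?thesis using that[of "2 * C + 1"] C(1) by simp
qed

text \<open>Summation by parts in the form of an induction: by integrality, the step from n to n + 1
  adds exactly the elements of norm n + 1.\<close>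

lemma recip_sum_nat:
  assumes I: "idl I"
  shows "recip_sum I (real n) = card (ball0 I (real n)) / (real n + 1) +
     (\<Sum>k=1..n. card (ball0 I (real k)) / (real k * (real k + 1)))"
proof (induction n)
  case 0
  have "ball0 I 0 = {}" unfolding ball0_def by simp
  thus ?case by (simp add: recip_sum_def)
next
  case (Suc n)
  let ?A = "ball0 I (real n)" and ?B = "ball0 I (real (Suc n))"
  have AB: "?A \<subseteq> ?B" unfolding ball0_def by auto
  have fin: "finite ?B" "finite ?A" using finite_ball0[OF I] by auto
  have "(cmod x)\<^sup>2 = real n + 1" if "x \<in> ?B - ?A" for x
  proof -
    have "x \<in> Ok" using that idl_sub[OF I] unfolding ball0_def by blast
    then obtain k where k: "(cmod x)\<^sup>2 = real k" by (rule Ok_norm_nat)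
    hence "\<not> real k \<le> real n" "real k \<le> real (Suc n)" using that unfolding ball0_def by auto
    hence "k = Suc n" by linarith
    thus ?thesis using k by simp
  qed
  hence "(\<Sum>x\<in>?B - ?A. 1 / (cmod x)\<^sup>2) = card (?B - ?A) * (1 / (real n + 1))" by simp
  also have "real (card (?B - ?A)) = real (card ?B) - real (card ?A)"
    using card_Diff_subset[OF fin(2) AB] card_mono[OF fin(1) AB] by simp
  finally have "recip_sum I (real (Suc n)) = recip_sum I (real n) + (real (card ?B) - real (card ?A)) * (1 / (real n + 1))"
    unfolding recip_sum_def using sum.subset_diff[OF AB fin(1), of "\<lambda>x. 1 / (cmod x)\<^sup>2"] by simp
  moreover have "real (card ?B) / (real n + 2) + real (card ?B) / ((real n + 1) * (real n + 2)) = real (card ?B) / (real n + 1)"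
    by (simp add: divide_simps) (simp add: algebra_simps)
  ultimately show ?case unfolding Suc.IH by (simp add: diff_divide_distrib add_ac)
qed

text \<open>In the summation by parts, the main term c k of the count produces c ln n through the
  harmonic sum, the error \<surd>k leaves a convergent series of exponent 3/2, and the boundary term
  is bounded. The constant still depends on I.\<close>

lemma recip_sum_asymp:
  assumes I: "idl I"
  obtains C where "C \<ge> 0" "\<And>Q. Q \<ge> 1 \<Longrightarrow> \<bar>recip_sum I Q - pi / Im w / nrm I * ln Q\<bar> \<le> C"
proof -
  define c where "c = pi / Im w / nrm I"
  have c0: "c \<ge> 0" unfolding c_def using Im_w by simp
  obtain C where C: "C \<ge> 0" "\<And>Q. Q \<ge> 1 \<Longrightarrow> \<bar>real (card (ball0 I Q)) - c * Q\<bar> \<le> C * sqrt Q"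
    using card_ball0[OF I] unfolding c_def by blast
  obtain B where B: "B \<ge> 0" "\<And>n. (\<Sum>k=1..n. 1 / (real k * sqrt (real k))) \<le> B"
    using sum_inverse_3_2_bound by blast
  have nat: "\<bar>recip_sum I (real n) - c * ln (real n)\<bar> \<le> c + C + C * B + c" if n: "n \<ge> 1" for n
  proof -
    let ?R = "\<lambda>k. real (card (ball0 I (real k)))"
    have "(\<Sum>k=1..n. ?R k / (real k * (real k + 1))) - c * (\<Sum>k=1..n. 1 / (real k + 1)) =
        (\<Sum>k=1..n. ?R k / (real k * (real k + 1)) - c * (1 / (real k + 1)))"
      by (simp add: sum_subtractf sum_distrib_left)
    also have "\<bar>\<dots>\<bar> \<le> (\<Sum>k=1..n. C * (1 / (real k * sqrt (real k))))"
    proof (rule sum_abs[THEN order_trans], rule sum_mono)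
      fix k assume "k \<in> {1..n}"
      hence k: "real k \<ge> 1" by simp
      have "?R k / (real k * (real k + 1)) - c * (1 / (real k + 1)) = (?R k - c * real k) / (real k * (real k + 1))"
      proof -
        have "c * (1 / (real k + 1)) = c * real k / (real k * (real k + 1))" using k by simp
        thus ?thesis by (simp only: diff_divide_distrib)
      qed
      also have "\<bar>\<dots>\<bar> \<le> C * sqrt (real k) / (real k * (real k + 1))"
        using C(2)[OF k] k by (simp add: abs_divide divide_right_mono)
      also have "\<dots> \<le> C * sqrt (real k) / (real k * real k)"
        using C(1) k by (intro divide_left_mono) auto
      also have "\<dots> = C * (1 / (real k * sqrt (real k)))"
      proof -
        have "sqrt (real k) * sqrt (real k) = real k" by simp
        thus ?thesis using k by (simp add: field_simps)
      qed
      finally show "\<bar>?R k / (real k * (real k + 1)) - c * (1 / (real k + 1))\<bar> \<le> C * (1 / (real k * sqrt (real k)))" .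
    qed
    also have "\<dots> \<le> C * B" unfolding sum_distrib_left[symmetric] using B(2) C(1) by (rule mult_left_mono)
    finally have 1: "\<bar>(\<Sum>k=1..n. ?R k / (real k * (real k + 1))) - c * (\<Sum>k=1..n. 1 / (real k + 1))\<bar> \<le> C * B" .
    have "\<bar>c * ((\<Sum>k=1..n. 1 / (real k + 1)) - ln (real n))\<bar> \<le> c * 1"
      unfolding abs_mult using harmonic_ln_bound[OF n] c0 by (intro mult_mono) auto
    hence 2: "\<bar>c * (\<Sum>k=1..n. 1 / (real k + 1)) - c * ln (real n)\<bar> \<le> c" by (simp add: algebra_simps)
    have "real n \<ge> 1" using n by simp
    hence "sqrt (real n) * 1 \<le> sqrt (real n) * sqrt (real n)" by (intro mult_left_mono) auto
    hence "sqrt (real n) \<le> real n + 1" by simp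
    hence "C * sqrt (real n) \<le> C * (real n + 1)" using C(1) by (rule mult_left_mono)
    hence "?R n \<le> (c + C) * (real n + 1)"
      using C(2)[OF \<open>real n \<ge> 1\<close>] c0 unfolding distrib_right by (simp add: algebra_simps abs_le_iff)
    hence "?R n / (real n + 1) \<le> c + C" by (simp add: divide_le_eq)
    moreover have "?R n / (real n + 1) \<ge> 0" by simp
    ultimately show ?thesis unfolding recip_sum_nat[OF I] using 1 2 by linarith
  qed
  have "\<bar>recip_sum I Q - c * ln Q\<bar> \<le> c + C + C * B + c + c" if Q: "Q \<ge> 1" for Q
  proof -
    \<comment> \<open>Norms are integers, so the sum is the same at n and at Q, while the logarithm
      moves by at most 1.\<close>
    define n where "n = nat \<lfloor>Q\<rfloor>"
    have n: "n \<ge> 1" "real n \<le> Q" "Q < real n + 1" unfolding n_def using Q by linarith+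
    have "ball0 I Q = ball0 I (real n)"
    proof -
      have "(cmod x)\<^sup>2 \<le> Q \<longleftrightarrow> (cmod x)\<^sup>2 \<le> real n" if "x \<in> I" for x
      proof -
        have "x \<in> Ok" using that idl_sub[OF I] by blast
        then obtain k where k: "(cmod x)\<^sup>2 = real k" by (rule Ok_norm_nat)
        have "real k \<le> real n" if "real k \<le> Q"
        proof -
          have "real k < real (n + 1)" using that n by simp
          hence "k < n + 1" by (simp only: of_nat_less_iff)
          thus ?thesis by simp
        qed
        thus ?thesis unfolding k using n by linarith
      qed
      thus ?thesis unfolding ball0_def by blast
    qed
    hence "recip_sum I Q = recip_sum I (real n)" unfolding recip_sum_def by simp
    moreover have "ln (real n) \<le> ln Q" using n by simp
    moreover have "ln Q - ln (real n) \<le> 1"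
    proof -
      have "ln Q \<le> ln (real n + 1)" using n Q by simp
      thus ?thesis using ln_Suc_diff_le[OF n(1)] by linarith
    qed
    ultimately have "c * (ln Q - ln (real n)) \<le> c * 1" "0 \<le> c * (ln Q - ln (real n))"
      using c0 by (intro mult_left_mono mult_nonneg_nonneg; simp)+
    thus ?thesis using nat[OF n(1)] \<open>recip_sum I Q = _\<close> by (simp add: algebra_simps abs_le_iff)
  qed
  thus ?thesis using that[of "c + C + C * B + c + c"] C(1) B(1) c0 unfolding c_def by auto
qed

lemma recip_sum_scale:
  assumes "c \<noteq> 0" shows "recip_sum ((*) c ` I) Q = recip_sum I (Q / (cmod c)\<^sup>2) / (cmod c)\<^sup>2"
proof -
  have "ball0 ((*) c ` I) Q = (*) c ` ball0 I (Q / (cmod c)\<^sup>2)"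
    unfolding ball0_def using assms by (auto simp: norm_mult power_mult_distrib field_simps)
  moreover have "inj_on ((*) c) A" for A using assms by (auto simp: inj_on_def)
  ultimately have "recip_sum ((*) c ` I) Q = (\<Sum>x\<in>ball0 I (Q / (cmod c)\<^sup>2). 1 / (cmod (c * x))\<^sup>2)"
    unfolding recip_sum_def by (simp add: sum.reindex)
  thus ?thesis unfolding recip_sum_def
    by (simp add: norm_mult power_mult_distrib sum_divide_distrib mult.commute)
qed

lemma recip_sum_large: assumes "idl J" "Q < real (nrm J)" shows "recip_sum J Q = 0"
proof -
  have "ball0 J Q = {}" using nrm_le_norm[OF assms(1)] assms(2) unfolding ball0_def by fastforce
  thus ?thesis unfolding recip_sum_def by simp
qed

text \<open>A homothety carries I to one of finitely many J and replaces Q by Q N(J) / N(I). The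
  logarithm shifts by ln N(J) - ln N(I): the first is bounded, the second is the loss ln N(I) in the
  error. The cruder upper bound controls the second factor when squares of these sums are
  compared.\<close>

lemma recip_sum_uniform:
  obtains C where "C \<ge> 0"
    "\<And>I Q. idl I \<Longrightarrow> Q \<ge> 1 \<Longrightarrow> \<bar>recip_sum I Q - pi / Im w / nrm I * ln Q\<bar> \<le> C * (1 + ln (nrm I)) / nrm I"
    "\<And>I Q. idl I \<Longrightarrow> Q \<ge> 1 \<Longrightarrow> recip_sum I Q \<le> C * (1 + ln Q) / nrm I"
proof -
  define \<kappa> where "\<kappa> = pi / Im w"
  have \<kappa>: "\<kappa> > 0" unfolding \<kappa>_def using Im_w by simp
  define M where "M = nat \<lfloor>(1 + cmod w)\<^sup>2\<rfloor>"
  let ?F = "{J. idl J \<and> nrm J \<le> M}"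
  have "\<exists>C. C \<ge> 0 \<and> (\<forall>Q\<ge>1. \<bar>recip_sum J Q - \<kappa> / nrm J * ln Q\<bar> \<le> C)" if "idl J" for J
    using recip_sum_asymp[OF that] unfolding \<kappa>_def by metis
  then obtain c where c: "\<And>J. idl J \<Longrightarrow> c J \<ge> 0"
    "\<And>J Q. idl J \<Longrightarrow> Q \<ge> 1 \<Longrightarrow> \<bar>recip_sum J Q - \<kappa> / nrm J * ln Q\<bar> \<le> c J" by metis
  \<comment> \<open>The sum over the finite set bounds the contribution of each single J; the extra
    \<kappa> covers the case Q < N(I).\<close>
  define C where "C = \<kappa> + (\<Sum>J\<in>?F. \<kappa> * ln (nrm J) + nrm J * c J)"
  have nonneg: "0 \<le> \<kappa> * ln (nrm J) + nrm J * c J" if "idl J" for J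
    using c(1)[OF that] nrm_pos[OF that] \<kappa> by simp
  have C: "\<kappa> * ln (nrm J) + nrm J * c J + \<kappa> \<le> C" if "J \<in> ?F" for J
    unfolding C_def using member_le_sum[of J ?F "\<lambda>J. \<kappa> * ln (nrm J) + nrm J * c J"] that finite_idl_le nonneg by auto
  have C\<kappa>: "C \<ge> \<kappa>" unfolding C_def using nonneg by (auto intro!: sum_nonneg)
  have main: "\<bar>recip_sum I Q - \<kappa> / nrm I * ln Q\<bar> \<le> C * (1 + ln (nrm I)) / nrm I \<and> recip_sum I Q \<le> C * (1 + ln Q) / nrm I"
    if I: "idl I" and Q: "Q \<ge> 1" for I Q
  proof (cases "Q < nrm I")
    case True
    \<comment> \<open>The sum is empty here, and the main term \<kappa> ln Q / N(I) is itself within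
      the error, as ln Q < ln N(I).\<close>
    have z: "recip_sum I Q = 0" by (rule recip_sum_large[OF I True])
    have "ln Q \<le> ln (real (nrm I))" using True Q by simp
    hence "\<kappa> * ln Q \<le> C * (1 + ln (nrm I))"
      using Q C\<kappa> \<kappa> by (intro mult_mono) auto
    hence "\<kappa> * ln Q / nrm I \<le> C * (1 + ln (nrm I)) / nrm I" by (rule divide_right_mono) simp
    moreover have "0 \<le> \<kappa> * ln Q / nrm I" "0 \<le> C * (1 + ln Q) / nrm I" using \<kappa> C\<kappa> Q by simp_all
    ultimately show ?thesis unfolding z by simp
  next
    case False
    obtain a J where a: "a \<in> Ok" "a \<noteq> 0" "idl J" "real (nrm J) \<le> (1 + cmod w)\<^sup>2"
      "(cmod a)\<^sup>2 = real (nrm I) * real (nrm J)" "I = (*) (a / of_nat (nrm J)) ` J"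
      using I by (rule idl_homothety)
    have N: "real (nrm I) \<ge> 1" "real (nrm J) \<ge> 1" using nrm_pos[OF I] nrm_pos[OF a(3)] by simp_all
    have "nrm J \<le> M" unfolding M_def using a(4) by (simp add: le_nat_floor)
    hence JF: "J \<in> ?F" using a(3) by simp
    define d where "d = a / of_nat (nrm J)"
    have d: "(cmod d)\<^sup>2 = real (nrm I) / real (nrm J)"
      unfolding d_def norm_divide power_divide a(5) using N by (simp add: power2_eq_square)
    have d0: "d \<noteq> 0" unfolding d_def using a(2) N by simp
    define Q' where "Q' = Q * nrm J / nrm I"
    have eq: "recip_sum I Q = recip_sum J Q' * nrm J / nrm I"
      unfolding a(6) d_def[symmetric] recip_sum_scale[OF d0] d Q'_def using N by simp
    \<comment> \<open>This is where N(I) \<le> Q enters: the asymptotics for J hold only from 1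
      on.\<close>
    have Q': "Q' \<ge> 1"
    proof -
      have "1 * real (nrm I) \<le> real (nrm J) * Q" using False N by (intro mult_mono) auto
      thus ?thesis unfolding Q'_def using N by (simp add: le_divide_eq mult.commute)
    qed
    have lnQ': "ln Q' = ln Q + ln (nrm J) - ln (nrm I)" unfolding Q'_def using N Q by (simp add: ln_mult ln_div)
    have "\<bar>recip_sum J Q' - \<kappa> / nrm J * ln Q'\<bar> * nrm J \<le> c J * nrm J" using c(2)[OF a(3) Q'] by (rule mult_right_mono) simp
    hence "\<bar>(recip_sum J Q' - \<kappa> / nrm J * ln Q') * nrm J\<bar> \<le> c J * nrm J" by (simp add: abs_mult)
    moreover have "(recip_sum J Q' - \<kappa> / nrm J * ln Q') * nrm J = recip_sum J Q' * nrm J - \<kappa> * ln Q'"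
      using N by (simp add: field_simps)
    ultimately have 1: "\<bar>recip_sum J Q' * nrm J - \<kappa> * ln Q'\<bar> \<le> c J * nrm J" by simp
    have ln0: "0 \<le> \<kappa> * ln (nrm I)" "0 \<le> \<kappa> * ln (nrm J)" "0 \<le> \<kappa> * ln Q" using N \<kappa> Q by simp_all
    have "C * ln (nrm I) \<ge> \<kappa> * ln (nrm I)" "C * ln Q \<ge> \<kappa> * ln Q" using C\<kappa> N Q by (simp_all add: mult_right_mono)
    hence "\<bar>recip_sum J Q' * nrm J - \<kappa> * ln Q\<bar> \<le> C * (1 + ln (nrm I))"
      "recip_sum J Q' * nrm J \<le> C * (1 + ln Q)"
      using 1 ln0 C[OF JF] \<kappa> unfolding lnQ' abs_le_iff by (simp_all add: algebra_simps)
    hence "\<bar>recip_sum J Q' * nrm J - \<kappa> * ln Q\<bar> / nrm I \<le> C * (1 + ln (nrm I)) / nrm I"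
      "recip_sum J Q' * nrm J / nrm I \<le> C * (1 + ln Q) / nrm I" by (simp_all add: divide_right_mono)
    moreover have "recip_sum I Q - \<kappa> / nrm I * ln Q = (recip_sum J Q' * nrm J - \<kappa> * ln Q) / nrm I"
      unfolding eq using N by (simp add: diff_divide_distrib)
    ultimately show ?thesis unfolding eq[symmetric] by (simp add: abs_divide)
  qed
  show ?thesis using that[of C] main C\<kappa> \<kappa> unfolding \<kappa>_def[symmetric] by auto
qed

end

section \<open>The Moebius function and the zeta function\<close>

text \<open>
  Instead of summing by parts, spread each term \<open>N\<close> to the power \<open>-3/2\<close> over the terms
  \<open>m\<close> to the power \<open>-5/2\<close> with \<open>N \<le> m \<le> 2 N\<close> and exchange the summations.
\<close>

lemma sum_norm_3_2_bound:
  obtains B :: real where "B \<ge> 0" "\<And>(G :: 'a set) N (C::real). finite G \<Longrightarrow> (\<And>x. x \<in> G \<Longrightarrow> (N x :: nat) \<ge> 1) \<Longrightarrow>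
      (\<And>m. m \<ge> 1 \<Longrightarrow> real (card {x \<in> G. N x \<le> m}) \<le> C * real m) \<Longrightarrow>
      (\<Sum>x\<in>G. 1 / (real (N x) * sqrt (N x))) \<le> B * C"
proof -
  obtain B where B: "B \<ge> 0" "\<And>n. (\<Sum>k=1..n. 1 / (real k * sqrt (real k))) \<le> B"
    using sum_inverse_3_2_bound by blast
  have "(\<Sum>x\<in>G. 1 / (real (N x) * sqrt (N x))) \<le> 6 * B * C"
    if fin: "finite G" and pos: "\<And>x. x \<in> G \<Longrightarrow> N x \<ge> 1"
      and C: "\<And>m. m \<ge> 1 \<Longrightarrow> real (card {x \<in> G. N x \<le> m}) \<le> C * real m"
    for G :: "'a set" and N :: "'a \<Rightarrow> nat" and C :: real
  proof -
    let ?g = "\<lambda>m. 1 / (real m * real m * sqrt (real m))"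
    define n where "n = 2 * (\<Sum>x\<in>G. N x)"
    have spread: "1 / (real k * sqrt k) \<le> 6 * (\<Sum>m\<in>{k..2*k}. ?g m)" if k: "k \<ge> 1" for k :: nat
    proof -
      have "(\<Sum>m\<in>{k..2*k}. 1 / (6 * (real k * real k * sqrt k))) \<le> (\<Sum>m\<in>{k..2*k}. ?g m)"
      proof (rule sum_mono)
        fix m assume m: "m \<in> {k..2*k}"
        have "sqrt m \<le> sqrt (9/4 * k)" using m by (intro real_sqrt_le_mono) simp
        also have "\<dots> = 3/2 * sqrt k" by (simp add: real_sqrt_mult real_sqrt_divide)
        finally have s: "sqrt m \<le> 3/2 * sqrt k" .
        have "real m * real m \<le> (2 * real k) * (2 * real k)" using m by (intro mult_mono) auto
        hence "real m * real m * sqrt m \<le> (2 * real k) * (2 * real k) * (3/2 * sqrt k)"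
          by (rule mult_mono[OF _ s]) simp_all
        hence "real m * real m * sqrt m \<le> 6 * (real k * real k * sqrt k)" by simp
        moreover have "real m * real m * sqrt m > 0" using m k by simp
        ultimately show "1 / (6 * (real k * real k * sqrt k)) \<le> ?g m" by (intro divide_left_mono) auto
      qed
      moreover have "(\<Sum>m\<in>{k..2*k}. 1 / (6 * (real k * real k * sqrt k))) = (real k + 1) / (6 * (real k * real k * sqrt k))"
        by (simp add: add.commute)
      moreover have "real k / (6 * (real k * real k * sqrt k)) \<le> (real k + 1) / (6 * (real k * real k * sqrt k))"
        by (intro divide_right_mono) auto
      moreover have "1 / (real k * sqrt k) = 6 * (real k / (6 * (real k * real k * sqrt k)))"
        using k by (simp add: field_simps)
      ultimately show ?thesis by linarith
    qed
    have "(\<Sum>x\<in>G. 1 / (real (N x) * sqrt (N x))) \<le> (\<Sum>x\<in>G. 6 * (\<Sum>m\<in>{m\<in>{1..n}. N x \<le> m}. ?g m))"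
    proof (rule sum_mono)
      fix x assume x: "x \<in> G"
      have "N x \<le> (\<Sum>x\<in>G. N x)" using member_le_sum[OF x _ fin, of N] by simp
      hence "{N x..2 * N x} \<subseteq> {m\<in>{1..n}. N x \<le> m}" using pos[OF x] unfolding n_def by auto
      hence "(\<Sum>m\<in>{N x..2 * N x}. ?g m) \<le> (\<Sum>m\<in>{m\<in>{1..n}. N x \<le> m}. ?g m)"
        by (intro sum_mono2) auto
      thus "1 / (real (N x) * sqrt (N x)) \<le> 6 * (\<Sum>m\<in>{m\<in>{1..n}. N x \<le> m}. ?g m)"
        using spread[OF pos[OF x]] by linarith
    qed
    also have "\<dots> = 6 * (\<Sum>m=1..n. \<Sum>x\<in>{x\<in>G. N x \<le> m}. ?g m)"
      unfolding sum_distrib_left[symmetric] using fin by (subst sum.swap_restrict) auto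
    also have "\<dots> \<le> 6 * (\<Sum>m=1..n. C * (1 / (real m * sqrt m)))"
    proof (intro mult_left_mono sum_mono)
      fix m assume m: "m \<in> {1..n}"
      have "(\<Sum>x\<in>{x\<in>G. N x \<le> m}. ?g m) = card {x \<in> G. N x \<le> m} * ?g m" by simp
      also have "\<dots> \<le> C * m * ?g m" using C[of m] m by (intro mult_right_mono) auto
      also have "\<dots> = C * (1 / (real m * sqrt m))" using m by (simp add: field_simps)
      finally show "(\<Sum>x\<in>{x\<in>G. N x \<le> m}. ?g m) \<le> C * (1 / (real m * sqrt m))" .
    qed simp
    also have "\<dots> = 6 * (C * (\<Sum>m=1..n. 1 / (real m * sqrt m)))" by (simp only: sum_distrib_left)
    also have "\<dots> \<le> 6 * (C * B)"
    proof -
      have "C \<ge> 0" using C[of 1] of_nat_0_le_iff order_trans by fastforce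
      thus ?thesis using B(2)[of n] by (intro mult_left_mono) auto
    qed
    finally show ?thesis by (simp add: mult_ac)
  qed
  thus ?thesis using that[of "6 * B"] B(1) by simp
qed

section \<open>Convergence of sums over ideals\<close>

context imag_quadratic begin

abbreviation Idls :: "complex set set" where "Idls \<equiv> {I. idl I}"

text \<open>By homothety an ideal is determined by a pair (a, J) with J from a finite set and |a|^2
  = N(I) N(J) \<le> M m, so there are at most as many ideals as lattice points in a disc of area
  O(m), up to a factor.\<close>

lemma card_idl_le:
  obtains C where "\<And>m. m \<ge> 1 \<Longrightarrow> real (card {I. idl I \<and> nrm I \<le> m}) \<le> C * real m"
proof -
  define M where "M = (1 + cmod w)\<^sup>2"
  have M: "M \<ge> 1" unfolding M_def by simp
  define F where "F = {J. idl J \<and> nrm J \<le> nat \<lfloor>M\<rfloor>}"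
  have F: "finite F" unfolding F_def by (rule finite_idl_le)
  obtain C where C: "C \<ge> 0" "\<And>Q. Q \<ge> 1 \<Longrightarrow> \<bar>real (card (ball0 Ok Q)) - pi / Im w / nrm Ok * Q\<bar> \<le> C * sqrt Q"
    using card_ball0[OF idl_Ok] by blast
  have card_Ok: "real (card (ball0 Ok Q)) \<le> (pi / Im w + C) * Q" if Q: "Q \<ge> 1" for Q
  proof -
    have "sqrt Q * 1 \<le> sqrt Q * sqrt Q" using Q by (intro mult_left_mono) auto
    hence "sqrt Q \<le> Q" using Q by simp
    hence "C * sqrt Q \<le> C * Q" using C(1) by (rule mult_left_mono)
    thus ?thesis using C(2)[OF Q] unfolding nrm_Ok by (simp add: distrib_right abs_le_iff)
  qed
  have "real (card {I. idl I \<and> nrm I \<le> m}) \<le> ((pi / Im w + C) * M * card F) * real m" if m: "m \<ge> 1" for m :: nat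
  proof -
    have sub: "{I. idl I \<and> nrm I \<le> m} \<subseteq> (\<lambda>(a, J). (*) (a / of_nat (nrm J)) ` J) ` (ball0 Ok (M * m) \<times> F)"
    proof (rule subsetI, clarify)
      fix I assume I: "idl I" "nrm I \<le> m"
      obtain a J where a: "a \<in> Ok" "a \<noteq> 0" "idl J" "real (nrm J) \<le> (1 + cmod w)\<^sup>2"
        "(cmod a)\<^sup>2 = real (nrm I) * real (nrm J)" "I = (*) (a / of_nat (nrm J)) ` J"
        using I(1) by (rule idl_homothety)
      have "(cmod a)\<^sup>2 \<le> M * m" unfolding a(5) using a(4) I(2) unfolding M_def
        by (subst mult.commute) (intro mult_mono, auto)
      moreover have "nrm J \<le> nat \<lfloor>M\<rfloor>" using a(4) unfolding M_def by (simp add: le_nat_floor)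
      ultimately have "(a, J) \<in> ball0 Ok (M * m) \<times> F" using a(1-3) unfolding ball0_def F_def by simp
      hence "(case (a, J) of (a, J) \<Rightarrow> (*) (a / of_nat (nrm J)) ` J) \<in>
        (\<lambda>(a, J). (*) (a / of_nat (nrm J)) ` J) ` (ball0 Ok (M * m) \<times> F)" by (rule imageI)
      thus "I \<in> (\<lambda>(a, J). (*) (a / of_nat (nrm J)) ` J) ` (ball0 Ok (M * m) \<times> F)"
        unfolding prod.case a(6)[symmetric] .
    qed
    have fin: "finite (ball0 Ok (M * m) \<times> F)" using finite_ball0[OF idl_Ok] F by simp
    have "card {I. idl I \<and> nrm I \<le> m} \<le> card (ball0 Ok (M * m) \<times> F)"
      using card_mono[OF finite_imageI[OF fin] sub] card_image_le[OF fin] by (rule order_trans)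
    hence "real (card {I. idl I \<and> nrm I \<le> m}) \<le> real (card (ball0 Ok (M * m))) * real (card F)"
      by (simp only: card_cartesian_product of_nat_mult[symmetric] of_nat_le_iff)
    also have "1 * 1 \<le> M * real m" using M m by (intro mult_mono) auto
    hence "real (card (ball0 Ok (M * m))) * real (card F) \<le> (pi / Im w + C) * (M * m) * real (card F)"
      by (intro mult_right_mono card_Ok) auto
    finally show ?thesis by (simp add: mult_ac)
  qed
  thus ?thesis using that by blast
qed

text \<open>The exponent 3/2 leaves room for a logarithm: (1 + ln N) / N^2 is dominated by a
  multiple of this.\<close>

lemma nrm_3_2_summable: "(\<lambda>I. 1 / (real (nrm I) * sqrt (nrm I))) summable_on Idls"
proof (rule nonneg_bdd_above_summable_on)
  obtain C where C: "\<And>m. m \<ge> 1 \<Longrightarrow> real (card {I. idl I \<and> nrm I \<le> m}) \<le> C * real m"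
    using card_idl_le by blast
  obtain B :: real where B: "B \<ge> 0" "\<And>(G :: complex set set) N (C::real). finite G \<Longrightarrow> (\<And>x. x \<in> G \<Longrightarrow> (N x :: nat) \<ge> 1) \<Longrightarrow>
      (\<And>m. m \<ge> 1 \<Longrightarrow> real (card {x \<in> G. N x \<le> m}) \<le> C * real m) \<Longrightarrow>
      (\<Sum>x\<in>G. 1 / (real (N x) * sqrt (N x))) \<le> B * C"
    using sum_norm_3_2_bound by blast
  have "(\<Sum>I\<in>G. 1 / (real (nrm I) * sqrt (nrm I))) \<le> B * C" if G: "G \<subseteq> Idls" "finite G" for G
  proof (rule B(2)[where N = nrm and G = G and C = C])
    show "finite G" by (rule G(2))
    show "nrm I \<ge> 1" if "I \<in> G" for I using nrm_pos[of I] that G(1) by fastforce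
    fix m :: nat assume m: "m \<ge> 1"
    have "card {I \<in> G. nrm I \<le> m} \<le> card {I. idl I \<and> nrm I \<le> m}"
      using G(1) by (intro card_mono finite_idl_le) auto
    thus "real (card {I \<in> G. nrm I \<le> m}) \<le> C * m" using C[OF m] by linarith
  qed
  thus "bdd_above (sum (\<lambda>I. 1 / (real (nrm I) * sqrt (nrm I))) ` {F. F \<subseteq> Idls \<and> finite F})"
    by (intro bdd_aboveI[of _ "B * C"]) auto
qed simp

section \<open>Maximal ideals and their intersections\<close>

definition maxid :: "complex set \<Rightarrow> bool" where
  "maxid P \<longleftrightarrow> idl P \<and> P \<noteq> Ok \<and> (\<forall>J. idl J \<longrightarrow> P \<subseteq> J \<longrightarrow> J = P \<or> J = Ok)"

definition Maxi :: "complex set \<Rightarrow> complex set set" where "Maxi I = {P. maxid P \<and> I \<subseteq> P}"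

lemma finite_Maxi: assumes "idl I" shows "finite (Maxi I)"
  by (rule finite_subset[OF _ finite_idl_above[OF assms]]) (auto simp: Maxi_def maxid_def)

lemma Maxi_empty_iff: assumes I: "idl I" shows "Maxi I = {} \<longleftrightarrow> I = Ok"
proof
  assume "I = Ok"
  thus "Maxi I = {}" unfolding Maxi_def maxid_def using idl_sub by auto
next
  assume E: "Maxi I = {}"
  show "I = Ok"
  proof (rule ccontr)
    assume ne: "I \<noteq> Ok"
    let ?S = "{J. idl J \<and> I \<subseteq> J} - {Ok}"
    have "finite ?S" "?S \<noteq> {}" using finite_idl_above[OF I] I ne by auto
    from finite_has_maximal[OF this] obtain P where P: "P \<in> ?S" "\<forall>J\<in>?S. P \<subseteq> J \<longrightarrow> P = J"
      by (rule bexE)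
    have "maxid P" unfolding maxid_def
    proof (intro conjI allI impI)
      fix J assume "idl J" "P \<subseteq> J"
      moreover have "I \<subseteq> P" using P(1) by simp
      ultimately have "J = Ok \<or> J \<in> ?S" by auto
      thus "J = P \<or> J = Ok" using P(2) \<open>P \<subseteq> J\<close> by metis
    qed (use P(1) in auto)
    hence "P \<in> Maxi I" unfolding Maxi_def using P(1) by simp
    thus False using E by simp
  qed
qed

text \<open>P + O x is strictly above P, so it contains 1 = p + o' x; multiply by y.\<close>

lemma maxid_prime:
  assumes P: "maxid P" and xy: "x \<in> Ok" "y \<in> Ok" "x * y \<in> P" "x \<notin> P"
  shows "y \<in> P"
proof -
  have I: "idl P" using P unfolding maxid_def by blast
  define J where "J = {p + o' * x | p o'. p \<in> P \<and> o' \<in> Ok}"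
  have JI: "p + o' * x \<in> J" if "p \<in> P" "o' \<in> Ok" for p o' using that unfolding J_def by blast
  have JE: "\<exists>p o'. z = p + o' * x \<and> p \<in> P \<and> o' \<in> Ok" if "z \<in> J" for z using that unfolding J_def by blast
  have PJ: "P \<subseteq> J" using JI[OF _ Ok_0] by auto
  obtain z where z: "z \<in> P" "z \<noteq> 0" using idl_nonzero[OF I] by blast
  have "idl J"
  proof (rule idlI[of _ z])
    show "J \<subseteq> Ok"
    proof
      fix v assume "v \<in> J"
      then obtain p o' where "v = p + o' * x" "p \<in> P" "o' \<in> Ok" using JE by metis
      thus "v \<in> Ok" using idl_sub[OF I] xy(1) by (auto intro!: Ok_add Ok_mult)
    qed
    show "0 \<in> J" "z \<in> J" using PJ idl_0[OF I] z by auto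
    fix u v assume "u \<in> J" "v \<in> J"
    then obtain p o' q o'' where "u = p + o' * x" "v = q + o'' * x" "p \<in> P" "q \<in> P" "o' \<in> Ok" "o'' \<in> Ok"
      using JE by metis
    thus "u + v \<in> J" using JI[of "p + q" "o' + o''"] idl_add[OF I] Ok_add by (simp add: algebra_simps)
  next
    fix a v assume a: "a \<in> Ok" "v \<in> J"
    then obtain p o' where "v = p + o' * x" "p \<in> P" "o' \<in> Ok" using JE by metis
    thus "a * v \<in> J" using JI[of "a * p" "a * o'"] idl_mult[OF I a(1)] Ok_mult[OF a(1)] by (simp add: algebra_simps)
  qed (use z in auto)
  moreover have "x \<in> J" using JI[OF idl_0[OF I] Ok_1] by simp
  ultimately have "J = Ok" using P PJ xy(4) unfolding maxid_def by metis
  then obtain p o' where 1: "1 = p + o' * x" "p \<in> P" "o' \<in> Ok" using JE[of 1] Ok_1 by metis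
  have "y = (p + o' * x) * y" unfolding 1(1)[symmetric] by simp
  also have "\<dots> = y * p + o' * (x * y)" by (simp add: algebra_simps)
  finally show ?thesis using idl_add[OF I idl_mult[OF I xy(2) 1(2)] idl_mult[OF I 1(3) xy(3)]] by simp
qed

lemma idl_Inter:
  assumes I: "idl I" and S: "\<And>P. P \<in> S \<Longrightarrow> idl P" "\<And>P. P \<in> S \<Longrightarrow> I \<subseteq> P"
  shows "idl (Ok \<inter> \<Inter>S)" "I \<subseteq> Ok \<inter> \<Inter>S"
proof -
  show sub: "I \<subseteq> Ok \<inter> \<Inter>S" using idl_sub[OF I] S(2) by auto
  obtain z where z: "z \<in> I" "z \<noteq> 0" using idl_nonzero[OF I] by blast
  show "idl (Ok \<inter> \<Inter>S)"
  proof (rule idlI[of _ z])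
    show "0 \<in> Ok \<inter> \<Inter>S" "z \<in> Ok \<inter> \<Inter>S" using sub z idl_0[OF I] by auto
  qed (use z S(1) idl_add idl_mult Ok_add Ok_mult in auto)
qed

text \<open>An intersection of maximal ideals remembers which ones were intersected. Hence S
  \<mapsto> O \<inter> \<Inter>S is injective on sets of maximal ideals above I, with
  \<open>Maxi\<close> as its inverse on the image.\<close>

lemma Maxi_Inter:
  assumes I: "idl I" and S: "S \<subseteq> Maxi I"
  shows "Maxi (Ok \<inter> \<Inter>S) = S"
proof
  show "S \<subseteq> Maxi (Ok \<inter> \<Inter>S)" using S unfolding Maxi_def by auto
  show "Maxi (Ok \<inter> \<Inter>S) \<subseteq> S"
  proof (rule subsetI, rule ccontr)
    fix P assume P: "P \<in> Maxi (Ok \<inter> \<Inter>S)" "P \<notin> S"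
    have mP: "maxid P" and sP: "Ok \<inter> \<Inter>S \<subseteq> P" using P(1) unfolding Maxi_def by auto
    have idP: "idl P" "P \<noteq> Ok" using mP unfolding maxid_def by auto
    have fS: "finite S" using S finite_Maxi[OF I] by (rule finite_subset)
    \<comment> \<open>Multiply together one element outside P from each member of T; since P is
      prime, the product stays outside P.\<close>
    have "\<exists>z\<in>Ok \<inter> \<Inter>T. z \<notin> P" if "finite T" "T \<subseteq> S" for T using that
    proof (induction T rule: finite_induct)
      case empty
      have "1 \<notin> P" using idl_one_iff[OF idP(1)] idP(2) by simp
      thus ?case using Ok_1 by auto
    next
      case (insert Q T)
      then obtain z where z: "z \<in> Ok" "z \<in> \<Inter>T" "z \<notin> P" by auto
      have mQ: "maxid Q" using insert.prems S unfolding Maxi_def by auto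
      hence iQ: "idl Q" unfolding maxid_def by simp
      have "\<not> Q \<subseteq> P"
      proof
        assume "Q \<subseteq> P"
        hence "P = Q \<or> P = Ok" using mQ idP(1) unfolding maxid_def by simp
        thus False using idP(2) P(2) insert.prems by auto
      qed
      then obtain q where q: "q \<in> Q" "q \<notin> P" by auto
      have qO: "q \<in> Ok" using q(1) idl_sub[OF iQ] by auto
      have "z * q \<notin> P" using maxid_prime[OF mP z(1) qO _ z(3)] q(2) by auto
      moreover have "z * q \<in> Ok" using Ok_mult[OF z(1) qO] .
      moreover have "z * q \<in> Q" using idl_mult[OF iQ z(1) q(1)] .
      moreover have "z * q \<in> R" if "R \<in> T" for R
      proof -
        have "idl R" using insert.prems S that unfolding Maxi_def maxid_def by auto
        thus ?thesis using idl_mult[of R q z] qO z(2) that by (auto simp: mult.commute)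
      qed
      ultimately show ?case by (intro bexI[of _ "z * q"]) auto
    qed
    from this[OF fS order_refl] show False using sP by auto
  qed
qed

text \<open>
  The Moebius function, described without factorisation into primes: an ideal is squarefree iff it is
  the intersection of the maximal ideals containing it. The intersection with \<open>Ok\<close> covers the empty family.
\<close>

definition mu :: "complex set \<Rightarrow> real" where
  "mu I = (if I = Ok \<inter> \<Inter>(Maxi I) then (-1) ^ card (Maxi I) else 0)"

lemma abs_mu_le: "\<bar>mu I\<bar> \<le> 1"
  unfolding mu_def by simp

text \<open>Only the intersections of subsets S of \<open>Maxi I\<close> contribute, each exactly
  once and with sign (-1)^|S|. The sum is (1 - 1) to the power |\<open>Maxi I\<close>|.\<close>

lemma sum_mu: assumes I: "idl I" shows "(\<Sum>J\<in>{J. idl J \<and> I \<subseteq> J}. mu J) = (if I = Ok then 1 else 0)"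
proof -
  have fin: "finite (Maxi I)" by (rule finite_Maxi[OF I])
  let ?f = "\<lambda>S. Ok \<inter> \<Inter>S"
  have f: "idl (?f S)" "I \<subseteq> ?f S" if "S \<subseteq> Maxi I" for S
    using idl_Inter[OF I, of S] that unfolding Maxi_def maxid_def by auto
  have "(\<Sum>S\<in>Pow (Maxi I). (-1) ^ card S) = (\<Sum>J\<in>?f ` Pow (Maxi I). mu J)"
  proof (subst sum.reindex)
    show "inj_on ?f (Pow (Maxi I))"
      by (rule inj_on_inverseI[of _ Maxi]) (use Maxi_Inter[OF I] in auto)
    show "(\<Sum>S\<in>Pow (Maxi I). (-1) ^ card S) = (\<Sum>S\<in>Pow (Maxi I). (mu \<circ> ?f) S)"
      using Maxi_Inter[OF I] by (intro sum.cong) (auto simp: mu_def)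
  qed
  also have "\<dots> = (\<Sum>J\<in>{J. idl J \<and> I \<subseteq> J}. mu J)"
  proof (rule sum.mono_neutral_left)
    show "finite {J. idl J \<and> I \<subseteq> J}" by (rule finite_idl_above[OF I])
    show "?f ` Pow (Maxi I) \<subseteq> {J. idl J \<and> I \<subseteq> J}"
    proof (rule image_subsetI)
      fix S assume "S \<in> Pow (Maxi I)"
      hence "S \<subseteq> Maxi I" by simp
      from f[OF this] show "?f S \<in> {J. idl J \<and> I \<subseteq> J}" by simp
    qed
    show "\<forall>J\<in>{J. idl J \<and> I \<subseteq> J} - ?f ` Pow (Maxi I). mu J = 0"
    proof
      fix J assume J: "J \<in> {J. idl J \<and> I \<subseteq> J} - ?f ` Pow (Maxi I)"
      have "Maxi J \<in> Pow (Maxi I)" using J unfolding Maxi_def by auto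
      hence "J \<noteq> ?f (Maxi J)" using J by auto
      thus "mu J = 0" unfolding mu_def by simp
    qed
  qed
  finally have "(\<Sum>J\<in>{J. idl J \<and> I \<subseteq> J}. mu J) = (\<Sum>S\<in>Pow (Maxi I). (-1) ^ card S)" ..
  \<comment> \<open>Expanding a product of sums over the subsets of the index set, read
    backwards.\<close>
  also have "\<dots> = (\<Prod>P\<in>Maxi I. (-1 :: real) + 1)" by (subst prod_add[OF fin]) simp
  also have "\<dots> = (if I = Ok then 1 else 0)"
    using Maxi_empty_iff[OF I] fin by (cases "I = Ok") (auto simp: card_gt_0_iff)
  finally show ?thesis .
qed

section \<open>Inversion of the zeta series at 2\<close>

definition zeta2 :: real where "zeta2 = (\<Sum>\<^sub>\<infinity>I\<in>Idls. 1 / (real (nrm I))\<^sup>2)"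
definition muzeta2 :: real where "muzeta2 = (\<Sum>\<^sub>\<infinity>I\<in>Idls. mu I / (real (nrm I))\<^sup>2)"

lemma nrm_2_le: assumes "idl I" shows "1 / (real (nrm I))\<^sup>2 \<le> 1 / (real (nrm I) * sqrt (nrm I))"
proof -
  have N: "real (nrm I) \<ge> 1" using nrm_pos[OF assms] by simp
  hence "sqrt (nrm I) * 1 \<le> sqrt (nrm I) * sqrt (nrm I)" by (intro mult_left_mono) auto
  hence "real (nrm I) * sqrt (nrm I) \<le> real (nrm I) * real (nrm I)" by (intro mult_left_mono) auto
  thus ?thesis using N unfolding power2_eq_square by (intro divide_left_mono) auto
qed

lemma nrm_2_summable: "(\<lambda>I. 1 / (real (nrm I))\<^sup>2) summable_on Idls"
  by (rule summable_on_comparison_test[OF nrm_3_2_summable]) (use nrm_2_le in auto)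

lemma mu_nrm_2_summable: "(\<lambda>I. norm (mu I / (real (nrm I))\<^sup>2)) summable_on Idls"
proof (rule summable_on_comparison_test[OF nrm_2_summable])
  show "norm (mu I / (real (nrm I))\<^sup>2) \<le> 1 / (real (nrm I))\<^sup>2" for I
    using abs_mu_le[of I] by (simp add: divide_right_mono)
qed simp

text \<open>Dirichlet convolution: group the pairs (I, J) by their product L = I J. The inner sum is
  then the finite sum of \<open>mu\<close> over the ideals above L, which vanishes unless L is the
  unit ideal.\<close>

lemma zeta2_muzeta2: "zeta2 * muzeta2 = 1"
proof -
  let ?f = "\<lambda>I. 1 / (real (nrm I))\<^sup>2" and ?g = "\<lambda>J. mu J / (real (nrm J))\<^sup>2"
  let ?B = "\<lambda>L. {J. idl J \<and> L \<subseteq> J}"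
  let ?h = "\<lambda>(L, J). mu J / (real (nrm L))\<^sup>2"
  have "(\<lambda>x. norm (case x of (I, J) \<Rightarrow> ?f I * ?g J)) summable_on Idls \<times> Idls"
  proof (rule Infinite_Sum.abs_summable_on_Sigma_iff[THEN iffD2], intro conjI ballI, unfold prod.case norm_mult infsum_cmult_right')
    show "(\<lambda>J. norm (?f I) * norm (?g J)) summable_on Idls" for I
      by (rule summable_on_cmult_right[OF mu_nrm_2_summable])
    show "(\<lambda>I. norm (norm (?f I)) * norm (\<Sum>\<^sub>\<infinity>J\<in>Idls. norm (?g J))) summable_on Idls"
      by (rule summable_on_cmult_left) (use nrm_2_summable in simp)
  qed
  hence sm: "(\<lambda>(I, J). ?f I * ?g J) summable_on Idls \<times> Idls" by (rule abs_summable_summable)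
  have "zeta2 * muzeta2 = (\<Sum>\<^sub>\<infinity>I\<in>Idls. \<Sum>\<^sub>\<infinity>J\<in>Idls. ?f I * ?g J)"
    unfolding zeta2_def muzeta2_def by (simp only: infsum_cmult_left' infsum_cmult_right')
  also have "\<dots> = (\<Sum>\<^sub>\<infinity>(I, J)\<in>Idls \<times> Idls. ?f I * ?g J)"
    using infsum_Sigma_banach[OF sm] by simp
  finally have E1: "zeta2 * muzeta2 = (\<Sum>\<^sub>\<infinity>(I, J)\<in>Idls \<times> Idls. ?f I * ?g J)" .
  \<comment> \<open>Injective by cancellation, surjective because containing means dividing.\<close>
  have bij: "bij_betw (\<lambda>(I, J). (iprod I J, J)) (Idls \<times> Idls) (Sigma Idls ?B)"
  proof (rule bij_betw_imageI)
    show "inj_on (\<lambda>(I, J). (iprod I J, J)) (Idls \<times> Idls)"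
    proof (rule inj_onI)
      fix x y assume xy: "x \<in> Idls \<times> Idls" "y \<in> Idls \<times> Idls"
        "(case x of (I, J) \<Rightarrow> (iprod I J, J)) = (case y of (I, J) \<Rightarrow> (iprod I J, J))"
      obtain I J I' J' where e: "x = (I, J)" "y = (I', J')" by (metis surj_pair)
      have *: "idl I" "idl J" "idl I'" "J' = J" "iprod I J = iprod I' J'" using xy unfolding e by auto
      have "I = I'" by (rule iprod_cancel[OF *(1) *(3) *(2) *(5)[unfolded *(4)]])
      thus "x = y" unfolding e *(4) by simp
    qed
    show "(\<lambda>(I, J). (iprod I J, J)) ` (Idls \<times> Idls) = Sigma Idls ?B"
    proof
      show "(\<lambda>(I, J). (iprod I J, J)) ` (Idls \<times> Idls) \<subseteq> Sigma Idls ?B"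
      proof (rule image_subsetI)
        fix x assume x: "x \<in> Idls \<times> Idls"
        obtain I J where e: "x = (I, J)" by (metis surj_pair)
        have *: "idl I" "idl J" using x unfolding e by auto
        show "(case x of (I, J) \<Rightarrow> (iprod I J, J)) \<in> Sigma Idls ?B"
          unfolding e using idl_iprod[OF *] iprod_sub[OF *] *(2) by simp
      qed
      show "Sigma Idls ?B \<subseteq> (\<lambda>(I, J). (iprod I J, J)) ` (Idls \<times> Idls)"
      proof (rule subsetI, clarify)
        fix L J assume LJ: "idl L" "idl J" "L \<subseteq> J"
        then obtain I where "idl I" "L = iprod I J" by (rule contains_divides)
        thus "(L, J) \<in> (\<lambda>(I, J). (iprod I J, J)) ` (Idls \<times> Idls)" using LJ(2)
          by (intro image_eqI[of _ _ "(I, J)"]) auto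
      qed
    qed
  qed
  have eq: "(case (I, J) of (I, J) \<Rightarrow> ?f I * ?g J) = ?h (case (I, J) of (I, J) \<Rightarrow> (iprod I J, J))"
    if "idl I" "idl J" for I J
    using nrm_iprod[OF that] by (simp add: power_mult_distrib)
  have "(\<Sum>\<^sub>\<infinity>(I, J)\<in>Idls \<times> Idls. ?f I * ?g J) = (\<Sum>\<^sub>\<infinity>x\<in>Idls \<times> Idls. ?h (case x of (I, J) \<Rightarrow> (iprod I J, J)))"
    by (rule infsum_cong) (use eq in auto)
  also have "\<dots> = infsum ?h (Sigma Idls ?B)" by (rule infsum_reindex_bij_betw[OF bij])
  also have "\<dots> = (\<Sum>\<^sub>\<infinity>L\<in>Idls. infsum (\<lambda>J. ?h (L, J)) (?B L))"
  proof (rule infsum_Sigma_banach[symmetric])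
    have "(\<lambda>x. ?h (case x of (I, J) \<Rightarrow> (iprod I J, J))) summable_on Idls \<times> Idls"
      by (rule summable_on_cong[THEN iffD1, OF _ sm]) (use eq in auto)
    thus "?h summable_on Sigma Idls ?B" using summable_on_reindex_bij_betw[OF bij, of ?h] by simp
  qed
  also have "\<dots> = (\<Sum>\<^sub>\<infinity>L\<in>Idls. if L = Ok then 1 else 0)"
  proof (rule infsum_cong)
    fix L assume "L \<in> Idls"
    hence L: "idl L" by simp
    have "infsum (\<lambda>J. ?h (L, J)) (?B L) = (\<Sum>J\<in>?B L. mu J) / (real (nrm L))\<^sup>2"
      using finite_idl_above[OF L] by (simp add: sum_divide_distrib)
    thus "infsum (\<lambda>J. ?h (L, J)) (?B L) = (if L = Ok then 1 else 0)" unfolding sum_mu[OF L] by (simp add: nrm_Ok)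
  qed
  also have "\<dots> = (\<Sum>\<^sub>\<infinity>L\<in>{Ok}. 1)" by (rule infsum_cong_neutral) (use idl_Ok in auto)
  finally show ?thesis unfolding E1 by simp
qed

end

section \<open>Coprime pairs\<close>

context imag_quadratic begin

text \<open>Comaximality. If there are non-principal ideals, this is stronger than having no common
  nonunit divisor, and it is what the congruences x = 0 mod b and x = -1 mod a force.\<close>

definition coprimeO :: "complex \<Rightarrow> complex \<Rightarrow> bool" where
  "coprimeO a b \<longleftrightarrow> (\<exists>u\<in>Ok. \<exists>v\<in>Ok. u * a + v * b = 1)"

lemma idl_generated:
  assumes ab: "a \<in> Ok" "b \<in> Ok" "a \<noteq> 0"
  obtains I where "idl I" "\<And>J. idl J \<Longrightarrow> I \<subseteq> J \<longleftrightarrow> a \<in> J \<and> b \<in> J" "I = Ok \<longleftrightarrow> coprimeO a b"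
proof -
  define I where "I = {u * a + v * b | u v. u \<in> Ok \<and> v \<in> Ok}"
  have II: "u * a + v * b \<in> I" if "u \<in> Ok" "v \<in> Ok" for u v using that unfolding I_def by blast
  have IE: "\<exists>u v. z = u * a + v * b \<and> u \<in> Ok \<and> v \<in> Ok" if "z \<in> I" for z using that unfolding I_def by blast
  have aI: "a \<in> I" using II[OF Ok_1 Ok_0] by simp
  have bI: "b \<in> I" using II[OF Ok_0 Ok_1] by simp
  have id: "idl I"
  proof (rule idlI[OF _ _ _ _ aI ab(3)])
    show "I \<subseteq> Ok"
    proof
      fix z assume "z \<in> I"
      then obtain u v where "z = u * a + v * b" "u \<in> Ok" "v \<in> Ok" using IE by metis
      thus "z \<in> Ok" using ab by (auto intro!: Ok_add Ok_mult)
    qed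
    show "0 \<in> I" using II[OF Ok_0 Ok_0] by simp
    fix y z assume "y \<in> I" "z \<in> I"
    then obtain u v u' v' where "y = u * a + v * b" "u \<in> Ok" "v \<in> Ok" "z = u' * a + v' * b" "u' \<in> Ok" "v' \<in> Ok"
      using IE by metis
    thus "y + z \<in> I" using II[of "u + u'" "v + v'"] Ok_add by (simp add: algebra_simps)
  next
    fix c z assume c: "c \<in> Ok" "z \<in> I"
    then obtain u v where "z = u * a + v * b" "u \<in> Ok" "v \<in> Ok" using IE by metis
    thus "c * z \<in> I" using II[of "c * u" "c * v"] Ok_mult[OF c(1)] by (simp add: algebra_simps)
  qed
  moreover have "I \<subseteq> J \<longleftrightarrow> a \<in> J \<and> b \<in> J" if J: "idl J" for J
  proof
    assume ab': "a \<in> J \<and> b \<in> J"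
    show "I \<subseteq> J"
    proof
      fix z assume "z \<in> I"
      then obtain u v where z: "z = u * a + v * b" "u \<in> Ok" "v \<in> Ok" using IE by metis
      show "z \<in> J" unfolding z(1) by (intro idl_add[OF J] idl_mult[OF J] z(2,3) ab'[THEN conjunct1] ab'[THEN conjunct2])
    qed
  qed (use aI bI in auto)
  moreover have "1 \<in> I \<longleftrightarrow> coprimeO a b"
  proof
    assume "1 \<in> I"
    then obtain u v where "1 = u * a + v * b" "u \<in> Ok" "v \<in> Ok" using IE by metis
    thus "coprimeO a b" unfolding coprimeO_def by (metis)
  next
    assume "coprimeO a b"
    then obtain u v where "u * a + v * b = 1" "u \<in> Ok" "v \<in> Ok" unfolding coprimeO_def by blast
    thus "1 \<in> I" using II by metis
  qed
  ultimately show ?thesis using that[of I] idl_one_iff[of I] by simp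
qed

text \<open>The ideals containing a and b are those above a O + b O, which is the unit ideal exactly
  when a and b are coprime.\<close>

lemma sum_mu_coprime:
  assumes "a \<in> Ok" "b \<in> Ok" "a \<noteq> 0"
  shows "(\<Sum>J\<in>{J. idl J \<and> a \<in> J \<and> b \<in> J}. mu J) = (if coprimeO a b then 1 else 0)"
proof -
  obtain I where I: "idl I" "\<And>J. idl J \<Longrightarrow> I \<subseteq> J \<longleftrightarrow> a \<in> J \<and> b \<in> J" "I = Ok \<longleftrightarrow> coprimeO a b"
    using idl_generated[OF assms] by blast
  have "{J. idl J \<and> a \<in> J \<and> b \<in> J} = {J. idl J \<and> I \<subseteq> J}" using I(2) by auto
  thus ?thesis using sum_mu[OF I(1)] I(3) by simp
qed

definition coprime_pairs :: "real \<Rightarrow> (complex \<times> complex) set" where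
  "coprime_pairs Q = {(a, b). a \<in> ball0 Ok Q \<and> b \<in> ball0 Ok Q \<and> coprimeO a b}"

definition coprime_sum :: "real \<Rightarrow> real" where
  "coprime_sum Q = (\<Sum>(a, b)\<in>coprime_pairs Q. 1 / ((cmod a)\<^sup>2 * (cmod b)\<^sup>2))"

lemma coprime_pairs_subset: "coprime_pairs Q \<subseteq> ball0 Ok Q \<times> ball0 Ok Q"
  unfolding coprime_pairs_def by auto

text \<open>After Moebius inversion the conditions on a and b separate, which gives a square. The
  ideals stop at norm Q, because a member of J of norm at most Q forces N(J) \<le> Q.\<close>

lemma coprime_sum_mu:
  "coprime_sum Q = (\<Sum>J | idl J \<and> nrm J \<le> nat \<lfloor>Q\<rfloor>. mu J * (recip_sum J Q)\<^sup>2)"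
proof -
  let ?F = "{J. idl J \<and> nrm J \<le> nat \<lfloor>Q\<rfloor>}" and ?B = "ball0 Ok Q"
  \<comment> \<open>The weight carries the condition a \<in> J, so that the range of summation does
    not depend on J and the sums can be exchanged.\<close>
  define i where "i = (\<lambda>J a. if a \<in> J then 1 / (cmod a)\<^sup>2 else 0)"
  have fB: "finite ?B" by (rule finite_ball0[OF idl_Ok])
  have fF: "finite ?F" by (rule finite_idl_le)
  have "coprime_sum Q = (\<Sum>(a, b)\<in>?B \<times> ?B. if coprimeO a b then 1 / ((cmod a)\<^sup>2 * (cmod b)\<^sup>2) else 0)"
    unfolding coprime_sum_def
    by (rule sum.mono_neutral_cong_left) (use fB in \<open>auto simp: coprime_pairs_def split: if_splits\<close>)
  also have "\<dots> = (\<Sum>a\<in>?B. \<Sum>b\<in>?B. if coprimeO a b then 1 / ((cmod a)\<^sup>2 * (cmod b)\<^sup>2) else 0)"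
    by (simp add: sum.cartesian_product)
  also have "\<dots> = (\<Sum>a\<in>?B. \<Sum>b\<in>?B. \<Sum>J\<in>?F. mu J * (i J a * i J b))"
  proof (intro sum.cong refl)
    fix a b assume ab: "a \<in> ?B" "b \<in> ?B"
    hence a: "a \<in> Ok" "a \<noteq> 0" "(cmod a)\<^sup>2 \<le> Q" "b \<in> Ok" unfolding ball0_def by auto
    have sub: "{J. idl J \<and> a \<in> J \<and> b \<in> J} \<subseteq> ?F"
    proof (rule subsetI)
      fix J assume J: "J \<in> {J. idl J \<and> a \<in> J \<and> b \<in> J}"
      hence "real (nrm J) \<le> Q" using nrm_le_norm[of J a] a by simp
      hence "nrm J \<le> nat \<lfloor>Q\<rfloor>" by (rule le_nat_floor)
      thus "J \<in> ?F" using J by simp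
    qed
    have "(if coprimeO a b then 1 / ((cmod a)\<^sup>2 * (cmod b)\<^sup>2) else 0)
        = (\<Sum>J\<in>{J. idl J \<and> a \<in> J \<and> b \<in> J}. mu J) * (1 / ((cmod a)\<^sup>2 * (cmod b)\<^sup>2))"
      unfolding sum_mu_coprime[OF a(1,4,2)] by simp
    also have "\<dots> = (\<Sum>J\<in>{J. idl J \<and> a \<in> J \<and> b \<in> J}. mu J * (1 / ((cmod a)\<^sup>2 * (cmod b)\<^sup>2)))"
      by (rule sum_distrib_right)
    also have "\<dots> = (\<Sum>J\<in>?F. mu J * (i J a * i J b))"
      by (rule sum.mono_neutral_cong_left[OF fF sub]) (auto simp: i_def)
    finally show "(if coprimeO a b then 1 / ((cmod a)\<^sup>2 * (cmod b)\<^sup>2) else 0) = (\<Sum>J\<in>?F. mu J * (i J a * i J b))" .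
  qed
  also have "\<dots> = (\<Sum>a\<in>?B. \<Sum>J\<in>?F. \<Sum>b\<in>?B. mu J * (i J a * i J b))"
    by (intro sum.cong refl sum.swap)
  also have "\<dots> = (\<Sum>J\<in>?F. \<Sum>a\<in>?B. \<Sum>b\<in>?B. mu J * (i J a * i J b))" by (rule sum.swap)
  also have "\<dots> = (\<Sum>J\<in>?F. mu J * (recip_sum J Q)\<^sup>2)"
  proof (intro sum.cong refl)
    fix J assume "J \<in> ?F"
    hence J: "J \<subseteq> Ok" using idl_sub by blast
    have "recip_sum J Q = (\<Sum>a\<in>?B. i J a)"
      unfolding recip_sum_def by (rule sum.mono_neutral_cong_left) (use fB J in \<open>auto simp: i_def ball0_def\<close>)
    thus "(\<Sum>a\<in>?B. \<Sum>b\<in>?B. mu J * (i J a * i J b)) = mu J * (recip_sum J Q)\<^sup>2"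
      by (simp only: power2_eq_square sum_distrib_left[symmetric] sum_distrib_right[symmetric])
  qed
  finally show ?thesis .
qed

lemma ln_le_two_sqrt: assumes "x \<ge> 1" shows "1 + ln x \<le> 2 * sqrt x"
proof -
  have "ln x = 2 * ln (sqrt x)" using assms by (simp add: ln_sqrt)
  also have "ln (sqrt x) \<le> sqrt x - 1" using assms by (intro ln_le_minus_one) simp
  finally show ?thesis by simp
qed

text \<open>With h the sum for J and k = \<kappa> ln Q / N(J) its main term, h^2 - k^2 = (h - k) (h
  + k). The first factor is O((1 + ln N) / N), the second O((1 + ln Q) / N), and 1 + ln N \<le> 2
  \<surd>N makes the total summable over all ideals.\<close>

lemma coprime_sum_asymp:
  obtains C where "C \<ge> 0"
    "\<And>Q. Q \<ge> 1 \<Longrightarrow> \<bar>coprime_sum Q - (pi / Im w)\<^sup>2 * muzeta2 * (ln Q)\<^sup>2\<bar> \<le> C * (1 + ln Q)"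
proof -
  define \<kappa> where "\<kappa> = pi / Im w"
  have \<kappa>: "\<kappa> > 0" unfolding \<kappa>_def using Im_w by simp
  obtain C where C: "C \<ge> 0"
    "\<And>I Q. idl I \<Longrightarrow> Q \<ge> 1 \<Longrightarrow> \<bar>recip_sum I Q - \<kappa> / nrm I * ln Q\<bar> \<le> C * (1 + ln (nrm I)) / nrm I"
    "\<And>I Q. idl I \<Longrightarrow> Q \<ge> 1 \<Longrightarrow> recip_sum I Q \<le> C * (1 + ln Q) / nrm I"
    using recip_sum_uniform unfolding \<kappa>_def by blast
  define Z where "Z = (\<Sum>\<^sub>\<infinity>I\<in>Idls. 1 / (real (nrm I) * sqrt (nrm I)))"
  have Z: "Z \<ge> 0" unfolding Z_def by (rule infsum_nonneg) simp
  \<comment> \<open>C from h - k, C + \<kappa> from h + k, and 2 from 1 + ln N \<le> 2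
    \<surd>N.\<close>
  define D where "D = 2 * C * (C + \<kappa>)"
  have D: "D \<ge> 0" unfolding D_def using C \<kappa> by simp
  have "\<bar>coprime_sum Q - \<kappa>\<^sup>2 * muzeta2 * (ln Q)\<^sup>2\<bar> \<le> D * Z * (1 + ln Q)" if Q: "Q \<ge> 1" for Q
  proof -
    define L where "L = ln Q"
    have L: "L \<ge> 0" unfolding L_def using Q by simp
    have sm: "(\<lambda>J. mu J / (real (nrm J))\<^sup>2) summable_on Idls"
      using mu_nrm_2_summable by (rule abs_summable_summable)
    let ?g = "\<lambda>J. \<kappa>\<^sup>2 * L\<^sup>2 * (mu J / (real (nrm J))\<^sup>2)"
    let ?f = "\<lambda>J. mu J * (recip_sum J Q)\<^sup>2"
    let ?F = "{J. idl J \<and> nrm J \<le> nat \<lfloor>Q\<rfloor>}"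
    \<comment> \<open>As h vanishes beyond Q, the finite sum is a sum over all ideals, and the tail
      of the series for \<open>muzeta2\<close> is handled by the same termwise bound.\<close>
    have z: "?f J = 0" if "J \<in> Idls - ?F" for J
    proof -
      have "idl J" "nrm J > nat \<lfloor>Q\<rfloor>" using that by auto
      hence "Q < nrm J" by linarith
      thus ?thesis using recip_sum_large[OF \<open>idl J\<close>] by simp
    qed
    have "(?f has_sum coprime_sum Q) Idls \<longleftrightarrow> (?f has_sum coprime_sum Q) ?F"
      by (rule has_sum_cong_neutral) (use z in auto)
    hence hf: "(?f has_sum coprime_sum Q) Idls"
      unfolding coprime_sum_mu using has_sum_finite[OF finite_idl_le] by blast
    have hg: "(?g has_sum \<kappa>\<^sup>2 * L\<^sup>2 * muzeta2) Idls"
      unfolding muzeta2_def by (intro has_sum_cmult_right has_sum_infsum sm)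
    have hd: "((\<lambda>J. ?f J - ?g J) has_sum coprime_sum Q - \<kappa>\<^sup>2 * L\<^sup>2 * muzeta2) Idls"
      using has_sum_add[OF hf has_sum_cmult_right[OF hg, of "-1"]] by simp
    have hb: "((\<lambda>J. D * (1 + L) * (1 / (real (nrm J) * sqrt (nrm J)))) has_sum D * (1 + L) * Z) Idls"
      unfolding Z_def by (intro has_sum_cmult_right has_sum_infsum nrm_3_2_summable)
    have bd: "\<bar>?f J - ?g J\<bar> \<le> D * (1 + L) * (1 / (real (nrm J) * sqrt (nrm J)))" if "J \<in> Idls" for J
    proof -
      have J: "idl J" using that by simp
      define N where "N = real (nrm J)"
      have N: "N \<ge> 1" unfolding N_def using nrm_pos[OF J] by simp
      define h where "h = recip_sum J Q"
      define k where "k = \<kappa> / N * L"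
      have h0: "h \<ge> 0" unfolding h_def recip_sum_def by (simp add: sum_nonneg)
      have k0: "k \<ge> 0" unfolding k_def using \<kappa> N L by simp
      have hk: "\<bar>h - k\<bar> \<le> C * (1 + ln N) / N" using C(2)[OF J Q] unfolding h_def k_def N_def L_def .
      have "h + k \<le> C * (1 + L) / N + \<kappa> * (1 + L) / N"
        using C(3)[OF J Q] \<kappa> N unfolding h_def k_def N_def[symmetric] L_def[symmetric]
        by (intro add_mono) (simp_all add: divide_right_mono)
      hence hk': "h + k \<le> (C + \<kappa>) * (1 + L) / N" by (simp add: distrib_right add_divide_distrib)
      have "?f J - ?g J = mu J * ((h - k) * (h + k))"
        unfolding h_def[symmetric] N_def[symmetric] k_def by (simp add: power2_eq_square algebra_simps)
      also have "\<bar>\<dots>\<bar> = \<bar>mu J\<bar> * (\<bar>h - k\<bar> * (h + k))" using h0 k0 by (simp add: abs_mult)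
      also have "\<dots> \<le> 1 * (C * (1 + ln N) / N * ((C + \<kappa>) * (1 + L) / N))"
        using abs_mu_le hk hk' h0 k0 C(1) N by (intro mult_mono) auto
      also have "\<dots> \<le> C * (2 * sqrt N) / N * ((C + \<kappa>) * (1 + L) / N)"
        using ln_le_two_sqrt[OF N] C(1) \<kappa> N L by (simp only: mult_1) (intro mult_mono divide_right_mono, auto)
      also have "\<dots> = D * (1 + L) * (sqrt N / (N * N))" unfolding D_def by simp
      also have "sqrt N / (N * N) = 1 / (N * sqrt N)"
      proof -
        have "sqrt N * sqrt N = N" using N by simp
        thus ?thesis using N by (simp add: field_simps)
      qed
      finally show ?thesis unfolding N_def .
    qed
    have "coprime_sum Q - \<kappa>\<^sup>2 * L\<^sup>2 * muzeta2 \<le> D * (1 + L) * Z"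
      by (rule has_sum_mono[OF hd hb]) (use bd in \<open>auto simp: abs_le_iff\<close>)
    moreover have "- (D * (1 + L) * Z) \<le> coprime_sum Q - \<kappa>\<^sup>2 * L\<^sup>2 * muzeta2"
    proof -
      have "-1 * (D * (1 + L) * Z) \<le> coprime_sum Q - \<kappa>\<^sup>2 * L\<^sup>2 * muzeta2"
      proof (rule has_sum_mono[OF has_sum_cmult_right[OF hb, of "-1"] hd])
        fix J assume "J \<in> Idls"
        have neg: "-1 * x \<le> y" if "\<bar>y\<bar> \<le> x" for x y :: real using that by linarith
        show "-1 * (D * (1 + L) * (1 / (real (nrm J) * sqrt (nrm J)))) \<le> ?f J - ?g J"
          by (rule neg[OF bd[OF \<open>J \<in> Idls\<close>]])
      qed
      thus ?thesis by simp
    qed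
    ultimately have "\<bar>coprime_sum Q - \<kappa>\<^sup>2 * L\<^sup>2 * muzeta2\<bar> \<le> D * (1 + L) * Z" by (rule abs_leI[OF _ minus_le_iff[THEN iffD1]])
    moreover have "\<kappa>\<^sup>2 * L\<^sup>2 * muzeta2 = \<kappa>\<^sup>2 * muzeta2 * L\<^sup>2" "D * (1 + L) * Z = D * Z * (1 + L)" by simp_all
    ultimately show ?thesis unfolding L_def by (simp only:)
  qed
  note main = this
  have "D * Z \<ge> 0" using D Z by simp
  show ?thesis by (rule that[OF \<open>D * Z \<ge> 0\<close> main[unfolded \<kappa>_def]])
qed

section \<open>Simultaneous divisibility conditions in a disc\<close>

definition dvdO :: "complex \<Rightarrow> complex \<Rightarrow> bool" where
  "dvdO d y \<longleftrightarrow> (\<exists>c\<in>Ok. y = d * c)"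

text \<open>Chinese remainder theorem: the solutions are x0 + a b O. Dividing by a b turns them into
  points of the whole order in a disc of radius \<rho> / |a b| with a new centre, so a single
  constant serves all a, b and s.\<close>

lemma congruence_count:
  obtains C where "C \<ge> 0"
    "\<And>a b s \<rho>. a \<in> Ok \<Longrightarrow> b \<in> Ok \<Longrightarrow> a \<noteq> 0 \<Longrightarrow> b \<noteq> 0 \<Longrightarrow> coprimeO a b \<Longrightarrow> \<rho> \<ge> 0 \<Longrightarrow>
       \<bar>real (card {x \<in> Ok. dvdO b x \<and> dvdO a (x + 1) \<and> cmod (x + s) \<le> \<rho>})
         - pi / Im w * (\<rho> / (cmod a * cmod b))\<^sup>2\<bar> \<le> C * (\<rho> / (cmod a * cmod b) + 1)"
proof -
  obtain C where C: "C \<ge> 0"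
    "\<And>z \<rho>. \<rho> \<ge> 0 \<Longrightarrow> finite {x \<in> Ok. cmod (x + z) \<le> \<rho>}"
    "\<And>z \<rho>. \<rho> \<ge> 0 \<Longrightarrow>
      \<bar>real (card {x \<in> Ok. cmod (x + z) \<le> \<rho>}) - pi / Im w / nrm Ok * \<rho>\<^sup>2\<bar> \<le> C * (\<rho> + 1)"
    using idl_count[OF idl_Ok] by blast
  have "\<bar>real (card {x \<in> Ok. dvdO b x \<and> dvdO a (x + 1) \<and> cmod (x + s) \<le> \<rho>})
         - pi / Im w * (\<rho> / (cmod a * cmod b))\<^sup>2\<bar> \<le> C * (\<rho> / (cmod a * cmod b) + 1)"
    if ab: "a \<in> Ok" "b \<in> Ok" "a \<noteq> 0" "b \<noteq> 0" and cop: "coprimeO a b" and \<rho>: "\<rho> \<ge> 0" for a b s \<rho>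
  proof -
    obtain u v where uv: "u \<in> Ok" "v \<in> Ok" "u * a + v * b = 1" using cop unfolding coprimeO_def by blast
    define x0 where "x0 = - (v * b)"
    have x0: "x0 + 1 = u * a" unfolding x0_def using uv(3) by (simp add: algebra_simps)
    \<comment> \<open>The shift of the disc after division by a b.\<close>
    define z where "z = (x0 + s) / (a * b)"
    let ?X = "{x \<in> Ok. dvdO b x \<and> dvdO a (x + 1) \<and> cmod (x + s) \<le> \<rho>}"
    let ?T = "{t \<in> Ok. cmod (t + z) \<le> \<rho> / (cmod a * cmod b)}"
    have nz: "cmod a * cmod b > 0" using ab by simp
    have eq: "x0 + t * (a * b) + s = (t + z) * (a * b)" for t
      unfolding z_def using ab by (simp add: algebra_simps)
    have norm_iff: "cmod (x0 + t * (a * b) + s) \<le> \<rho> \<longleftrightarrow> cmod (t + z) \<le> \<rho> / (cmod a * cmod b)" for t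
      unfolding eq norm_mult using nz by (simp add: pos_le_divide_eq)
    have "bij_betw (\<lambda>t. x0 + t * (a * b)) ?T ?X"
    proof (rule bij_betw_imageI)
      show "inj_on (\<lambda>t. x0 + t * (a * b)) ?T" using ab by (auto simp: inj_on_def)
      show "(\<lambda>t. x0 + t * (a * b)) ` ?T = ?X"
      proof (rule subset_antisym; rule subsetI)
        fix x assume "x \<in> (\<lambda>t. x0 + t * (a * b)) ` ?T"
        then obtain t where t: "t \<in> Ok" "cmod (t + z) \<le> \<rho> / (cmod a * cmod b)" "x = x0 + t * (a * b)" by blast
        have "x = b * (t * a - v)" unfolding t(3) x0_def by (simp add: algebra_simps)
        moreover have "t * a - v \<in> Ok" using t ab uv Ok_mult Ok_diff by simp
        ultimately have d1: "dvdO b x" "x \<in> Ok" unfolding dvdO_def using ab Ok_mult by auto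
        have "x + 1 = a * (u + t * b)" unfolding t(3) using x0 by (simp add: algebra_simps)
        moreover have "u + t * b \<in> Ok" using t ab uv Ok_mult Ok_add by simp
        ultimately have "dvdO a (x + 1)" unfolding dvdO_def by auto
        thus "x \<in> ?X" using d1 norm_iff[of t] t(2) unfolding t(3) by simp
      next
        fix x assume x: "x \<in> ?X"
        then obtain c d where c: "c \<in> Ok" "x = b * c" and d: "d \<in> Ok" "x + 1 = a * d"
          unfolding dvdO_def by blast
        \<comment> \<open>Here x - x0 equals both b (c + v) and a (d - u); multiplying it by 1 = u a
          + v b exhibits the factor a b and this cofactor.\<close>
        define t where "t = u * (c + v) + v * (d - u)"
        have tO: "t \<in> Ok" unfolding t_def using uv c d Ok_mult Ok_add Ok_diff by simp
        have "a * d - b * c = 1" using c(2) d(2) by (metis add_diff_cancel_left')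
        hence ad: "a * (d - u) = b * (c + v)" using uv(3) by (simp add: algebra_simps)
        have "t * (a * b) = (u * a) * (b * (c + v)) + (v * b) * (a * (d - u))" unfolding t_def by (simp add: algebra_simps)
        also have "\<dots> = (u * a + v * b) * (b * (c + v))" unfolding ad by (simp add: algebra_simps)
        also have "\<dots> = x - x0" unfolding uv(3) x0_def c(2) by (simp add: algebra_simps)
        finally have xt: "x = x0 + t * (a * b)" by simp
        have "cmod (x + s) \<le> \<rho>" using x by simp
        hence "cmod (t + z) \<le> \<rho> / (cmod a * cmod b)" using norm_iff[of t] unfolding xt by simp
        hence "t \<in> ?T" using tO by simp
        thus "x \<in> (\<lambda>t. x0 + t * (a * b)) ` ?T" using xt by blast
      qed
    qed
    hence XT: "card ?X = card ?T" by (rule bij_betw_same_card[symmetric])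
    have "\<rho> / (cmod a * cmod b) \<ge> 0" using \<rho> nz by simp
    from C(3)[OF this, of z] show ?thesis unfolding XT nrm_Ok by (simp only: of_nat_1 div_by_1)
  qed
  note main = this
  show ?thesis by (rule that[OF C(1) main])
qed

end

section \<open>The hyperbola method\<close>

context imag_quadratic begin

definition divs :: "complex \<Rightarrow> complex set" where "divs y = {d \<in> Ok - {0}. dvdO d y}"

lemma finite_disc: "finite {x \<in> Ok. cmod (x + s) \<le> \<rho>}"
proof (cases "\<rho> \<ge> 0")
  case True
  thus ?thesis using idl_count[OF idl_Ok] by metis
next
  case False
  have "{x \<in> Ok. cmod (x + s) \<le> \<rho>} = {}"
    using False norm_ge_zero order_trans by blast
  thus ?thesis by (metis finite.emptyI)
qed

text \<open>Under the involution d \<mapsto> y / d, the divisors of norm at most Q and their images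
  cover everything, because |d|^2 |y / d|^2 = |y|^2 \<le> Q^2. They overlap in B, and
  inclusion-exclusion gives the count.\<close>

lemma hyperbola:
  assumes y: "y \<in> Ok" "y \<noteq> 0" "cmod y \<le> Q"
  defines "A \<equiv> {d \<in> ball0 Ok Q. dvdO d y}"
  defines "B \<equiv> {d \<in> ball0 Ok Q. dvdO d y \<and> (cmod (y / d))\<^sup>2 \<le> Q}"
  shows "card (divs y) + card B = 2 * card A" "B \<subseteq> A" "finite A"
proof -
  show fA: "finite A" unfolding A_def using finite_ball0[OF idl_Ok] by simp
  show "B \<subseteq> A" unfolding A_def B_def by auto
  have i: "y / d \<in> divs y" "y / (y / d) = d" if dy: "d \<in> divs y" for d
  proof -
    have d: "d \<in> Ok" "d \<noteq> 0" using dy unfolding divs_def by auto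
    obtain c where c: "c \<in> Ok" "y = d * c" using dy unfolding divs_def dvdO_def by blast
    have yd: "y / d = c" using c d by simp
    have "c \<noteq> 0" using c y by auto
    moreover have "dvdO c y" unfolding dvdO_def by (rule bexI[OF _ d(1)]) (use c in simp)
    ultimately show "y / d \<in> divs y" unfolding yd divs_def using c(1) by simp
    show "y / (y / d) = d" using y(2) d(2) by simp
  qed
  have AD: "A \<subseteq> divs y" unfolding A_def divs_def ball0_def by auto
  have inj: "inj_on (\<lambda>d. y / d) (divs y)" by (rule inj_on_inverseI[of _ "\<lambda>d. y / d"]) (rule i(2))
  have memA: "d \<in> A \<longleftrightarrow> (cmod d)\<^sup>2 \<le> Q" if "d \<in> divs y" for d
    using that unfolding A_def divs_def ball0_def by auto
  have im: "d \<in> (\<lambda>d. y / d) ` A \<longleftrightarrow> (cmod (y / d))\<^sup>2 \<le> Q" if d: "d \<in> divs y" for d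
  proof
    assume "d \<in> (\<lambda>d. y / d) ` A"
    then obtain e where e: "e \<in> A" "d = y / e" by blast
    hence "y / d = e" using i(2)[of e] AD by auto
    thus "(cmod (y / d))\<^sup>2 \<le> Q" using memA[of e] e(1) AD by auto
  next
    assume "(cmod (y / d))\<^sup>2 \<le> Q"
    hence "y / d \<in> A" using memA[OF i(1)[OF d]] by simp
    thus "d \<in> (\<lambda>d. y / d) ` A" using i(2)[OF d] by (metis imageI)
  qed
  have imD: "(\<lambda>d. y / d) ` A \<subseteq> divs y" using AD i(1) by blast
  have un: "A \<union> (\<lambda>d. y / d) ` A = divs y"
  proof
    show "A \<union> (\<lambda>d. y / d) ` A \<subseteq> divs y" using AD imD by simp
    show "divs y \<subseteq> A \<union> (\<lambda>d. y / d) ` A"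
    proof
      fix d assume d: "d \<in> divs y"
      hence d0: "d \<noteq> 0" unfolding divs_def by simp
      have "(cmod d)\<^sup>2 \<le> Q \<or> (cmod (y / d))\<^sup>2 \<le> Q"
      proof (rule ccontr)
        assume n: "\<not> ((cmod d)\<^sup>2 \<le> Q \<or> (cmod (y / d))\<^sup>2 \<le> Q)"
        have Q0: "Q \<ge> 0" using y(3) norm_ge_zero order_trans by blast
        have "Q * Q < (cmod d)\<^sup>2 * (cmod (y / d))\<^sup>2" using n Q0 by (intro mult_strict_mono') auto
        also have "\<dots> = (cmod y)\<^sup>2" using d0 by (simp add: norm_divide power_divide)
        also have "\<dots> \<le> Q * Q" using y(3) unfolding power2_eq_square by (intro mult_mono) (auto simp: Q0)
        finally show False by simp
      qed
      thus "d \<in> A \<union> (\<lambda>d. y / d) ` A" using memA[OF d] im[OF d] by simp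
    qed
  qed
  have int: "A \<inter> (\<lambda>d. y / d) ` A = B"
  proof (rule Set.set_eqI)
    fix d
    show "d \<in> A \<inter> (\<lambda>d. y / d) ` A \<longleftrightarrow> d \<in> B"
    proof (cases "d \<in> A")
      case True
      hence "d \<in> divs y" using AD by auto
      thus ?thesis using True im unfolding A_def B_def by auto
    next
      case False
      thus ?thesis unfolding A_def B_def by auto
    qed
  qed
  have "card ((\<lambda>d. y / d) ` A) = card A" by (rule card_image[OF inj_on_subset[OF inj AD]])
  thus "card (divs y) + card B = 2 * card A"
    using card_Un_Int[OF fA finite_imageI[OF fA], of "\<lambda>d. y / d"] unfolding un int by simp
qed

lemma sum_card_swap:
  assumes "finite S" "finite P"
  shows "(\<Sum>x\<in>S. card {p \<in> P. rel x p}) = (\<Sum>p\<in>P. card {x \<in> S. rel x p})"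
proof -
  have "(\<Sum>x\<in>S. \<Sum>p\<in>{p \<in> P. rel x p}. 1) = (\<Sum>p\<in>P. \<Sum>x\<in>{x \<in> S. rel x p}. (1::nat))"
    by (rule sum.swap_restrict[OF assms])
  thus ?thesis by simp
qed

lemma dvdO_coprime: assumes "dvdO b x" "dvdO a (x + 1)" shows "coprimeO a b"
proof -
  obtain c d where c: "c \<in> Ok" "x = b * c" and d: "d \<in> Ok" "x + 1 = a * d" using assms unfolding dvdO_def by blast
  have "a * d - b * c = 1" using c(2) d(2) by (metis add_diff_cancel_left')
  hence "d * a + (- c) * b = 1" by (simp add: algebra_simps)
  thus ?thesis unfolding coprimeO_def using c(1) d(1) Ok_minus by blast
qed

text \<open>One majorant for two kinds of error per pair (a, b): the boundary term Q / |a b| + 1 of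
  the lattice count, and the overlap of the hyperbola method, of size Q / |a|^2 + 1 or Q / |b|^2 +
  1.\<close>

definition pair_error :: "real \<Rightarrow> real" where
  "pair_error Q = (\<Sum>(a, b)\<in>ball0 Ok Q \<times> ball0 Ok Q. Q / (cmod a)\<^sup>2 + Q / (cmod b)\<^sup>2 + 1)"

text \<open>With n = O(Q) elements and reciprocal sum H = O(1 + ln Q), the total is 2 n Q H + n^2.
  Later Q^2 = O(T).\<close>

lemma pair_error_bound:
  obtains C where "C \<ge> 0" "\<And>Q. Q \<ge> 1 \<Longrightarrow> pair_error Q \<le> C * Q\<^sup>2 * (1 + ln Q)"
proof -
  define \<kappa> where "\<kappa> = pi / Im w"
  obtain C1 where C1: "C1 \<ge> 0" "\<And>Q. Q \<ge> 1 \<Longrightarrow> \<bar>real (card (ball0 Ok Q)) - pi / Im w / nrm Ok * Q\<bar> \<le> C1 * sqrt Q"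
    using card_ball0[OF idl_Ok] by blast
  obtain C2 where C2: "C2 \<ge> 0"
    "\<And>I Q. idl I \<Longrightarrow> Q \<ge> 1 \<Longrightarrow> \<bar>recip_sum I Q - pi / Im w / nrm I * ln Q\<bar> \<le> C2 * (1 + ln (nrm I)) / nrm I"
    "\<And>I Q. idl I \<Longrightarrow> Q \<ge> 1 \<Longrightarrow> recip_sum I Q \<le> C2 * (1 + ln Q) / nrm I"
    using recip_sum_uniform by blast
  define M where "M = \<kappa> + C1"
  have M: "M \<ge> 0" unfolding M_def \<kappa>_def using C1 Im_w by simp
  have "pair_error Q \<le> (2 * M * C2 + M * M) * Q\<^sup>2 * (1 + ln Q)" if Q: "Q \<ge> 1" for Q
  proof -
    let ?B = "ball0 Ok Q"
    define n where "n = real (card ?B)"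
    define H where "H = recip_sum Ok Q"
    define L where "L = 1 + ln Q"
    have L: "L \<ge> 1" unfolding L_def using Q by simp
    have "sqrt Q * 1 \<le> sqrt Q * sqrt Q" using Q by (intro mult_left_mono) auto
    hence "C1 * sqrt Q \<le> C1 * Q" using Q C1(1) by (intro mult_left_mono) auto
    hence n: "n \<le> M * Q" using C1(2)[OF Q] unfolding n_def M_def \<kappa>_def nrm_Ok
      by (simp add: distrib_right abs_le_iff)
    have H: "H \<le> C2 * L" using C2(3)[OF idl_Ok Q] unfolding H_def L_def nrm_Ok by simp
    have H0: "H \<ge> 0" unfolding H_def recip_sum_def by (simp add: sum_nonneg)
    have n0: "n \<ge> 0" unfolding n_def by simp
    have QH: "(\<Sum>a\<in>?B. Q / (cmod a)\<^sup>2) = Q * H"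
      unfolding H_def recip_sum_def by (simp add: sum_distrib_left)
    have "pair_error Q = (\<Sum>a\<in>?B. \<Sum>b\<in>?B. Q / (cmod a)\<^sup>2 + Q / (cmod b)\<^sup>2 + 1)"
      unfolding pair_error_def by (simp add: sum.cartesian_product)
    also have "\<dots> = (\<Sum>a\<in>?B. n * (Q / (cmod a)\<^sup>2) + Q * H + n)"
      unfolding sum.distrib QH n_def by simp
    also have "\<dots> = n * (Q * H) + n * (Q * H) + n * n"
      unfolding sum.distrib sum_distrib_left[symmetric] QH n_def by simp
    also have "\<dots> = 2 * (n * (Q * H)) + n * n" by simp
    also have "\<dots> \<le> 2 * ((M * Q) * (Q * (C2 * L))) + (M * Q) * (M * Q)"
      using n H H0 n0 Q M C2(1) L by (intro add_mono mult_left_mono mult_mono) auto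
    also have "(M * Q) * (M * Q) \<le> (M * Q) * (M * Q) * L"
      using mult_left_mono[OF L, of "(M * Q) * (M * Q)"] by simp
    finally show ?thesis unfolding L_def[symmetric] by (simp add: power2_eq_square algebra_simps)
  qed
  note main = this
  have "2 * M * C2 + M * M \<ge> 0" using M C2(1) by simp
  thus ?thesis using main by (rule that)
qed

lemma sum_coprime_pairs_le:
  assumes "\<And>a b. (a, b) \<in> coprime_pairs Q \<Longrightarrow> f (a, b) \<le> C * (Q / (cmod a)\<^sup>2 + Q / (cmod b)\<^sup>2 + 1)"
    and "C \<ge> 0" "Q \<ge> 0"
  shows "(\<Sum>p\<in>coprime_pairs Q. f p) \<le> C * pair_error Q"
proof -
  let ?e = "\<lambda>(a, b). Q / (cmod a)\<^sup>2 + Q / (cmod b)\<^sup>2 + (1::real)"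
  have "(\<Sum>p\<in>coprime_pairs Q. f p) \<le> (\<Sum>p\<in>coprime_pairs Q. C * ?e p)"
    by (rule sum_mono) (use assms(1) in auto)
  also have "\<dots> \<le> (\<Sum>p\<in>ball0 Ok Q \<times> ball0 Ok Q. C * ?e p)"
    by (rule sum_mono2[OF _ coprime_pairs_subset])
       (use finite_ball0[OF idl_Ok] assms(2,3) in \<open>auto intro!: mult_nonneg_nonneg add_nonneg_nonneg\<close>)
  also have "\<dots> = C * pair_error Q" unfolding pair_error_def by (simp only: sum_distrib_left)
  finally show ?thesis .
qed

end

text \<open>The cutoff \<surd>T + 1 has logarithm (ln T) / 2 + O(1); the quarter compensates the
  factor 4 of the hyperbola method.\<close>

lemma log_shift:
  fixes T :: real
  assumes "T \<ge> 1"
  shows "1 + ln (sqrt T + 1) \<le> 2 * (1 + ln T)" "\<bar>(ln (sqrt T + 1))\<^sup>2 - (ln T)\<^sup>2 / 4\<bar> \<le> 1 + ln T"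
proof -
  define r where "r = ln (sqrt T)"
  define q where "q = ln (sqrt T + 1)"
  have R: "sqrt T \<ge> 1" using assms by simp
  have r: "r = ln T / 2" unfolding r_def using assms by (simp add: ln_sqrt)
  have r0: "r \<ge> 0" unfolding r_def using R by (rule ln_ge_zero)
  have rq: "r \<le> q" unfolding r_def q_def by (rule ln_le_cancel_iff[THEN iffD2]) (use R in linarith)+
  have "q \<le> ln (2 * sqrt T)" unfolding q_def by (rule ln_le_cancel_iff[THEN iffD2]) (use R in linarith)+
  also have "\<dots> = ln 2 + r" unfolding r_def using R by (simp add: ln_mult)
  also have "ln 2 \<le> (1 :: real)" using ln_le_minus_one[of 2] by simp
  finally have qr: "q \<le> 1 + r" by simp
  show "1 + ln (sqrt T + 1) \<le> 2 * (1 + ln T)" using qr r0 unfolding q_def[symmetric] r by simp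
  have "q\<^sup>2 - r\<^sup>2 = (q - r) * (q + r)" by (simp add: power2_eq_square algebra_simps)
  hence "\<bar>q\<^sup>2 - r\<^sup>2\<bar> = (q - r) * (q + r)" using rq r0 by (simp add: abs_mult)
  also have "\<dots> \<le> 1 * (1 + 2 * r)" using qr rq r0 by (intro mult_mono) auto
  finally show "\<bar>(ln (sqrt T + 1))\<^sup>2 - (ln T)\<^sup>2 / 4\<bar> \<le> 1 + ln T"
    unfolding q_def[symmetric] r by (simp add: power_divide)
qed

context imag_quadratic begin

text \<open>With A counting the small divisors and B the overlap, the product (2 A2 - B2) (2 A1 -
  B1) is 4 A1 A2 up to terms containing a B. Excluding 0 and -1 keeps x and x + 1 nonzero, and Q
  exceeds \<surd>T by 1 so that it bounds |x + 1| as well.\<close>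

lemma sum_divs_hyperbola:
  fixes T :: real
  assumes T: "T \<ge> 0"
  defines "S \<equiv> {x \<in> Ok - {0, -1}. (cmod x)\<^sup>2 \<le> T}" and "Q \<equiv> sqrt T + 1"
  defines "AA \<equiv> (\<lambda>(a, b). {x \<in> S. dvdO b x \<and> dvdO a (x + 1)})"
  shows "finite S"
    "\<bar>real (\<Sum>x\<in>S. card (divs x) * card (divs (x + 1))) - 4 * (\<Sum>p\<in>coprime_pairs Q. real (card (AA p)))\<bar>
       \<le> 2 * (\<Sum>(a, b)\<in>coprime_pairs Q. real (card {x \<in> AA (a, b). (cmod ((x + 1) / a))\<^sup>2 \<le> Q}))
        + 2 * (\<Sum>(a, b)\<in>coprime_pairs Q. real (card {x \<in> AA (a, b). (cmod (x / b))\<^sup>2 \<le> Q}))"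
proof -
  let ?K = "ball0 Ok Q"
  have fK: "finite ?K" by (rule finite_ball0[OF idl_Ok])
  have "S \<subseteq> ball0 Ok T" unfolding S_def ball0_def by auto
  thus fS: "finite S" using finite_ball0[OF idl_Ok] by (rule finite_subset)
  \<comment> \<open>The extra conditions f and g are instantiated three times: both trivial for the
    main term, one of them the overlap condition for each error sum.\<close>
  have double_count: "(\<Sum>x\<in>S. card {a \<in> ?K. dvdO a (x + 1) \<and> f x a} * card {b \<in> ?K. dvdO b x \<and> g x b})
      = (\<Sum>p\<in>coprime_pairs Q. card {x \<in> AA p. f x (fst p) \<and> g x (snd p)})"
    for f g :: "complex \<Rightarrow> complex \<Rightarrow> bool"
  proof -
    let ?R = "\<lambda>x p. dvdO (snd p) x \<and> dvdO (fst p) (x + 1) \<and> f x (fst p) \<and> g x (snd p)"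
    have "(\<Sum>x\<in>S. card {a \<in> ?K. dvdO a (x + 1) \<and> f x a} * card {b \<in> ?K. dvdO b x \<and> g x b})
      = (\<Sum>x\<in>S. card {p \<in> ?K \<times> ?K. ?R x p})"
    proof (rule sum.cong[OF refl])
      fix x
      have "{p \<in> ?K \<times> ?K. ?R x p} = {a \<in> ?K. dvdO a (x + 1) \<and> f x a} \<times> {b \<in> ?K. dvdO b x \<and> g x b}"
        by auto
      thus "card {a \<in> ?K. dvdO a (x + 1) \<and> f x a} * card {b \<in> ?K. dvdO b x \<and> g x b} = card {p \<in> ?K \<times> ?K. ?R x p}"
        by (simp only: card_cartesian_product)
    qed
    also have "\<dots> = (\<Sum>p\<in>?K \<times> ?K. card {x \<in> S. ?R x p})"
      by (rule sum_card_swap) (use fS fK in auto)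
    also have "\<dots> = (\<Sum>p\<in>coprime_pairs Q. card {x \<in> AA p. f x (fst p) \<and> g x (snd p)})"
    proof (rule sum.mono_neutral_cong_right)
      show "finite (?K \<times> ?K)" using fK by simp
      \<comment> \<open>A pair that is not coprime is hit by no x, so the restriction to coprime
        pairs is automatic.\<close>
      show "\<forall>p\<in>?K \<times> ?K - coprime_pairs Q. card {x \<in> S. ?R x p} = 0"
      proof
        fix p assume p: "p \<in> ?K \<times> ?K - coprime_pairs Q"
        obtain a b where ab: "p = (a, b)" by (metis surj_pair)
        have "\<not> coprimeO a b" using p unfolding ab coprime_pairs_def by auto
        hence "{x \<in> S. ?R x p} = {}" using dvdO_coprime unfolding ab by auto
        thus "card {x \<in> S. ?R x p} = 0" by (simp only: card.empty)
      qed
      show "card {x \<in> S. ?R x p} = card {x \<in> AA p. f x (fst p) \<and> g x (snd p)}" for p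
        unfolding AA_def by (simp add: case_prod_unfold conj_assoc)
    qed (rule coprime_pairs_subset)
    finally show ?thesis .
  qed
  define A1 where "A1 = (\<lambda>x. card {a \<in> ?K. dvdO a (x + 1) \<and> True})"
  define A2 where "A2 = (\<lambda>x. card {b \<in> ?K. dvdO b x \<and> True})"
  define B1 where "B1 = (\<lambda>x. card {a \<in> ?K. dvdO a (x + 1) \<and> (cmod ((x + 1) / a))\<^sup>2 \<le> Q})"
  define B2 where "B2 = (\<lambda>x. card {b \<in> ?K. dvdO b x \<and> (cmod (x / b))\<^sup>2 \<le> Q})"
  have step: "\<bar>real (card (divs x) * card (divs (x + 1))) - 4 * real (A1 x * A2 x)\<bar>
      \<le> 2 * real (B1 x * A2 x) + 2 * real (A1 x * B2 x)" if x: "x \<in> S" for x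
  proof -
    have xO: "x \<in> Ok" "x \<noteq> 0" "x \<noteq> -1" "(cmod x)\<^sup>2 \<le> T" using x unfolding S_def by auto
    have R: "cmod x \<le> sqrt T" using xO(4) by (rule real_le_rsqrt)
    hence "cmod x \<le> Q" unfolding Q_def by simp
    from hyperbola[OF xO(1,2) this] have 2: "card (divs x) + B2 x = 2 * A2 x" and le2: "B2 x \<le> A2 x"
      unfolding A2_def B2_def by (simp_all add: card_mono)
    have "cmod (x + 1) \<le> cmod x + 1" using norm_triangle_ineq[of x 1] by simp
    hence "cmod (x + 1) \<le> Q" using R unfolding Q_def by simp
    moreover have "x + 1 \<noteq> 0" using xO(3) by (metis add_eq_0_iff2)
    ultimately have 1: "card (divs (x + 1)) + B1 x = 2 * A1 x" and le1: "B1 x \<le> A1 x"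
      using hyperbola[OF Ok_add[OF xO(1) Ok_1], of Q] unfolding A1_def B1_def by (simp_all add: card_mono)
    define a1 a2 b1 b2 where "a1 = real (A1 x)" and "a2 = real (A2 x)" and "b1 = real (B1 x)" and "b2 = real (B2 x)"
    have c: "real (card (divs x)) = 2 * a2 - b2" "real (card (divs (x + 1))) = 2 * a1 - b1"
      using 1 2 unfolding a1_def a2_def b1_def b2_def by linarith+
    \<comment> \<open>The positive term b1 b2 is absorbed into a1 b2, since B1 is at most
      A1.\<close>
    have "b1 * b2 \<le> a1 * b2" "0 \<le> b1 * b2" "0 \<le> b1 * a2" "0 \<le> a1 * b2"
      using le1 unfolding a1_def a2_def b1_def b2_def by (auto intro: mult_right_mono)
    moreover have "(2 * a2 - b2) * (2 * a1 - b1) - 4 * (a1 * a2) = b1 * b2 - 2 * (b1 * a2) - 2 * (a1 * b2)"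
      by (simp add: algebra_simps)
    ultimately have "\<bar>(2 * a2 - b2) * (2 * a1 - b1) - 4 * (a1 * a2)\<bar> \<le> 2 * (b1 * a2) + 2 * (a1 * b2)" by linarith
    thus ?thesis unfolding of_nat_mult c unfolding a1_def a2_def b1_def b2_def .
  qed
  have "\<bar>(\<Sum>x\<in>S. real (card (divs x) * card (divs (x + 1))) - 4 * real (A1 x * A2 x))\<bar>
      \<le> (\<Sum>x\<in>S. 2 * real (B1 x * A2 x) + 2 * real (A1 x * B2 x))"
    by (rule sum_abs[THEN order_trans], rule sum_mono, rule step)
  hence "\<bar>real (\<Sum>x\<in>S. card (divs x) * card (divs (x + 1))) - 4 * real (\<Sum>x\<in>S. A1 x * A2 x)\<bar>
      \<le> 2 * real (\<Sum>x\<in>S. B1 x * A2 x) + 2 * real (\<Sum>x\<in>S. A1 x * B2 x)"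
    by (simp only: sum_subtractf sum.distrib sum_distrib_left[symmetric] of_nat_sum)
  moreover have "(\<Sum>x\<in>S. A1 x * A2 x) = (\<Sum>p\<in>coprime_pairs Q. card (AA p))"
    unfolding A1_def A2_def double_count by simp
  moreover have "(\<Sum>x\<in>S. B1 x * A2 x) = (\<Sum>(a, b)\<in>coprime_pairs Q. card {x \<in> AA (a, b). (cmod ((x + 1) / a))\<^sup>2 \<le> Q})"
    unfolding B1_def A2_def double_count by (simp add: case_prod_unfold)
  moreover have "(\<Sum>x\<in>S. A1 x * B2 x) = (\<Sum>(a, b)\<in>coprime_pairs Q. card {x \<in> AA (a, b). (cmod (x / b))\<^sup>2 \<le> Q})"
    unfolding A1_def B2_def double_count by (simp add: case_prod_unfold)
  ultimately show "\<bar>real (\<Sum>x\<in>S. card (divs x) * card (divs (x + 1))) - 4 * (\<Sum>p\<in>coprime_pairs Q. real (card (AA p)))\<bar>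
       \<le> 2 * (\<Sum>(a, b)\<in>coprime_pairs Q. real (card {x \<in> AA (a, b). (cmod ((x + 1) / a))\<^sup>2 \<le> Q}))
        + 2 * (\<Sum>(a, b)\<in>coprime_pairs Q. real (card {x \<in> AA (a, b). (cmod (x / b))\<^sup>2 \<le> Q}))"
    by (simp only: of_nat_sum case_prod_unfold)
qed

lemma product_le_sum_squares: fixes x y :: real shows "x * y \<le> x\<^sup>2 + y\<^sup>2"
proof -
  have "0 \<le> (x - y)\<^sup>2" by simp
  hence "2 * (x * y) \<le> x\<^sup>2 + y\<^sup>2" by (simp add: power2_diff)
  moreover have "0 \<le> x\<^sup>2 + y\<^sup>2" by simp
  ultimately show ?thesis by linarith
qed

lemma le_square_plus_1: fixes x :: real shows "x \<le> x\<^sup>2 + 1"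
  using product_le_sum_squares[of x 1] by simp

text \<open>For a coprime pair, the main count is over the disc of radius \<surd>T. In the overlap
  sums, smallness of (x + 1) / a or x / b confines x to a disc of radius \<surd>Q |a| or \<surd>Q
  |b|, so these counts are of the order of \<open>pair_error\<close>.\<close>

lemma divisor_correlation:
  obtains C where "C \<ge> 0" "\<And>T. T \<ge> 1 \<Longrightarrow>
     \<bar>real (\<Sum>x\<in>{x \<in> Ok - {0, -1}. (cmod x)\<^sup>2 \<le> T}. card (divs x) * card (divs (x + 1)))
        - (pi / Im w) ^ 3 * muzeta2 * (T * (ln T)\<^sup>2)\<bar> \<le> C * (T * (1 + ln T))"
proof -
  define \<kappa> where "\<kappa> = pi / Im w"
  have \<kappa>: "\<kappa> > 0" unfolding \<kappa>_def using Im_w by simp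
  obtain C0 where C0: "C0 \<ge> 0"
    "\<And>a b s \<rho>. a \<in> Ok \<Longrightarrow> b \<in> Ok \<Longrightarrow> a \<noteq> 0 \<Longrightarrow> b \<noteq> 0 \<Longrightarrow> coprimeO a b \<Longrightarrow> \<rho> \<ge> 0 \<Longrightarrow>
       \<bar>real (card {x \<in> Ok. dvdO b x \<and> dvdO a (x + 1) \<and> cmod (x + s) \<le> \<rho>})
         - pi / Im w * (\<rho> / (cmod a * cmod b))\<^sup>2\<bar> \<le> C0 * (\<rho> / (cmod a * cmod b) + 1)"
    using congruence_count by blast
  obtain C1 where C1: "C1 \<ge> 0"
    "\<And>Q. Q \<ge> 1 \<Longrightarrow> \<bar>coprime_sum Q - (pi / Im w)\<^sup>2 * muzeta2 * (ln Q)\<^sup>2\<bar> \<le> C1 * (1 + ln Q)"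
    using coprime_sum_asymp by blast
  obtain C2 where C2: "C2 \<ge> 0" "\<And>Q. Q \<ge> 1 \<Longrightarrow> pair_error Q \<le> C2 * Q\<^sup>2 * (1 + ln Q)"
    using pair_error_bound by blast
  \<comment> \<open>The 2 accounts for the points 0 and -1 removed from the disc.\<close>
  define C3 where "C3 = C0 + 2"
  define C4 where "C4 = \<kappa> + 2 * C0"
  have C34: "C3 \<ge> 0" "C4 \<ge> 0" unfolding C3_def C4_def using C0(1) \<kappa> by simp_all
  \<comment> \<open>The weights 4 C3 and 4 C4 come from the factor 4 and from two overlap sums with
    factor 2 each; the 8 in the first term comes from Q^2 \<le> 4 T and 1 + ln Q \<le> 2 (1 + ln T).
    The last two terms replace the coprime sum by its asymptotics and ln Q by (ln T) / 2.\<close>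
  define C where "C = (4 * C3 + 4 * C4) * C2 * 8 + 8 * \<kappa> * C1 + 4 * \<bar>\<kappa> ^ 3 * muzeta2\<bar>"
  have C: "C \<ge> 0" unfolding C_def using C34 C1(1) C2(1) \<kappa> by simp
  have main: "\<bar>real (\<Sum>x\<in>{x \<in> Ok - {0, -1}. (cmod x)\<^sup>2 \<le> T}. card (divs x) * card (divs (x + 1)))
        - \<kappa> ^ 3 * muzeta2 * (T * (ln T)\<^sup>2)\<bar> \<le> C * (T * (1 + ln T))" if T: "T \<ge> 1" for T
  proof -
    define R where "R = sqrt T"
    define Q where "Q = R + 1"
    have R: "R \<ge> 1" "R\<^sup>2 = T" unfolding R_def using T by simp_all
    have Q: "Q \<ge> 1" "Q \<ge> 0" "R \<le> Q" unfolding Q_def using R by simp_all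
    define S where "S = {x \<in> Ok - {0, -1}. (cmod x)\<^sup>2 \<le> T}"
    define AA where "AA = (\<lambda>(a, b). {x \<in> S. dvdO b x \<and> dvdO a (x + 1)})"
    define total where "total = real (\<Sum>x\<in>S. card (divs x) * card (divs (x + 1)))"
    have hyp: "finite S" "\<bar>total - 4 * (\<Sum>p\<in>coprime_pairs Q. real (card (AA p)))\<bar>
       \<le> 2 * (\<Sum>(a, b)\<in>coprime_pairs Q. real (card {x \<in> AA (a, b). (cmod ((x + 1) / a))\<^sup>2 \<le> Q}))
        + 2 * (\<Sum>(a, b)\<in>coprime_pairs Q. real (card {x \<in> AA (a, b). (cmod (x / b))\<^sup>2 \<le> Q}))"
      unfolding total_def AA_def S_def Q_def R_def using sum_divs_hyperbola[of T] T by simp_all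
    have pair: "a \<in> Ok" "b \<in> Ok" "a \<noteq> 0" "b \<noteq> 0" "coprimeO a b" if "(a, b) \<in> coprime_pairs Q" for a b
      using that unfolding coprime_pairs_def ball0_def by auto
    let ?e = "\<lambda>a b. Q / (cmod a)\<^sup>2 + Q / (cmod b)\<^sup>2 + (1::real)"
    have e1: "Q / (cmod a)\<^sup>2 \<ge> 0" for a :: complex using Q by simp
    \<comment> \<open>Here c is the member of the pair that scales the radius and d is the other
      one; the effective radius is \<surd>Q / |d|.\<close>
    have small: "real (card {x \<in> Ok. dvdO b x \<and> dvdO a (x + 1) \<and> cmod (x + s) \<le> sqrt Q * cmod c}) \<le> C4 * ?e a b"
      if ab: "(a, b) \<in> coprime_pairs Q" and c: "c = a \<and> d = b \<or> c = b \<and> d = a" for a b c d s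
    proof -
      have nz: "cmod a > 0" "cmod b > 0" using pair[OF ab] by simp_all
      have \<rho>: "sqrt Q * cmod c / (cmod a * cmod b) = sqrt Q / cmod d" using c nz by auto
      define q where "q = Q / (cmod d)\<^sup>2"
      define t where "t = sqrt Q / cmod d"
      have sq: "t\<^sup>2 = q" unfolding q_def t_def using Q by (simp add: power_divide)
      have q0: "q \<ge> 0" unfolding q_def by (rule e1)
      have "\<bar>real (card {x \<in> Ok. dvdO b x \<and> dvdO a (x + 1) \<and> cmod (x + s) \<le> sqrt Q * cmod c})
         - \<kappa> * t\<^sup>2\<bar> \<le> C0 * (t + 1)"
        using C0(2)[OF pair[OF ab], of "sqrt Q * cmod c" s] Q unfolding \<rho> \<kappa>_def t_def by simp
      moreover have "t + 1 \<le> 2 * q + 2"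
        using le_square_plus_1[of t] q0 unfolding sq by linarith
      hence "C0 * (t + 1) \<le> C0 * (2 * q + 2)" using C0(1) by (rule mult_left_mono)
      moreover have "\<kappa> * q \<le> \<kappa> * (q + 1)" using \<kappa> by simp
      ultimately have "real (card {x \<in> Ok. dvdO b x \<and> dvdO a (x + 1) \<and> cmod (x + s) \<le> sqrt Q * cmod c})
         \<le> \<kappa> * (q + 1) + C0 * (2 * q + 2)" unfolding sq abs_le_iff by linarith
      also have "\<dots> = C4 * (q + 1)" unfolding C4_def by (simp add: algebra_simps)
      also have "\<dots> \<le> C4 * ?e a b"
      proof -
        have "q + 1 \<le> ?e a b" unfolding q_def using c e1[of a] e1[of b] by auto
        thus ?thesis using C34(2) by (rule mult_left_mono)
      qed
      finally show ?thesis .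
    qed
    have fin: "finite {x \<in> Ok. dvdO b x \<and> dvdO a (x + 1) \<and> cmod (x + s) \<le> \<rho>}" for a b s \<rho>
      by (rule finite_subset[OF _ finite_disc[of s \<rho>]]) auto
    have s1: "(\<Sum>(a, b)\<in>coprime_pairs Q. real (card {x \<in> AA (a, b). (cmod ((x + 1) / a))\<^sup>2 \<le> Q})) \<le> C4 * pair_error Q"
    proof (rule sum_coprime_pairs_le[OF _ C34(2) Q(2)], unfold prod.case)
      fix a b assume ab: "(a, b) \<in> coprime_pairs Q"
      have "{x \<in> AA (a, b). (cmod ((x + 1) / a))\<^sup>2 \<le> Q}
          \<subseteq> {x \<in> Ok. dvdO b x \<and> dvdO a (x + 1) \<and> cmod (x + 1) \<le> sqrt Q * cmod a}"
      proof
        fix x assume x: "x \<in> {x \<in> AA (a, b). (cmod ((x + 1) / a))\<^sup>2 \<le> Q}"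
        hence "cmod ((x + 1) / a) \<le> sqrt Q" by (auto intro: real_le_rsqrt)
        hence "cmod (x + 1) \<le> sqrt Q * cmod a" using pair[OF ab] by (simp add: norm_divide divide_le_eq)
        thus "x \<in> {x \<in> Ok. dvdO b x \<and> dvdO a (x + 1) \<and> cmod (x + 1) \<le> sqrt Q * cmod a}"
          using x unfolding AA_def S_def by simp
      qed
      hence "card {x \<in> AA (a, b). (cmod ((x + 1) / a))\<^sup>2 \<le> Q}
         \<le> card {x \<in> Ok. dvdO b x \<and> dvdO a (x + 1) \<and> cmod (x + 1) \<le> sqrt Q * cmod a}"
        by (rule card_mono[OF fin])
      thus "real (card {x \<in> AA (a, b). (cmod ((x + 1) / a))\<^sup>2 \<le> Q}) \<le> C4 * ?e a b"
        using small[OF ab disjI1[OF conjI[OF refl refl]], of 1] by linarith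
    qed
    have s2: "(\<Sum>(a, b)\<in>coprime_pairs Q. real (card {x \<in> AA (a, b). (cmod (x / b))\<^sup>2 \<le> Q})) \<le> C4 * pair_error Q"
    proof (rule sum_coprime_pairs_le[OF _ C34(2) Q(2)], unfold prod.case)
      fix a b assume ab: "(a, b) \<in> coprime_pairs Q"
      have "{x \<in> AA (a, b). (cmod (x / b))\<^sup>2 \<le> Q}
          \<subseteq> {x \<in> Ok. dvdO b x \<and> dvdO a (x + 1) \<and> cmod (x + 0) \<le> sqrt Q * cmod b}"
      proof
        fix x assume x: "x \<in> {x \<in> AA (a, b). (cmod (x / b))\<^sup>2 \<le> Q}"
        hence "cmod (x / b) \<le> sqrt Q" by (auto intro: real_le_rsqrt)
        hence "cmod x \<le> sqrt Q * cmod b" using pair[OF ab] by (simp add: norm_divide divide_le_eq)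
        thus "x \<in> {x \<in> Ok. dvdO b x \<and> dvdO a (x + 1) \<and> cmod (x + 0) \<le> sqrt Q * cmod b}"
          using x unfolding AA_def S_def by simp
      qed
      hence "card {x \<in> AA (a, b). (cmod (x / b))\<^sup>2 \<le> Q}
         \<le> card {x \<in> Ok. dvdO b x \<and> dvdO a (x + 1) \<and> cmod (x + 0) \<le> sqrt Q * cmod b}"
        by (rule card_mono[OF fin])
      thus "real (card {x \<in> AA (a, b). (cmod (x / b))\<^sup>2 \<le> Q}) \<le> C4 * ?e a b"
        using small[OF ab disjI2[OF conjI[OF refl refl]], of 0] by linarith
    qed
    let ?m = "\<lambda>(a, b). \<kappa> * T * (1 / ((cmod a)\<^sup>2 * (cmod b)\<^sup>2))"
    have large: "\<bar>real (card (AA (a, b))) - ?m (a, b)\<bar> \<le> C3 * ?e a b" if ab: "(a, b) \<in> coprime_pairs Q" for a b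
    proof -
      let ?Y = "{x \<in> Ok. dvdO b x \<and> dvdO a (x + 1) \<and> cmod (x + 0) \<le> R}"
      have "AA (a, b) = ?Y - {0, -1}"
      proof -
        have "(cmod x)\<^sup>2 \<le> T \<longleftrightarrow> cmod (x + 0) \<le> R" for x
          unfolding R_def using real_sqrt_le_iff[of "(cmod x)\<^sup>2" T] by simp
        thus ?thesis unfolding AA_def S_def by auto
      qed
      moreover have "card ?Y \<le> card (?Y - {0, -1}) + card {0, -1 :: complex}"
        using diff_card_le_card_Diff[of "{0, -1 :: complex}" ?Y] by simp
      moreover have "card (?Y - {0, -1}) \<le> card ?Y" by (rule card_mono[OF fin]) auto
      moreover have "card {0, -1 :: complex} \<le> 2" by (simp add: card_insert_if)
      ultimately have dY: "\<bar>real (card (AA (a, b))) - real (card ?Y)\<bar> \<le> 2" by simp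
      have sq: "(Q / (cmod a * cmod b)) \<le> Q / (cmod a)\<^sup>2 + Q / (cmod b)\<^sup>2"
      proof -
        have "(1 / cmod a) * (1 / cmod b) \<le> (1 / cmod a)\<^sup>2 + (1 / cmod b)\<^sup>2" by (rule product_le_sum_squares)
        hence "Q * ((1 / cmod a) * (1 / cmod b)) \<le> Q * ((1 / cmod a)\<^sup>2 + (1 / cmod b)\<^sup>2)" using Q(2) by (rule mult_left_mono)
        thus ?thesis by (simp add: power_divide distrib_left)
      qed
      have "R / (cmod a * cmod b) \<le> Q / (cmod a * cmod b)" using Q by (intro divide_right_mono) auto
      hence "R / (cmod a * cmod b) + 1 \<le> ?e a b" using sq by linarith
      hence "C0 * (R / (cmod a * cmod b) + 1) \<le> C0 * ?e a b" using C0(1) by (rule mult_left_mono)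
      moreover have "\<bar>real (card ?Y) - \<kappa> * (R / (cmod a * cmod b))\<^sup>2\<bar> \<le> C0 * (R / (cmod a * cmod b) + 1)"
        unfolding \<kappa>_def by (rule C0(2)[OF pair[OF ab]]) (use R in simp)
      moreover have "\<kappa> * (R / (cmod a * cmod b))\<^sup>2 = ?m (a, b)"
        unfolding power_divide R(2) power_mult_distrib by simp
      moreover have "2 \<le> 2 * ?e a b" using e1[of a] e1[of b] by simp
      moreover have "C3 * ?e a b = C0 * ?e a b + 2 * ?e a b" unfolding C3_def by (rule distrib_right)
      ultimately show ?thesis using dY by linarith
    qed
    have s0: "\<bar>(\<Sum>p\<in>coprime_pairs Q. real (card (AA p))) - \<kappa> * T * coprime_sum Q\<bar> \<le> C3 * pair_error Q"
    proof -
      have "(\<Sum>p\<in>coprime_pairs Q. real (card (AA p))) - \<kappa> * T * coprime_sum Q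
          = (\<Sum>p\<in>coprime_pairs Q. real (card (AA p)) - ?m p)"
        unfolding coprime_sum_def sum_subtractf sum_distrib_left by (simp add: case_prod_unfold)
      also have "\<bar>\<dots>\<bar> \<le> (\<Sum>p\<in>coprime_pairs Q. \<bar>real (card (AA p)) - ?m p\<bar>)" by (rule sum_abs)
      also have "\<dots> \<le> C3 * pair_error Q"
        by (rule sum_coprime_pairs_le[OF large C34(1) Q(2)])
      finally show ?thesis .
    qed
    have "\<bar>total - 4 * (\<kappa> * T * coprime_sum Q)\<bar> \<le> (4 * C3 + 4 * C4) * pair_error Q"
      using hyp(2) s0 s1 s2 unfolding distrib_right by linarith
    moreover have "(4 * C3 + 4 * C4) * pair_error Q \<le> (4 * C3 + 4 * C4) * C2 * 8 * (T * (1 + ln T))"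
    proof -
      have "Q\<^sup>2 \<le> (2 * R)\<^sup>2" unfolding Q_def using R(1) by (intro power_mono) auto
      also have "\<dots> = 4 * T" using R(2) by (simp add: power_mult_distrib)
      finally have "C2 * Q\<^sup>2 * (1 + ln Q) \<le> C2 * (4 * T) * (2 * (1 + ln T))"
        using log_shift(1)[OF T] C2(1) T Q(1) unfolding Q_def R_def by (intro mult_mono) auto
      moreover have "C2 * (4 * T) * (2 * (1 + ln T)) = C2 * 8 * (T * (1 + ln T))" by simp
      ultimately have "pair_error Q \<le> C2 * 8 * (T * (1 + ln T))" using C2(2)[OF Q(1)] by linarith
      hence "(4 * C3 + 4 * C4) * pair_error Q \<le> (4 * C3 + 4 * C4) * (C2 * 8 * (T * (1 + ln T)))"
        using C34 by (intro mult_left_mono) auto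
      thus ?thesis by (simp only: mult.assoc)
    qed
    moreover have "\<bar>4 * (\<kappa> * T * coprime_sum Q) - 4 * \<kappa> ^ 3 * muzeta2 * T * (ln Q)\<^sup>2\<bar> \<le> 8 * \<kappa> * C1 * (T * (1 + ln T))"
    proof -
      have "4 * (\<kappa> * T * coprime_sum Q) - 4 * \<kappa> ^ 3 * muzeta2 * T * (ln Q)\<^sup>2
          = 4 * \<kappa> * T * (coprime_sum Q - \<kappa>\<^sup>2 * muzeta2 * (ln Q)\<^sup>2)"
        by (simp add: algebra_simps power2_eq_square power3_eq_cube)
      also have "\<bar>\<dots>\<bar> = 4 * \<kappa> * T * \<bar>coprime_sum Q - \<kappa>\<^sup>2 * muzeta2 * (ln Q)\<^sup>2\<bar>"
        using \<kappa> T by (simp add: abs_mult)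
      also have "\<dots> \<le> 4 * \<kappa> * T * (C1 * (1 + ln Q))"
        using C1(2)[OF Q(1)] \<kappa> T unfolding \<kappa>_def[symmetric] by (intro mult_left_mono) auto
      also have "\<dots> \<le> 4 * \<kappa> * T * (C1 * (2 * (1 + ln T)))"
        using log_shift(1)[OF T] \<kappa> T C1(1) unfolding Q_def R_def by (intro mult_left_mono) auto
      finally show ?thesis by (simp add: algebra_simps)
    qed
    moreover have "\<bar>4 * \<kappa> ^ 3 * muzeta2 * T * (ln Q)\<^sup>2 - \<kappa> ^ 3 * muzeta2 * (T * (ln T)\<^sup>2)\<bar>
        \<le> 4 * \<bar>\<kappa> ^ 3 * muzeta2\<bar> * (T * (1 + ln T))"
    proof -
      have "4 * \<kappa> ^ 3 * muzeta2 * T * (ln Q)\<^sup>2 - \<kappa> ^ 3 * muzeta2 * (T * (ln T)\<^sup>2)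
          = 4 * (\<kappa> ^ 3 * muzeta2) * (T * ((ln Q)\<^sup>2 - (ln T)\<^sup>2 / 4))" by (simp add: algebra_simps)
      also have "\<bar>\<dots>\<bar> = 4 * \<bar>\<kappa> ^ 3 * muzeta2\<bar> * (T * \<bar>(ln Q)\<^sup>2 - (ln T)\<^sup>2 / 4\<bar>)"
        using T by (simp add: abs_mult)
      also have "\<dots> \<le> 4 * \<bar>\<kappa> ^ 3 * muzeta2\<bar> * (T * (1 + ln T))"
        using log_shift(2)[OF T] T unfolding Q_def R_def by (intro mult_left_mono) auto
      finally show ?thesis .
    qed
    ultimately show ?thesis unfolding C_def S_def[symmetric] total_def[symmetric] distrib_right by linarith
  qed
  show ?thesis by (rule that[OF C main[unfolded \<kappa>_def]])
qed

end

section \<open>Imaginary quadratic fields\<close>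

lemma ring_ops [simp]:
  "carrier complex_ring = UNIV" "x \<otimes>\<^bsub>complex_ring\<^esub> y = x * y" "x \<oplus>\<^bsub>complex_ring\<^esub> y = x + y"
  "\<one>\<^bsub>complex_ring\<^esub> = 1" "\<zero>\<^bsub>complex_ring\<^esub> = 0"
  by (simp_all add: ring_of_type_algebra_def)

lemma complex_ring_ring: "ring complex_ring"
  by (rule ring_from_type_algebra)

lemma ring_minus [simp]: "\<ominus>\<^bsub>complex_ring\<^esub> x = - x"
proof -
  interpret ring complex_ring by (rule complex_ring_ring)
  show ?thesis by (rule minus_equality) simp_all
qed

text \<open>Peels off two line extensions, which yields a spanning pair; independence enters later
  through an element off the real line.\<close>

lemma dimension_2_basis:
  assumes "ring.dimension complex_ring 2 \<rat> K"
  obtains u v where "K = {a * u + b * v | a b. a \<in> \<rat> \<and> b \<in> \<rat>}"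
proof -
  interpret ring complex_ring by (rule complex_ring_ring)
  have step: "\<exists>v E'. dimension n \<rat> E' \<and> E = line_extension \<rat> v E'" if "dimension (Suc n) \<rat> E" for n E
    using that by (cases rule: dimension.cases) auto
  have zero: "E = {0}" if "dimension 0 \<rat> E" for E
    using that by (cases rule: dimension.cases) auto
  have "dimension (Suc (Suc 0)) \<rat> K" using assms by (simp add: numeral_2_eq_2)
  then obtain u E where E: "dimension (Suc 0) \<rat> E" "K = line_extension \<rat> u E" using step by blast
  then obtain v F where F: "dimension 0 \<rat> F" "E = line_extension \<rat> v F" using step by blast
  have E_iff: "x \<in> E \<longleftrightarrow> (\<exists>b\<in>\<rat>. x = b * v)" for x
    unfolding F(2) zero[OF F(1)] line_extension_mem_iff by simp
  have K_iff: "x \<in> K \<longleftrightarrow> (\<exists>a\<in>\<rat>. \<exists>e\<in>E. x = a * u + e)" for x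
    unfolding E(2) line_extension_mem_iff by simp
  have "x \<in> K \<longleftrightarrow> (\<exists>a\<in>\<rat>. \<exists>b\<in>\<rat>. x = a * u + b * v)" for x
  proof
    assume "x \<in> K"
    then obtain a e where ae: "a \<in> \<rat>" "e \<in> E" "x = a * u + e" unfolding K_iff by blast
    then obtain b where "b \<in> \<rat>" "e = b * v" unfolding E_iff by blast
    thus "\<exists>a\<in>\<rat>. \<exists>b\<in>\<rat>. x = a * u + b * v" using ae by blast
  next
    assume "\<exists>a\<in>\<rat>. \<exists>b\<in>\<rat>. x = a * u + b * v"
    then obtain a b where ab: "a \<in> \<rat>" "b \<in> \<rat>" "x = a * u + b * v" by blast
    have "b * v \<in> E" unfolding E_iff using ab by blast
    thus "x \<in> K" unfolding K_iff using ab by blast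
  qed
  hence "K = {a * u + b * v | a b. a \<in> \<rat> \<and> b \<in> \<rat>}" by blast
  thus ?thesis by (rule that)
qed

lemma subfield_complexD:
  assumes "subfield K complex_ring"
  shows "1 \<in> K" "\<And>x y. x \<in> K \<Longrightarrow> y \<in> K \<Longrightarrow> x * y \<in> K"
proof -
  interpret ring complex_ring by (rule complex_ring_ring)
  note E = subringE[OF subfieldE(1)[OF assms]]
  show "1 \<in> K" using E(3) by simp
  show "x * y \<in> K" if "x \<in> K" "y \<in> K" for x y using E(6)[OF that] by simp
qed

text \<open>Here \<open>\<i> y\<close> is a square root of a negative rational that generates the field.\<close>

lemma imaginary_quadratic_shape:
  assumes "imaginary_quadratic_field K"
  obtains y where "y > 0" "y\<^sup>2 \<in> \<rat>" "K = {z. Re z \<in> \<rat> \<and> Im z / y \<in> \<rat>}"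
proof -
  have sf: "subfield K complex_ring" and dim: "ring.dimension complex_ring 2 \<rat> K" and nr: "\<not> K \<subseteq> \<real>"
    using assms unfolding imaginary_quadratic_field_def by auto
  obtain u v where uv: "K = {a * u + b * v | a b. a \<in> \<rat> \<and> b \<in> \<rat>}" using dim by (rule dimension_2_basis)
  have KI: "a * u + b * v \<in> K" if "a \<in> \<rat>" "b \<in> \<rat>" for a b using that unfolding uv by blast
  have KE: "\<exists>a b. x = a * u + b * v \<and> a \<in> \<rat> \<and> b \<in> \<rat>" if "x \<in> K" for x using that unfolding uv by blast
  obtain \<theta> where \<theta>: "\<theta> \<in> K" "\<theta> \<notin> \<real>" using nr by blast
  obtain a1 b1 where 1: "1 = a1 * u + b1 * v" "a1 \<in> \<rat>" "b1 \<in> \<rat>" using KE[OF subfield_complexD(1)[OF sf]] by metis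
  obtain a2 b2 where 2: "\<theta> = a2 * u + b2 * v" "a2 \<in> \<rat>" "b2 \<in> \<rat>" using KE[OF \<theta>(1)] by metis
  \<comment> \<open>Determinant of 1, \<theta> in terms of u, v. It is nonzero since \<theta> is not
    real, and Cramer's rule then expresses K through 1 and \<theta>.\<close>
  define \<Delta> where "\<Delta> = a1 * b2 - a2 * b1"
  have u\<Delta>: "\<Delta> * u = b2 - b1 * \<theta>"
  proof -
    have "b2 - b1 * \<theta> = b2 * (a1 * u + b1 * v) - b1 * (a2 * u + b2 * v)" unfolding 1(1)[symmetric] 2(1)[symmetric] by simp
    thus ?thesis unfolding \<Delta>_def by (simp add: algebra_simps)
  qed
  have v\<Delta>: "\<Delta> * v = a1 * \<theta> - a2"
  proof -
    have "a1 * \<theta> - a2 = a1 * (a2 * u + b2 * v) - a2 * (a1 * u + b1 * v)" unfolding 1(1)[symmetric] 2(1)[symmetric] by simp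
    thus ?thesis unfolding \<Delta>_def by (simp add: algebra_simps)
  qed
  have of_rat_real: "(of_rat r :: complex) = of_real (of_rat r)" for r
    by (cases r) (simp add: of_rat_rat)
  have QR: "x \<in> \<real>" if "x \<in> \<rat>" for x :: complex using that of_rat_real by (metis Rats_cases Reals_of_real)
  have indep: "q = 0" if "q \<in> \<rat>" "p \<in> \<rat>" "p = q * \<theta>" for p q
  proof (rule ccontr)
    assume "q \<noteq> 0"
    hence "\<theta> = p / q" using that by simp
    also have "p / q \<in> \<rat>" using that(2,1) by (rule Rats_divide)
    finally have "\<theta> \<in> \<rat>" .
    thus False using \<theta>(2) QR by blast
  qed
  have \<Delta>0: "\<Delta> \<noteq> 0"
  proof
    assume z: "\<Delta> = 0"
    have "b1 = 0" by (rule indep[OF 1(3) 2(3)]) (use u\<Delta> z in simp)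
    moreover have "a1 = 0" by (rule indep[OF 1(2) 2(2)]) (use v\<Delta> z in simp)
    ultimately show False using 1(1) by simp
  qed
  have \<Delta>Q: "\<Delta> \<in> \<rat>" unfolding \<Delta>_def using 1 2 by simp
  have span: "\<exists>p q. x = p + q * \<theta> \<and> p \<in> \<rat> \<and> q \<in> \<rat>" if "x \<in> K" for x
  proof -
    obtain a b where ab: "x = a * u + b * v" "a \<in> \<rat>" "b \<in> \<rat>" using KE[OF \<open>x \<in> K\<close>] by metis
    have "\<Delta> * x = a * (\<Delta> * u) + b * (\<Delta> * v)" unfolding ab(1) by (simp add: algebra_simps)
    also have "\<dots> = (a * b2 - b * a2) + (b * a1 - a * b1) * \<theta>" unfolding u\<Delta> v\<Delta> by (simp add: algebra_simps)
    finally have "x = ((a * b2 - b * a2) + (b * a1 - a * b1) * \<theta>) / \<Delta>" using \<Delta>0 by (simp add: eq_divide_eq mult.commute)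
    hence "x = (a * b2 - b * a2) / \<Delta> + ((b * a1 - a * b1) / \<Delta>) * \<theta>" by (simp add: add_divide_distrib)
    moreover have "(a * b2 - b * a2) / \<Delta> \<in> \<rat>" "(b * a1 - a * b1) / \<Delta> \<in> \<rat>" using ab 1 2 \<Delta>Q by simp_all
    ultimately show ?thesis by blast
  qed
  have comb: "p + q * \<theta> \<in> K" if "p \<in> \<rat>" "q \<in> \<rat>" for p q
  proof -
    have "p + q * \<theta> = p * (a1 * u + b1 * v) + q * (a2 * u + b2 * v)" unfolding 1(1)[symmetric] 2(1)[symmetric] by simp
    also have "\<dots> = (p * a1 + q * a2) * u + (p * b1 + q * b2) * v" by (simp add: algebra_simps)
    finally show ?thesis using KI[of "p * a1 + q * a2" "p * b1 + q * b2"] that 1 2 by simp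
  qed
  obtain p q where pq: "\<theta> * \<theta> = p + q * \<theta>" "p \<in> \<rat>" "q \<in> \<rat>"
    using span[OF subfield_complexD(2)[OF sf \<theta>(1) \<theta>(1)]] by metis
  obtain p' q' :: rat where p': "p = of_rat p'" and q': "q = of_rat q'" using pq(2,3) by (auto elim!: Rats_cases)

  \<comment> \<open>Completing the square in \<theta>^2 = p + q \<theta>: \<delta> = \<theta> - q /
    2 has a rational square and is not real, hence is purely imaginary. Its imaginary part gives y
    up to sign.\<close>
  define h where "h = real_of_rat q' / 2"
  have hQ: "h \<in> \<rat>" unfolding h_def by simp
  define \<delta> where "\<delta> = \<theta> - of_real h"
  define c where "c = real_of_rat p' + h\<^sup>2"
  have \<delta>2: "\<delta> * \<delta> = of_real c"
  proof -
    have "q = of_real (2 * h)" unfolding q' h_def of_rat_real by simp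
    hence "\<theta> * \<theta> = of_real (real_of_rat p') + of_real (2 * h) * \<theta>" using pq(1) unfolding p' of_rat_real by simp
    thus ?thesis unfolding \<delta>_def c_def by (simp add: algebra_simps power2_eq_square)
  qed
  have \<delta>Im: "Im \<delta> \<noteq> 0" unfolding \<delta>_def using \<theta>(2) by (simp add: complex_is_Real_iff)
  have "Im (\<delta> * \<delta>) = 0" unfolding \<delta>2 by simp
  hence \<delta>Re: "Re \<delta> = 0" using \<delta>Im by simp
  have "Re (\<delta> * \<delta>) = c" unfolding \<delta>2 by simp
  hence cy: "(Im \<delta>)\<^sup>2 = - c" using \<delta>Re by (simp add: power2_eq_square)
  have \<theta>Re: "Re \<theta> = h" and \<theta>Im: "Im \<theta> = Im \<delta>" using \<delta>Re unfolding \<delta>_def by simp_all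
  define y where "y = \<bar>Im \<delta>\<bar>"
  have y: "y > 0" "y\<^sup>2 \<in> \<rat>" unfolding y_def using \<delta>Im cy c_def hQ by simp_all
  have sgn: "r * Im \<delta> / y \<in> \<rat> \<longleftrightarrow> r \<in> \<rat>" for r
    unfolding y_def using \<delta>Im by (cases "Im \<delta> > 0") auto
  have "K = {z. Re z \<in> \<rat> \<and> Im z / y \<in> \<rat>}"
  proof (intro equalityI subsetI)
    fix z assume "z \<in> K"
    then obtain a b where z: "z = a + b * \<theta>" "a \<in> \<rat>" "b \<in> \<rat>" using span by metis
    obtain a' b' :: rat where ab: "a = of_rat a'" "b = of_rat b'" using z(2,3) by (auto elim!: Rats_cases)
    have "Re z = real_of_rat a' + real_of_rat b' * h" "Im z = real_of_rat b' * Im \<delta>"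
      unfolding z(1) ab of_rat_real using \<theta>Re \<theta>Im by simp_all
    thus "z \<in> {z. Re z \<in> \<rat> \<and> Im z / y \<in> \<rat>}" using sgn[of "real_of_rat b'"] hQ by simp
  next
    fix z assume z: "z \<in> {z. Re z \<in> \<rat> \<and> Im z / y \<in> \<rat>}"
    define b where "b = Im z / Im \<delta>"
    have "b * Im \<delta> / y \<in> \<rat>" using z \<delta>Im unfolding b_def by simp
    hence b: "b \<in> \<rat>" unfolding sgn .
    define a where "a = Re z - b * h"
    have a: "a \<in> \<rat>" unfolding a_def using z b hQ by simp
    have "z = of_real a + of_real b * \<theta>"
      using \<theta>Re \<theta>Im \<delta>Im unfolding a_def b_def by (simp add: complex_eq_iff)
    moreover have "complex_of_real a \<in> \<rat>" "complex_of_real b \<in> \<rat>" using a b by (auto elim!: Rats_cases)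
    ultimately show "z \<in> K" using comb by metis
  qed
  thus ?thesis using that y by blast
qed

section \<open>Integral elements of an imaginary quadratic field\<close>

lemma rational_bounded_powers:
  assumes N: "N \<in> \<rat>" and m: "(m::int) > 0" and bd: "\<And>k. of_int m * (N::real) ^ k \<in> \<int>"
  shows "N \<in> \<int>"
proof -
  obtain a b where ab: "b > 0" "Rings.coprime a b" "N = of_int a / of_int b" using N by (auto elim: Rats_cases')
  \<comment> \<open>In lowest terms b^k is coprime to a^k and divides m a^k, so every power of b
    divides m.\<close>
  have "b ^ k \<le> m" for k
  proof -
    obtain c where "of_int m * N ^ k = of_int c" using bd[of k] by (elim Ints_cases)
    hence "real_of_int m * of_int a ^ k = of_int c * of_int b ^ k"
      unfolding ab(3) using ab(1) by (simp add: power_divide field_simps)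
    hence "m * a ^ k = c * b ^ k" by (metis of_int_eq_iff of_int_mult of_int_power)
    hence "b ^ k dvd m * a ^ k" by simp
    moreover have "Rings.coprime (b ^ k) (a ^ k)" using ab(2) by (simp add: coprime_commute)
    ultimately have "b ^ k dvd m" by (simp add: coprime_dvd_mult_left_iff)
    thus ?thesis using m by (rule zdvd_imp_le)
  qed
  note le = this
  have "b = 1"
  proof (rule ccontr)
    assume "b \<noteq> 1"
    hence b: "b \<ge> 2" using ab(1) by simp
    have "int (nat m) < 2 ^ nat m" by (rule of_nat_less_two_power)
    also have "(2::int) ^ nat m \<le> b ^ nat m" using b by (intro power_mono) auto
    also have "\<dots> \<le> m" by (rule le)
    finally show False using m by simp
  qed
  thus ?thesis using ab(3) by simp
qed

lemma quadratic_algebraic_int: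
  assumes "x * x - of_int t * x + of_int n = (0::complex)" shows "algebraic_int x"
proof (rule algebraic_int.intros)
  let ?p = "[:of_int n, - of_int t, 1:] :: complex poly"
  show "Polynomial.coeff ?p (Polynomial.degree ?p) = 1" by simp
  show "\<forall>i. Polynomial.coeff ?p i \<in> \<int>" by (auto simp: coeff_pCons split: nat.splits)
  show "poly ?p x = 0" using assms by (simp add: algebra_simps)
qed

context
  fixes y :: real
  assumes y: "y > 0" "y\<^sup>2 \<in> \<rat>"
begin

text \<open>The field itself, and the lattice \<int> + \<int> \<i> y in it. The lattice only
  measures denominators: \<i> y need not be an algebraic integer.\<close>

abbreviation (input) "rat_span \<equiv> {z. Re z \<in> \<rat> \<and> Im z / y \<in> \<rat>}"
abbreviation (input) "int_span \<equiv> {z. Re z \<in> \<int> \<and> Im z / y \<in> \<int>}"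

lemma rat_span_arith:
  assumes "z \<in> rat_span" "z' \<in> rat_span"
  shows "z + z' \<in> rat_span" "z * z' \<in> rat_span" "cnj z \<in> rat_span"
proof -
  have "Re (z * z') = Re z * Re z' - (Im z / y) * (Im z' / y) * y\<^sup>2"
    using y by (simp add: power2_eq_square)
  moreover have "Im (z * z') / y = Re z * (Im z' / y) + (Im z / y) * Re z'"
    using y by (simp add: add_divide_distrib)
  moreover have "Re z * Re z' - (Im z / y) * (Im z' / y) * y\<^sup>2 \<in> \<rat>" "Re z * (Im z' / y) + (Im z / y) * Re z' \<in> \<rat>"
    using assms y(2) by (intro Rats_diff Rats_add Rats_mult; simp)+
  ultimately show "z * z' \<in> rat_span" by (simp only: mem_Collect_eq simp_thms)
  show "z + z' \<in> rat_span" "cnj z \<in> rat_span" using assms by (simp_all add: add_divide_distrib)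
qed

lemma rat_span_denominator:
  assumes "z \<in> rat_span" obtains D :: int where "D > 0" "of_int D * z \<in> int_span"
proof -
  obtain a b where ab: "b > 0" "Re z = of_int a / of_int b" using assms by (auto elim: Rats_cases')
  obtain c d where cd: "d > 0" "Im z / y = of_int c / of_int d" using assms by (auto elim: Rats_cases')
  have "Re (of_int (b * d) * z) = of_int (d * a)" "Im (of_int (b * d) * z) / y = of_int (b * c)"
  proof -
    have "real_of_int b \<noteq> 0" "real_of_int d \<noteq> 0" using ab cd by simp_all
    moreover have "Im (of_int (b * d) * z) / y = of_int (b * d) * (Im z / y)" by simp
    ultimately show "Re (of_int (b * d) * z) = of_int (d * a)" "Im (of_int (b * d) * z) / y = of_int (b * c)"
      using ab(2) cd(2) by simp_all
  qed
  hence "of_int (b * d) * z \<in> int_span" by (metis (mono_tags, lifting) Ints_of_int mem_Collect_eq)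
  thus ?thesis using that[of "b * d"] ab cd by simp
qed

lemma int_span_arith:
  assumes "z \<in> int_span" "z' \<in> int_span"
  shows "z + z' \<in> int_span" "of_int k * z \<in> int_span"
  using assms by (simp_all add: add_divide_distrib flip: times_divide_eq_right)

lemma int_span_sum: "finite A \<Longrightarrow> (\<And>i. i \<in> A \<Longrightarrow> f i \<in> int_span) \<Longrightarrow> sum f A \<in> int_span"
proof (induction A rule: finite_induct)
  case (insert i A)
  thus ?case using int_span_arith(1)[of "f i" "sum f A"] by simp
qed simp

text \<open>Integrality as bounded denominators of all powers: the monic equation reduces every
  power to the first n, whose denominators have a common multiple.\<close>

lemma algebraic_int_denominator:
  assumes x: "x \<in> rat_span" "algebraic_int x"
  obtains D :: int where "D > 0" "\<And>k. of_int D * x ^ k \<in> int_span"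
proof -
  obtain p where p: "Polynomial.coeff p (Polynomial.degree p) = 1" "\<forall>i. Polynomial.coeff p i \<in> \<int>" "poly p x = 0"
    using x(2) by (auto elim: algebraic_int.cases)
  define n where "n = Polynomial.degree p"
  have powers: "x ^ k \<in> rat_span" for k
  proof (induction k)
    case (Suc k) thus ?case using rat_span_arith(2)[OF x(1), of "x ^ k"] by simp
  qed simp
  have "\<forall>i. \<exists>D::int. D > 0 \<and> of_int D * x ^ i \<in> int_span"
    using rat_span_denominator[OF powers] by metis
  then obtain d :: "nat \<Rightarrow> int" where d: "\<And>i. d i > 0" "\<And>i. of_int (d i) * x ^ i \<in> int_span" by metis
  define D where "D = (\<Prod>i<n. d i)"
  have D: "D > 0" unfolding D_def using d(1) by (intro prod_pos) auto
  have small: "of_int D * x ^ i \<in> int_span" if i: "i < n" for i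
  proof -
    have "D = (\<Prod>j\<in>{..<n} - {i}. d j) * d i" unfolding D_def using i by (subst prod.remove[of _ i]) (auto simp: mult.commute)
    hence "of_int D * x ^ i = of_int (\<Prod>j\<in>{..<n} - {i}. d j) * (of_int (d i) * x ^ i)" by simp
    thus ?thesis using int_span_arith(2)[OF d(2) d(2)] by metis
  qed
  have xn: "x ^ n = - (\<Sum>i<n. Polynomial.coeff p i * x ^ i)"
  proof -
    have "poly p x = (\<Sum>i\<le>n. Polynomial.coeff p i * x ^ i)" unfolding n_def by (rule poly_altdef)
    also have "\<dots> = (\<Sum>i<n. Polynomial.coeff p i * x ^ i) + x ^ n"
      using p(1) unfolding n_def by (simp add: lessThan_Suc_atMost[symmetric])
    finally show ?thesis using p(3) by (simp add: eq_neg_iff_add_eq_0 add.commute)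
  qed
  have "of_int D * x ^ k \<in> int_span" for k
  proof (induction k rule: less_induct)
    case (less k)
    show ?case
    proof (cases "k < n")
      case True thus ?thesis by (rule small)
    next
      case False
      have "x ^ k = x ^ (k - n) * x ^ n" using False by (simp flip: power_add)
      hence eq: "of_int D * x ^ k = (\<Sum>i<n. - Polynomial.coeff p i * (of_int D * x ^ (k - n + i)))"
        unfolding xn by (simp add: sum_distrib_left sum_negf power_add algebra_simps)
      have mem: "- Polynomial.coeff p i * (of_int D * x ^ (k - n + i)) \<in> int_span" if i: "i \<in> {..<n}" for i
      proof -
        obtain c where c: "Polynomial.coeff p i = of_int c" using p(2) by (metis Ints_cases)
        have "k - n + i < k" using False i by simp
        hence h: "of_int D * x ^ (k - n + i) \<in> int_span" by (rule less.IH)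
        have "- Polynomial.coeff p i = of_int (- c)" unfolding c by simp
        thus ?thesis using int_span_arith(2)[OF h h, of "- c"] by metis
      qed
      show ?thesis unfolding eq by (rule int_span_sum[OF finite_lessThan mem])
    qed
  qed
  thus ?thesis using that D by blast
qed

text \<open>The powers of the norm have a common denominator too: D^2 from D z^k and its conjugate,
  and e from y^2.\<close>

lemma bounded_denominator_norm_int:
  assumes z: "z \<in> rat_span" and D: "(D::int) > 0" "\<And>k. of_int D * z ^ k \<in> int_span"
  shows "(cmod z)\<^sup>2 \<in> \<int>"
proof -
  obtain a e where ae: "e > 0" "y\<^sup>2 = of_int a / of_int e" using y(2) by (auto elim: Rats_cases')
  have zy: "(cmod z)\<^sup>2 = (Re z)\<^sup>2 + (Im z / y)\<^sup>2 * y\<^sup>2" using y(1) by (simp add: cmod_power2 power_divide)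
  show ?thesis
  proof (rule rational_bounded_powers[of _ "e * (D * D)"])
    show "(cmod z)\<^sup>2 \<in> \<rat>" unfolding zy using z y(2) by simp
    show "e * (D * D) > 0" using ae D by simp
    fix k
    let ?v = "of_int D * z ^ k"
    have v: "Re ?v \<in> \<int>" "Im ?v / y \<in> \<int>" using D(2)[of k] by blast+
    obtain b where b: "Re ?v = of_int b" using v(1) by (rule Ints_cases)
    obtain c where c: "Im ?v / y = of_int c" using v(2) by (rule Ints_cases)
    have "of_int D * of_int D * ((cmod z)\<^sup>2) ^ k = (cmod ?v)\<^sup>2"
      by (simp add: norm_mult norm_power power_mult_distrib power2_eq_square mult_ac)
    also have "\<dots> = (Re ?v)\<^sup>2 + (Im ?v / y)\<^sup>2 * y\<^sup>2" using y(1) by (simp add: cmod_power2 power_divide)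
    also have "\<dots> = (of_int b)\<^sup>2 + (of_int c)\<^sup>2 * (of_int a / of_int e)" unfolding b c ae(2) ..
    finally have eq: "of_int D * of_int D * ((cmod z)\<^sup>2) ^ k = (of_int b)\<^sup>2 + (of_int c)\<^sup>2 * (of_int a / of_int e)" .
    have "of_int (e * (D * D)) * ((cmod z)\<^sup>2) ^ k = of_int e * (of_int D * of_int D * ((cmod z)\<^sup>2) ^ k)" by simp
    also have "\<dots> = of_int (e * b\<^sup>2 + c\<^sup>2 * a)" unfolding eq using ae(1) by (simp add: distrib_left)
    finally have "of_int (e * (D * D)) * ((cmod z)\<^sup>2) ^ k = of_int (e * b\<^sup>2 + c\<^sup>2 * a)" .
    thus "of_int (e * (D * D)) * ((cmod z)\<^sup>2) ^ k \<in> \<int>" by (metis Ints_of_int)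
  qed
qed

text \<open>The trace comes from two norms, 2 Re x = |x + 1|^2 - |x|^2 - 1, once x + 1 is seen to
  have bounded denominators as well.\<close>

lemma algebraic_int_norm_trace:
  assumes x: "x \<in> rat_span" "algebraic_int x"
  shows "(cmod x)\<^sup>2 \<in> \<int>" "2 * Re x \<in> \<int>"
proof -
  obtain D :: int where D: "D > 0" "\<And>k. of_int D * x ^ k \<in> int_span" using algebraic_int_denominator[OF x] by blast
  show 1: "(cmod x)\<^sup>2 \<in> \<int>" by (rule bounded_denominator_norm_int[OF x(1) D])
  have "of_int D * (x ^ j * (x + 1) ^ k) \<in> int_span" for j k
  proof (induction k arbitrary: j)
    case 0 show ?case using D(2)[of j] by simp
  next
    case (Suc k)
    have "of_int D * (x ^ j * (x + 1) ^ Suc k) = of_int D * (x ^ Suc j * (x + 1) ^ k) + of_int D * (x ^ j * (x + 1) ^ k)"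
      by (simp add: algebra_simps)
    thus ?case using int_span_arith(1)[OF Suc.IH Suc.IH] by metis
  qed
  from this[of 0] have "of_int D * (x + 1) ^ k \<in> int_span" for k by simp
  moreover have "x + 1 \<in> rat_span" using x(1) by simp
  ultimately have "(cmod (x + 1))\<^sup>2 \<in> \<int>" by (intro bounded_denominator_norm_int[OF _ D(1)])
  moreover have "(cmod (x + 1))\<^sup>2 = (cmod x)\<^sup>2 + (2 * Re x + 1)"
    unfolding cmod_power2 by (simp add: power2_eq_square algebra_simps)
  ultimately have "(cmod x)\<^sup>2 + (2 * Re x + 1) - (cmod x)\<^sup>2 - 1 \<in> \<int>" using 1 by (metis Ints_1 Ints_diff)
  thus "2 * Re x \<in> \<int>" by simp
qed

lemma algebraic_int_iff:
  assumes x: "x \<in> rat_span"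
  shows "algebraic_int x \<longleftrightarrow> (cmod x)\<^sup>2 \<in> \<int> \<and> 2 * Re x \<in> \<int>"
proof
  assume "(cmod x)\<^sup>2 \<in> \<int> \<and> 2 * Re x \<in> \<int>"
  then obtain n t where nt: "(cmod x)\<^sup>2 = of_int n" "2 * Re x = of_int t" by (auto elim!: Ints_cases)
  have "x * cnj x = of_real ((cmod x)\<^sup>2)" by (simp only: complex_norm_square)
  hence n: "x * cnj x = of_int n" unfolding nt by simp
  have "x + cnj x = of_real (2 * Re x)" by (simp add: complex_add_cnj)
  hence t: "x + cnj x = of_int t" unfolding nt by simp
  show "algebraic_int x"
    by (rule quadratic_algebraic_int[of _ t n]) (simp add: algebra_simps flip: n t)
qed (use algebraic_int_norm_trace[OF x] in blast)

end

lemma integers_of_iff: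
  assumes y: "y > 0" "y\<^sup>2 \<in> \<rat>" and K: "K = {z. Re z \<in> \<rat> \<and> Im z / y \<in> \<rat>}"
  shows "x \<in> integers_of K \<longleftrightarrow> x \<in> K \<and> (cmod x)\<^sup>2 \<in> \<int> \<and> 2 * Re x \<in> \<int>"
  unfolding integers_of_def using algebraic_int_iff[OF y, of x] unfolding K by blast

text \<open>
  The point is that \<open>x z' + x' z\<close> (a prime denotes conjugation) is an integer: it is a rational root of a
  monic integer quadratic, whose other root is \<open>x z + x' z'\<close>.
\<close>

lemma integers_of_add:
  assumes y: "y > 0" "y\<^sup>2 \<in> \<rat>" and K: "K = {z. Re z \<in> \<rat> \<and> Im z / y \<in> \<rat>}"
    and x: "x \<in> integers_of K" and z: "z \<in> integers_of K"
  shows "x + z \<in> integers_of K"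
proof -
  note iff = integers_of_iff[OF y K]
  have xK: "x \<in> K" and zK: "z \<in> K" using x z iff by blast+
  obtain n where n: "(cmod x)\<^sup>2 = of_int n" using x iff by (metis Ints_cases)
  obtain t where t: "2 * Re x = of_int t" using x iff by (metis Ints_cases)
  obtain m where m: "(cmod z)\<^sup>2 = of_int m" using z iff by (metis Ints_cases)
  obtain s where s: "2 * Re z = of_int s" using z iff by (metis Ints_cases)
  define p where "p = 2 * (Re x * Re z + Im x * Im z)"
  define q where "q = 2 * (Re x * Re z - Im x * Im z)"
  have pq: "p + q = of_int (t * s)"
  proof -
    have "p + q = (2 * Re x) * (2 * Re z)" unfolding p_def q_def by (simp add: algebra_simps)
    thus ?thesis unfolding t s by simp
  qed
  \<comment> \<open>With n, m the norms and t, s the traces of x and z, the product is m (x^2 +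
    x'^2) + n (z^2 + z'^2) = m (t^2 - 2 n) + n (s^2 - 2 m).\<close>
  have "p * q = of_int (t * t * m + s * s * n - 4 * (n * m))"
  proof -
    have "p * q = (2 * Re x) * (2 * Re x) * ((Re z)\<^sup>2 + (Im z)\<^sup>2) + (2 * Re z) * (2 * Re z) * ((Re x)\<^sup>2 + (Im x)\<^sup>2)
        - 4 * (((Re x)\<^sup>2 + (Im x)\<^sup>2) * ((Re z)\<^sup>2 + (Im z)\<^sup>2))"
      unfolding p_def q_def by (simp add: algebra_simps power2_eq_square)
    thus ?thesis unfolding t s cmod_power2[symmetric] n m by simp
  qed
  note prod = this
  have "of_real p * of_real p - of_int (t * s) * of_real p + of_int (t * t * m + s * s * n - 4 * (n * m)) = (0 :: complex)"
  proof -
    have "p * p - (p + q) * p + p * q = 0" by (simp add: algebra_simps)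
    hence "p * p - of_int (t * s) * p + of_int (t * t * m + s * s * n - 4 * (n * m)) = 0" unfolding pq prod .
    hence "complex_of_real (p * p - of_int (t * s) * p + of_int (t * t * m + s * s * n - 4 * (n * m))) = of_real 0" by (rule arg_cong)
    thus ?thesis by simp
  qed
  hence "algebraic_int (complex_of_real p)" by (rule quadratic_algebraic_int)
  hence "algebraic_int p" by simp
  moreover have "p \<in> \<rat>"
  proof -
    define r where "r = Re x * Re z + (Im x / y) * (Im z / y) * y\<^sup>2"
    have "p = 2 * r" unfolding p_def r_def using y(1) by (simp add: power2_eq_square)
    moreover have "r \<in> \<rat>"
      unfolding r_def using xK zK y(2) unfolding K by (intro Rats_add Rats_mult; simp)
    ultimately show ?thesis by simp
  qed
  ultimately have p: "p \<in> \<int>" by (rule rational_algebraic_int_is_int)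
  have "(cmod (x + z))\<^sup>2 = of_int n + of_int m + p"
    unfolding n[symmetric] m[symmetric] p_def cmod_power2 by (simp add: power2_eq_square algebra_simps)
  hence "(cmod (x + z))\<^sup>2 \<in> \<int>" using p by simp
  moreover have "2 * Re (x + z) = of_int (t + s)" using t s by simp
  hence "2 * Re (x + z) \<in> \<int>" by (metis Ints_of_int)
  moreover have "x + z \<in> K" using rat_span_arith(1)[OF y, of x z] xK zK unfolding K by blast
  ultimately show ?thesis using iff by blast
qed

text \<open>\<open>w\<close> is an integer of least positive imaginary part; it exists because 4 (Im
  x)^2 = 4 |x|^2 - (2 Re x)^2 is a natural number. Subtracting multiples of \<open>w\<close> leaves
  an integer that is rational, hence in \<int>.\<close>

lemma integers_of_lattice:
  assumes "imaginary_quadratic_field K"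
  obtains w tw nw y where "imag_quadratic w tw nw" "integers_of K = imag_quadratic.Ok w"
    "y > 0" "y\<^sup>2 \<in> \<rat>" "K = {z. Re z \<in> \<rat> \<and> Im z / y \<in> \<rat>}"
proof -
  obtain y where y: "y > 0" "y\<^sup>2 \<in> \<rat>" and K: "K = {z. Re z \<in> \<rat> \<and> Im z / y \<in> \<rat>}"
    using imaginary_quadratic_shape[OF assms] by blast
  let ?O = "integers_of K"
  note iff = integers_of_iff[OF y K] and add = integers_of_add[OF y K]
  have int: "of_int k \<in> ?O" for k unfolding iff unfolding K by (simp add: norm_of_int)
  have minus: "- x \<in> ?O" if "x \<in> ?O" for x using that unfolding iff unfolding K by simp
  have natmult: "of_nat k * x \<in> ?O" if "x \<in> ?O" for k x
  proof (induction k)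
    case 0 show ?case using int[of 0] by simp
  next
    case (Suc k) show ?case using add[OF that Suc.IH] by (simp add: algebra_simps)
  qed
  have intmult: "of_int k * x \<in> ?O" if "x \<in> ?O" for k x
    using natmult[OF that, of "nat k"] minus[OF natmult[OF that, of "nat (- k)"]] by (cases "k \<ge> 0") auto
  have im: "\<exists>k. 4 * (Im x)\<^sup>2 = of_int k" if x: "x \<in> ?O" for x
  proof -
    obtain n where n: "(cmod x)\<^sup>2 = of_int n" using x iff by (metis Ints_cases)
    obtain t where t: "2 * Re x = of_int t" using x iff by (metis Ints_cases)
    have "4 * (Im x)\<^sup>2 = 4 * (cmod x)\<^sup>2 - (2 * Re x)\<^sup>2" unfolding cmod_power2 by (simp add: power2_eq_square)
    also have "\<dots> = of_int (4 * n - t\<^sup>2)" unfolding n t by simp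
    finally show ?thesis by blast
  qed
  define P where "P = (\<lambda>k::nat. \<exists>x\<in>?O. Im x > 0 \<and> 4 * (Im x)\<^sup>2 = real k)"
  have "\<exists>k. P k"
  proof -
    obtain a e where ae: "e > 0" "y\<^sup>2 = of_int a / of_int e" using y(2) by (auto elim: Rats_cases')
    \<comment> \<open>Clearing the denominator of y^2 makes e \<i> y integral: trace 0, norm e
      a.\<close>
    define x where "x = Complex 0 (of_int e * y)"
    have "(cmod x)\<^sup>2 = of_int (e * a)" unfolding x_def cmod_power2 using ae by (simp add: power_mult_distrib power2_eq_square[of "of_int e"])
    hence "(cmod x)\<^sup>2 \<in> \<int>" by (metis Ints_of_int)
    hence xO: "x \<in> ?O" unfolding iff unfolding K x_def using y by simp
    moreover have "Im x > 0" unfolding x_def using ae y by simp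
    moreover obtain k where k: "4 * (Im x)\<^sup>2 = of_int k" using im[OF xO] by blast
    hence "k \<ge> 0" by (metis of_int_0_le_iff zero_le_mult_iff zero_le_numeral zero_le_power2)
    hence "4 * (Im x)\<^sup>2 = real (nat k)" using k by simp
    ultimately show ?thesis unfolding P_def by blast
  qed
  hence PL: "P (LEAST k. P k)" by (rule LeastI_ex)
  then obtain w where w: "w \<in> ?O" "Im w > 0" "4 * (Im w)\<^sup>2 = real (LEAST k. P k)" unfolding P_def by blast
  have minimal: "Im w \<le> Im x" if x: "x \<in> ?O" "Im x > 0" for x
  proof -
    obtain k where k: "4 * (Im x)\<^sup>2 = of_int k" using im[OF x(1)] by blast
    hence "k \<ge> 0" by (metis of_int_0_le_iff zero_le_mult_iff zero_le_numeral zero_le_power2)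
    hence "4 * (Im x)\<^sup>2 = real (nat k)" using k by simp
    hence "P (nat k)" unfolding P_def using x by blast
    hence "(LEAST k. P k) \<le> nat k" by (rule Least_le)
    hence "4 * (Im w)\<^sup>2 \<le> 4 * (Im x)\<^sup>2" unfolding w(3) \<open>4 * (Im x)\<^sup>2 = real (nat k)\<close> by simp
    hence "(Im w)\<^sup>2 \<le> (Im x)\<^sup>2" by simp
    thus ?thesis by (rule power2_le_imp_le) (use x(2) in simp)
  qed
  have lattice: "\<exists>a b. x = of_int a + of_int b * w" if x: "x \<in> ?O" for x
  proof -
    define b where "b = \<lfloor>Im x / Im w\<rfloor>"
    define x' where "x' = x + of_int (- b) * w"
    have x'O: "x' \<in> ?O" unfolding x'_def by (rule add[OF x intmult[OF w(1)]])
    have "of_int b \<le> Im x / Im w" "Im x / Im w < of_int b + 1" unfolding b_def by linarith+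
    hence "of_int b * Im w \<le> Im x" "Im x < (of_int b + 1) * Im w" using w(2) by (simp_all add: le_divide_eq divide_less_eq)
    hence "0 \<le> Im x'" "Im x' < Im w" unfolding x'_def by (simp_all add: algebra_simps)
    hence "Im x' = 0" using minimal[OF x'O] by fastforce
    hence xr: "x' = of_real (Re x')" by (simp add: complex_eq_iff)
    have "algebraic_int x'" using x'O unfolding integers_of_def by simp
    hence "algebraic_int (Re x')" using xr by (metis algebraic_int_of_real_iff)
    moreover have "Re x' \<in> \<rat>" using x'O iff unfolding K by blast
    ultimately have "Re x' \<in> \<int>" by (rule rational_algebraic_int_is_int)
    then obtain a where "Re x' = of_int a" by (rule Ints_cases)
    hence "x' = of_int a" using xr by simp
    hence "x = of_int a + of_int b * w" unfolding x'_def by (simp add: algebra_simps)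
    thus ?thesis by blast
  qed
  obtain nw where nw: "(cmod w)\<^sup>2 = of_int nw" using w(1) iff by (metis Ints_cases)
  obtain tw where tw: "2 * Re w = of_int tw" using w(1) iff by (metis Ints_cases)
  have loc: "imag_quadratic w tw nw"
  proof
    show "Im w > 0" by (rule w(2))
    have "w + cnj w = of_real (2 * Re w)" by (simp add: complex_add_cnj)
    thus "w + cnj w = of_int tw" unfolding tw by simp
    have "w * cnj w = of_real ((cmod w)\<^sup>2)" by (simp only: complex_norm_square)
    thus "w * cnj w = of_int nw" unfolding nw by simp
  next
    \<comment> \<open>Maximality: x lies in K since k x does, and integral trace and norm then put
      it among the integers of K.\<close>
    fix x :: complex and k a b :: int
    assume k: "k \<noteq> 0" "of_int k * x = of_int a + of_int b * w" and t: "x + cnj x \<in> \<int>" and n: "x * cnj x \<in> \<int>"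
    have "of_int a + of_int b * w \<in> K" using add[OF int intmult[OF w(1)]] iff by blast
    hence q: "Re (of_int k * x) \<in> \<rat>" "Im (of_int k * x) / y \<in> \<rat>" unfolding k(2) K by blast+
    have "Re (of_int k * x) / of_int k \<in> \<rat>" "(Im (of_int k * x) / y) / of_int k \<in> \<rat>"
      by (rule Rats_divide[OF q(1) Rats_of_int], rule Rats_divide[OF q(2) Rats_of_int])
    moreover have "Re (of_int k * x) / of_int k = Re x" "(Im (of_int k * x) / y) / of_int k = Im x / y"
      using k(1) by simp_all
    ultimately have xK: "x \<in> K" unfolding K by simp
    obtain t' where "x + cnj x = of_int t'" using t by (rule Ints_cases)
    hence "Re (x + cnj x) = of_int t'" by simp
    hence "2 * Re x = of_int t'" by simp
    moreover obtain n' where n': "x * cnj x = of_int n'" using n by (rule Ints_cases)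
    have "complex_of_real ((cmod x)\<^sup>2) = of_int n'" unfolding complex_norm_square n' ..
    hence "(cmod x)\<^sup>2 = of_int n'" by (metis of_real_eq_iff of_real_of_int_eq)
    ultimately have "x \<in> ?O" using iff xK by (metis Ints_of_int)
    thus "\<exists>a b. x = of_int a + of_int b * w" by (rule lattice)
  qed
  have "?O = imag_quadratic.Ok w"
  proof
    show "?O \<subseteq> imag_quadratic.Ok w" unfolding imag_quadratic.Ok_def[OF loc] using lattice by blast
    show "imag_quadratic.Ok w \<subseteq> ?O" unfolding imag_quadratic.Ok_def[OF loc] using add[OF int intmult[OF w(1)]] by blast
  qed
  thus ?thesis using that loc y K by blast
qed

section \<open>Embeddings, trace and discriminant\<close>

lemma field_trace_eq:
  assumes y: "y > 0" "y\<^sup>2 \<in> \<rat>" and K: "K = {z. Re z \<in> \<rat> \<and> Im z / y \<in> \<rat>}" and x: "x \<in> K"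
  shows "field_trace K x = x + cnj x"
proof -
  let ?id = "restrict (\<lambda>z. z) K" and ?cnj = "restrict cnj K"
  note arith = rat_span_arith[OF y, folded K]
  define j where "j = Complex 0 y"
  have real_K: "of_real r \<in> K" if "r \<in> \<rat>" for r using that unfolding K by simp
  have jK: "j \<in> K" unfolding j_def K using y by simp
  have "field_embeddings K = {?id, ?cnj}"
  proof
    have h: "restrict f K \<in> field_embeddings K"
      if "\<And>a b. f (a + b) = f a + f b" "\<And>a b. f (a * b) = f a * f b" "f 1 = 1" for f
      unfolding field_embeddings_def ring_hom_def using that arith(1,2) real_K[of 1] by simp
    show "{?id, ?cnj} \<subseteq> field_embeddings K" using h[of "\<lambda>z. z"] h[of cnj] by simp
    show "field_embeddings K \<subseteq> {?id, ?cnj}"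
    proof
      fix f assume "f \<in> field_embeddings K"
      hence f: "\<And>a b. a \<in> K \<Longrightarrow> b \<in> K \<Longrightarrow> f (a + b) = f a + f b"
        "\<And>a b. a \<in> K \<Longrightarrow> b \<in> K \<Longrightarrow> f (a * b) = f a * f b" "f 1 = 1" "f \<in> extensional K"
        unfolding field_embeddings_def ring_hom_def by auto
      have f0: "f 0 = 0" using f(1)[of 0 0] real_K[of 0] by simp
      have fnat: "f (of_nat n) = of_nat n" for n
      proof (induction n)
        case (Suc n)
        have "f (1 + of_nat n) = f 1 + f (of_nat n)" using real_K[of 1] real_K[of "of_nat n"] by (intro f(1)) simp_all
        thus ?case using Suc f(3) by simp
      qed (use f0 in simp)
      have fneg: "f (- x) = - f x" if "x \<in> K" for x
      proof -
        have "- x \<in> K" using that unfolding K by simp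
        hence "f x + f (- x) = 0" using f(1)[OF that] f0 by (metis add.right_inverse)
        thus ?thesis by (simp add: add_eq_0_iff)
      qed
      have fint: "f (of_int n) = of_int n" for n
      proof (cases "n \<ge> 0")
        case True thus ?thesis using fnat[of "nat n"] by simp
      next
        case False
        have "f (- of_nat (nat (- n))) = - f (of_nat (nat (- n)))" using real_K[of "of_nat (nat (- n))"] by (intro fneg) simp
        thus ?thesis using fnat[of "nat (- n)"] False by simp
      qed
      have frat: "f (of_real r) = of_real r" if "r \<in> \<rat>" for r
      proof -
        obtain a b where ab: "b > 0" "r = of_int a / of_int b" using \<open>r \<in> \<rat>\<close> by (auto elim: Rats_cases')
        have e: "of_int b * of_real r = (of_int a :: complex)" unfolding ab(2) using ab(1) by simp
        have "f (of_int b * of_real r) = f (of_int b) * f (of_real r)"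
          using real_K[of "of_int b"] real_K[OF \<open>r \<in> \<rat>\<close>] by (intro f(2)) simp_all
        hence "of_int b * f (of_real r) = of_int b * (of_real r :: complex)" unfolding e fint by simp
        thus ?thesis using ab(1) by simp
      qed
      \<comment> \<open>Every embedding fixes the rational number j^2, so it sends j to j or -j, and
        that choice determines it.\<close>
      have "j * j = of_real (- y\<^sup>2)" unfolding j_def by (simp add: complex_eq_iff power2_eq_square)
      hence "f j * f j = j * j" using f(2)[OF jK jK] frat[of "- y\<^sup>2"] y(2) by simp
      hence fj: "f j = j \<or> f j = - j" by (simp add: square_eq_iff)
      have dec: "z = of_real (Re z) + of_real (Im z / y) * j" for z
        unfolding j_def using y(1) by (simp add: complex_eq_iff)
      have fz: "f z = of_real (Re z) + of_real (Im z / y) * f j" if "z \<in> K" for z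
      proof -
        have q: "Re z \<in> \<rat>" "Im z / y \<in> \<rat>" using that unfolding K by auto
        have "f z = f (of_real (Re z) + of_real (Im z / y) * j)" using dec[of z] by (rule arg_cong)
        also have "\<dots> = f (of_real (Re z)) + f (of_real (Im z / y)) * f j"
          using f(1)[OF real_K[OF q(1)] arith(2)[OF real_K[OF q(2)] jK]] f(2)[OF real_K[OF q(2)] jK] by (rule trans[OF _ arg_cong])
        finally show ?thesis unfolding frat[OF q(1)] frat[OF q(2)] .
      qed
      have cj: "cnj j = - j" unfolding j_def by (simp add: complex_eq_iff)
      have cdec: "cnj z = of_real (Re z) + of_real (Im z / y) * (- j)" for z
        unfolding j_def using y(1) by (simp add: complex_eq_iff)
      from fj show "f \<in> {?id, ?cnj}"
      proof
        assume j: "f j = j"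
        have "f = ?id"
        proof (rule extensionalityI[OF f(4) restrict_extensional])
          fix z assume z: "z \<in> K"
          show "f z = ?id z" unfolding fz[OF z] j dec[symmetric] using z by simp
        qed
        thus ?thesis by simp
      next
        assume j: "f j = - j"
        have "f = ?cnj"
        proof (rule extensionalityI[OF f(4) restrict_extensional])
          fix z assume z: "z \<in> K"
          show "f z = ?cnj z" unfolding fz[OF z] j cdec[symmetric] using z by simp
        qed
        thus ?thesis by simp
      qed
    qed
  qed
  moreover have "?id \<noteq> ?cnj"
  proof
    assume "?id = ?cnj"
    hence "?id j = ?cnj j" by (rule fun_cong)
    hence "j = cnj j" using jK by simp
    thus False unfolding j_def using y by (simp add: complex_eq_iff)
  qed
  ultimately show ?thesis unfolding field_trace_def using x by simp
qed

text \<open>The Gram determinant of u, v is the square of u v' - u' v, which is the coordinate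
  determinant times w' - w. That determinant is 1 or -1 for every integral basis, so the definite
  description is unique.\<close>

lemma quadratic_discriminant_eq:
  assumes loc: "imag_quadratic w tw nw" and O: "integers_of K = imag_quadratic.Ok w"
    and y: "y > 0" "y\<^sup>2 \<in> \<rat>" and K: "K = {z. Re z \<in> \<rat> \<and> Im z / y \<in> \<rat>}"
  shows "real_of_int (quadratic_discriminant K) = - 4 * (Im w)\<^sup>2"
proof -
  interpret imag_quadratic w tw nw by (rule loc)
  note arith = rat_span_arith[OF y, folded K]
  define gram where "gram = (\<lambda>u v. field_trace K (u * u) * field_trace K (v * v) - field_trace K (u * v) * field_trace K (v * u))"
  have OK: "x \<in> K" if "x \<in> Ok" for x using that unfolding O[symmetric] integers_of_def by simp
  have gram: "gram u v = (u * cnj v - cnj u * v)\<^sup>2" if "u \<in> Ok" "v \<in> Ok" for u v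
    unfolding gram_def using OK[OF that(1)] OK[OF that(2)] arith(2)
    by (simp add: field_trace_eq[OF y K] power2_eq_square algebra_simps)
  have lat: "(u * cnj v - cnj u * v) = of_int (a * d - b * c) * (cnj w - w)"
    if "u = of_int a + of_int b * w" "v = of_int c + of_int d * w" for u v a b c d
    unfolding that by (simp add: algebra_simps)
  have ww: "(cnj w - w)\<^sup>2 = of_int (tw\<^sup>2 - 4 * nw)"
  proof -
    have "(cnj w - w)\<^sup>2 = (w + cnj w)\<^sup>2 - 4 * (w * cnj w)" by (simp add: power2_eq_square algebra_simps)
    thus ?thesis unfolding trace_w norm_w by simp
  qed
  have basis: "gram u v = of_int (tw\<^sup>2 - 4 * nw)" if B: "integral_basis2 K u v" for u v
  proof -
    have uv: "u \<in> Ok" "v \<in> Ok" and ex: "\<And>x. x \<in> Ok \<Longrightarrow> \<exists>a b. x = of_int a * u + of_int b * v"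
      using B unfolding integral_basis2_def O by (auto, blast)
    obtain a b where u: "u = of_int a + of_int b * w" using uv(1) by (rule OkE)
    obtain c d where v: "v = of_int c + of_int d * w" using uv(2) by (rule OkE)
    obtain a' b' where 1: "1 = of_int a' * u + of_int b' * v" using ex[OF Ok_1] by blast
    obtain c' d' where 2: "w = of_int c' * u + of_int d' * v" using ex[OF Ok_w] by blast
    have "of_int 1 + of_int 0 * w = of_int (a' * a + b' * c) + of_int (a' * b + b' * d) * w"
      using 1 unfolding u v by (simp add: algebra_simps)
    hence e1: "1 = a' * a + b' * c" "0 = a' * b + b' * d" using coords_eq by blast+
    have "of_int 0 + of_int 1 * w = of_int (c' * a + d' * c) + of_int (c' * b + d' * d) * w"
      using 2 unfolding u v by (simp add: algebra_simps)
    hence e2: "0 = c' * a + d' * c" "1 = c' * b + d' * d" using coords_eq by blast+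
    \<comment> \<open>The two base changes are inverse to each other, so their integer determinants
      multiply to 1.\<close>
    have "(a * d - b * c) * (a' * d' - b' * c') = (a' * a + b' * c) * (c' * b + d' * d) - (a' * b + b' * d) * (c' * a + d' * c)"
      by (simp add: algebra_simps)
    hence "(a * d - b * c) * (a' * d' - b' * c') = 1" unfolding e1[symmetric] e2[symmetric] by simp
    hence "a * d - b * c = 1 \<or> a * d - b * c = -1" unfolding zmult_eq_1_iff by blast
    hence "(a * d - b * c)\<^sup>2 = 1" by auto
    hence sq: "(of_int (a * d - b * c) :: complex)\<^sup>2 = 1" by (metis of_int_1 of_int_power)
    show ?thesis unfolding gram[OF uv] lat[OF u v] power_mult_distrib sq ww by simp
  qed
  have wbasis: "integral_basis2 K 1 w"
    unfolding integral_basis2_def O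
  proof (intro conjI ballI Ok_1 Ok_w)
    fix x assume "x \<in> Ok"
    then obtain a b where x: "x = of_int a + of_int b * w" by (rule OkE)
    show "\<exists>!(a, b). x = of_int a * 1 + of_int b * w"
    proof (rule ex1I[of _ "(a, b)"])
      show "case (a, b) of (a, b) \<Rightarrow> x = of_int a * 1 + of_int b * w" using x by simp
      fix p assume p: "case p of (a, b) \<Rightarrow> x = of_int a * 1 + of_int b * w"
      obtain c d where cd: "p = (c, d)" by (metis surj_pair)
      have "of_int c + of_int d * w = of_int a + of_int b * w" using p x unfolding cd by simp
      thus "p = (a, b)" using coords_eq unfolding cd by blast
    qed
  qed
  have "quadratic_discriminant K = tw\<^sup>2 - 4 * nw"
    unfolding quadratic_discriminant_def
  proof (rule the_equality)
    show "\<exists>u v. integral_basis2 K u v \<and> of_int (tw\<^sup>2 - 4 * nw) =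
        field_trace K (u * u) * field_trace K (v * v) - field_trace K (u * v) * field_trace K (v * u)"
      using wbasis basis[OF wbasis] unfolding gram_def by metis
    fix D assume "\<exists>u v. integral_basis2 K u v \<and> of_int D =
        field_trace K (u * u) * field_trace K (v * v) - field_trace K (u * v) * field_trace K (v * u)"
    then obtain u v where "integral_basis2 K u v" "of_int D = gram u v" unfolding gram_def by blast
    hence "of_int D = (of_int (tw\<^sup>2 - 4 * nw) :: complex)" using basis by simp
    thus "D = tw\<^sup>2 - 4 * nw" by (simp only: of_int_eq_iff)
  qed
  moreover have "real_of_int (tw\<^sup>2 - 4 * nw) = Re ((cnj w - w)\<^sup>2)" unfolding ww by simp
  moreover have "Re ((cnj w - w)\<^sup>2) = - 4 * (Im w)\<^sup>2" by (simp add: power2_eq_square)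
  ultimately show ?thesis by simp
qed

section \<open>Agreement with the abstract ideals, norms and divisor counts\<close>

context imag_quadratic begin

lemma ring_Ok: "ring (complex_ring\<lparr>carrier := Ok\<rparr>)"
proof -
  interpret ring complex_ring by (rule complex_ring_ring)
  have "subring Ok complex_ring"
    by (rule subringI) (auto intro: Ok_1 Ok_minus Ok_mult Ok_add)
  thus ?thesis by (rule subring_is_ring)
qed

lemma ideal_iff_idl: "ideal I (complex_ring\<lparr>carrier := Ok\<rparr>) \<and> I \<noteq> {0} \<longleftrightarrow> idl I"
proof
  assume A: "ideal I (complex_ring\<lparr>carrier := Ok\<rparr>) \<and> I \<noteq> {0}"
  hence I: "ideal I (complex_ring\<lparr>carrier := Ok\<rparr>)" by simp
  note S = ideal.axioms(1)[OF I]
  have z: "0 \<in> I" using additive_subgroup.zero_closed[OF S] by simp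
  then obtain x where "x \<in> I" "x \<noteq> 0" using A by blast
  thus "idl I"
    using additive_subgroup.a_subset[OF S] additive_subgroup.a_closed[OF S] ideal.I_l_closed[OF I] z
    by (intro idlI[of I x]) auto
next
  assume I: "idl I"
  interpret R: ring "complex_ring\<lparr>carrier := Ok\<rparr>" by (rule ring_Ok)
  have "ideal I (complex_ring\<lparr>carrier := Ok\<rparr>)"
  proof (rule idealI[OF ring_Ok])
    show "subgroup I (add_monoid (complex_ring\<lparr>carrier := Ok\<rparr>))"
    proof (rule R.add.subgroupI)
      show "I \<subseteq> carrier (complex_ring\<lparr>carrier := Ok\<rparr>)" using idl_sub[OF I] by simp
      show "I \<noteq> {}" using idl_0[OF I] by auto
      show "a \<oplus>\<^bsub>complex_ring\<lparr>carrier := Ok\<rparr>\<^esub> b \<in> I" if "a \<in> I" "b \<in> I" for a b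
        using idl_add[OF I that] by simp
      show "\<ominus>\<^bsub>complex_ring\<lparr>carrier := Ok\<rparr>\<^esub> a \<in> I" if a: "a \<in> I" for a
      proof -
        have "a \<in> Ok" using a idl_sub[OF I] by blast
        hence "\<ominus>\<^bsub>complex_ring\<lparr>carrier := Ok\<rparr>\<^esub> a = - a"
          by (intro R.minus_equality) (simp_all add: Ok_minus)
        thus ?thesis using idl_minus[OF I a] by simp
      qed
    qed
    fix a x assume "a \<in> I" "x \<in> carrier (complex_ring\<lparr>carrier := Ok\<rparr>)"
    thus "x \<otimes>\<^bsub>complex_ring\<lparr>carrier := Ok\<rparr>\<^esub> a \<in> I" "a \<otimes>\<^bsub>complex_ring\<lparr>carrier := Ok\<rparr>\<^esub> x \<in> I"
      using idl_mult[OF I, of x a] by (simp_all add: mult.commute)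
  qed
  moreover have "I \<noteq> {0}" using idl_nonzero[OF I] by blast
  ultimately show "ideal I (complex_ring\<lparr>carrier := Ok\<rparr>) \<and> I \<noteq> {0}" ..
qed

text \<open>\<open>nrm\<close> was written with these very cosets, so the two sets coincide.\<close>

lemma card_Quot: "card (carrier ((complex_ring\<lparr>carrier := Ok\<rparr>) Quot I)) = nrm I"
proof -
  have "carrier ((complex_ring\<lparr>carrier := Ok\<rparr>) Quot I) = (\<lambda>x. (\<lambda>h. h + x) ` I) ` Ok"
    unfolding FactRing_def by (auto simp: A_RCOSETS_def' a_r_coset_def')
  thus ?thesis unfolding nrm_def by simp
qed

end

lemma of_nat_powr_minus_2: "n > 0 \<Longrightarrow> (of_nat n :: complex) powr (- 2) = of_real (1 / (real n)\<^sup>2)"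
  using powr_of_int[of "of_nat n" "-2"] by (simp add: inverse_eq_divide)

lemma dedekind_zeta_2:
  assumes loc: "imag_quadratic w tw nw" and O: "integers_of K = imag_quadratic.Ok w"
  shows "dedekind_zeta K 2 = of_real (imag_quadratic.zeta2 w)"
proof -
  interpret imag_quadratic w tw nw by (rule loc)
  have "dedekind_zeta K 2 = (\<Sum>\<^sub>\<infinity>I\<in>Idls. of_real (1 / (real (nrm I))\<^sup>2))"
    unfolding dedekind_zeta_def ideal_norm_def ring_of_integers_def O ideal_iff_idl card_Quot
    by (rule infsum_cong) (use nrm_pos of_nat_powr_minus_2 in simp)
  also have "\<dots> = of_real zeta2"
    unfolding zeta2_def by (rule infsumI) (simp only: has_sum_of_real_iff has_sum_infsum nrm_2_summable)
  finally show ?thesis .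
qed

lemma divisor_count_eq:
  assumes loc: "imag_quadratic w tw nw" and O: "integers_of K = imag_quadratic.Ok w"
  shows "divisor_count K x = card (imag_quadratic.divs w x)"
proof -
  interpret imag_quadratic w tw nw by (rule loc)
  show ?thesis
    unfolding divisor_count_def divs_def dvdO_def factor_def ring_of_integers_def O by simp
qed

lemma bigo_T_ln_T:
  fixes f :: "real \<Rightarrow> real"
  assumes "C \<ge> 0" "\<And>T. T \<ge> 1 \<Longrightarrow> \<bar>f T\<bar> \<le> C * (T * (1 + ln T))"
  shows "(\<lambda>T. complex_of_real (f T)) \<in> O[at_top](\<lambda>T. complex_of_real (T * ln T))"
proof (rule bigoI[of _ "2 * C"])
  show "eventually (\<lambda>T. norm (complex_of_real (f T)) \<le> 2 * C * norm (complex_of_real (T * ln T))) at_top"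
    \<comment> \<open>From e on, ln T \<ge> 1 and so 1 + ln T \<le> 2 ln T.\<close>
    using eventually_ge_at_top[of "exp 1 :: real"]
  proof eventually_elim
    case (elim T)
    have "T \<ge> 1" using elim one_le_exp_iff[of "1::real"] by linarith
    have "ln (exp 1) \<le> ln T"
      by (rule ln_le_cancel_iff[THEN iffD2, OF _ _ elim]) (use \<open>T \<ge> 1\<close> in simp_all)
    hence l: "ln T \<ge> 1" by simp
    have "\<bar>f T\<bar> \<le> C * (T * (1 + ln T))" by (rule assms(2)[OF \<open>T \<ge> 1\<close>])
    also have "\<dots> \<le> C * (T * (2 * ln T))" using l \<open>T \<ge> 1\<close> assms(1) by (intro mult_left_mono) auto
    also have "\<dots> = 2 * C * \<bar>T * ln T\<bar>" using l \<open>T \<ge> 1\<close> by simp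
    finally show ?case by (simp only: norm_of_real)
  qed
qed

theorem theorem2:
  fixes K :: "complex set"
  assumes "imaginary_quadratic_field K"
  shows "(\<lambda>T::real.
            of_nat (\<Sum>x\<in>{x \<in> integers_of K - {0, -1}. (cmod x)\<^sup>2 \<le> T}.
                      divisor_count K x * divisor_count K (x + 1))
            - of_real (8 * pi ^ 3)
                / (of_real (\<bar>real_of_int (quadratic_discriminant K)\<bar> powr (3 / 2)) * dedekind_zeta K 2)
                * of_real (T * (ln T)\<^sup>2))
         \<in> O[at_top](\<lambda>T. complex_of_real (T * ln T))"
proof -
  obtain w tw nw y where loc: "imag_quadratic w tw nw" and O: "integers_of K = imag_quadratic.Ok w"
    and y: "y > 0" "y\<^sup>2 \<in> \<rat>" "K = {z. Re z \<in> \<rat> \<and> Im z / y \<in> \<rat>}"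
    using integers_of_lattice[OF assms] by blast
  interpret imag_quadratic w tw nw by (rule loc)
  obtain C where C: "C \<ge> 0" "\<And>T. T \<ge> 1 \<Longrightarrow>
     \<bar>real (\<Sum>x\<in>{x \<in> Ok - {0, -1}. (cmod x)\<^sup>2 \<le> T}. card (divs x) * card (divs (x + 1)))
        - (pi / Im w) ^ 3 * muzeta2 * (T * (ln T)\<^sup>2)\<bar> \<le> C * (T * (1 + ln T))"
    using divisor_correlation by blast
  \<comment> \<open>Since the absolute discriminant is (2 Im w)^2, this power is (2 Im w)^3. The 8
    of the statement cancels 2^3, leaving (\<pi> / Im w)^3.\<close>
  define D where "D = \<bar>real_of_int (quadratic_discriminant K)\<bar> powr (3 / 2)"
  have "\<bar>real_of_int (quadratic_discriminant K)\<bar> = (2 * Im w)\<^sup>2"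
    unfolding quadratic_discriminant_eq[OF loc O y] by (simp add: power_mult_distrib)
  also have "(2 * Im w)\<^sup>2 = (2 * Im w) powr 2" using Im_w by simp
  finally have "D = (2 * Im w) powr 3" unfolding D_def by (simp add: powr_powr)
  hence D: "D = (2 * Im w) ^ 3" using Im_w by simp
  have z: "zeta2 \<noteq> 0" "muzeta2 = 1 / zeta2" using zeta2_muzeta2 by (auto simp: eq_divide_eq mult.commute)
  have const: "8 * pi ^ 3 / (D * zeta2) = (pi / Im w) ^ 3 * muzeta2"
    unfolding D z(2) using Im_w z(1) by (simp add: power_mult_distrib power_divide)
  have "(\<lambda>T. complex_of_real (real (\<Sum>x\<in>{x \<in> Ok - {0, -1}. (cmod x)\<^sup>2 \<le> T}. card (divs x) * card (divs (x + 1)))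
        - (pi / Im w) ^ 3 * muzeta2 * (T * (ln T)\<^sup>2))) \<in> O[at_top](\<lambda>T. complex_of_real (T * ln T))"
    by (rule bigo_T_ln_T[OF C])
  moreover have "of_nat (\<Sum>x\<in>{x \<in> integers_of K - {0, -1}. (cmod x)\<^sup>2 \<le> T}. divisor_count K x * divisor_count K (x + 1))
      - of_real (8 * pi ^ 3) / (of_real (\<bar>real_of_int (quadratic_discriminant K)\<bar> powr (3 / 2)) * dedekind_zeta K 2)
          * of_real (T * (ln T)\<^sup>2)
    = complex_of_real (real (\<Sum>x\<in>{x \<in> Ok - {0, -1}. (cmod x)\<^sup>2 \<le> T}. card (divs x) * card (divs (x + 1)))
        - (pi / Im w) ^ 3 * muzeta2 * (T * (ln T)\<^sup>2))" for T
    unfolding divisor_count_eq[OF loc O] dedekind_zeta_2[OF loc O] O D_def[symmetric] const[symmetric] by simp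
  ultimately show ?thesis by (simp only:)
qed

end
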